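(* Let $k$ be a field of positive characteristic $p$ and let $S_r=\mathfrak S_r$. Let $B_R$ be the right generalized Schur algebra of $S_r=\mathfrak S_r$ over $k$. There is one isomorphism class of irreducible left $B_R$-modules for each choice of the following data (i.e. the isomorphism classes are in bijection with the set of such choices): 1. a decomposition $r=\sum_{i\ge 0}s_ip^i$ with integers $s_i\ge 0$; and 2. a $p$-regular partition of $s_i$ for each $i$ with $s_i>0$.
   Context: Fix integers $r\ge 1$ and $n\ge r$. Let $S_r=\mathfrak S_r$ be the symmetric group on $\{1,\dots,r\}$, with product $(\alpha\beta)(x)=\alpha(\beta(x))$. $\Lambda$ is the set of compositions $\lambda=(\lambda_1,\dots,\lambda_n)$ of $r$ ($\lambda_i\ge 0$ integers, $\sum\lambda_i=r$). The $\lambda$-blocks are $b_i^\lambda=\{k:\lambda_1+\dots+\lambda_{i-1}<k\le\lambda_1+\dots+\lambda_i\}$, and $G_\lambda=\mathfrak S_\lambda\subseteq\mathfrak S_r$ is the Young subgroup of all permutations mapping each $\lambda$-block to itself. ${}_\lambda M_\mu$ is the set of double cosets $G_\lambda\alpha G_\mu$, $\alpha\in S_r$. For $\alpha\in S_r$ put $G_R(\lambda,\alpha,\mu)=\{\sigma\in G_\lambda:\exists\pi\in G_\mu,\ \sigma\alpha=\alpha\pi\}$; its order $n_R(\lambda,\alpha,\mu)$ depends only on $D=G_\lambda\alpha G_\mu$ and is also written $n_R(D)$. For $D_\alpha=G_\lambda\alpha G_\nu$, $D_\beta=G_\nu\beta G_\mu$, $D\in{}_\lambda M_\mu$ let $N(D_\alpha,D_\beta,D)=\#\{\rho\in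 G_\nu:\alpha\rho\beta\in D\}$ (independent of representatives). The right generalized Schur algebra $B_R$ is the $k$-algebra with $k$-basis $\{f(\lambda,D,\mu):\lambda,\mu\in\Lambda,\ D\in{}_\lambda M_\mu\}$, writing $f(\lambda,\alpha,\mu)=f(\lambda,G_\lambda\alpha G_\mu,\mu)$, and product given by $f(\lambda,\alpha,\nu)*_R f(\omega,\beta,\mu)=0$ if $\nu\ne\omega$ and $$f(\lambda,\alpha,\nu)*_R f(\nu,\beta,\mu)=\sum_{D\in{}_\lambda M_\mu}\frac{n_R(D)\,N(D_\alpha,D_\beta,D)}{n_R(\lambda,\alpha,\nu)\,n_R(\nu,\beta,\mu)}f(\lambda,D,\mu);$$ the coefficients are nonnegative integers, read in $k$. This is an associative algebra with identity $\sum_{\lambda\in\Lambda}f(\lambda,1,\lambda)$. (For $S_r=\mathfrak S_r$ it is identified with the classical Schur algebra $S_k(r,n)$, up to passing to the opposite algebra.) A partition is $p$-regular if no nonzero part is repeated $p$ or more times. *)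

theory Defs
  imports "HOL-Algebra.Module" "HOL-Library.Multiset" "HOL-Combinatorics.Permutations"
begin

section \<open>Left modules over a ring that need not be commutative\<close>

text \<open>The library locale \<^locale>\<open>module\<close> requires a commutative ring of scalars. The record type and
  the locale \<^locale>\<open>submodule\<close> do not, and are reused here. The fields for multiplication and one in the
  record of a module are unused.\<close>

locale left_module = R?: ring R + M?: abelian_group M for R (structure) and M (structure) +
  assumes smult_closed:
      "\<lbrakk>a \<in> carrier R; x \<in> carrier M\<rbrakk> \<Longrightarrow> a \<odot>\<^bsub>M\<^esub> x \<in> carrier M"
    and smult_l_distr:
      "\<lbrakk>a \<in> carrier R; b \<in> carrier R; x \<in> carrier M\<rbrakk> \<Longrightarrow>
        (a \<oplus>\<^bsub>R\<^esub> b) \<odot>\<^bsub>M\<^esub> x = a \<odot>\<^bsub>M\<^esub> x \<oplus>\<^bsub>M\<^esub> b \<odot>\<^bsub>M\<^esub> x"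
    and smult_r_distr:
      "\<lbrakk>a \<in> carrier R; x \<in> carrier M; y \<in> carrier M\<rbrakk> \<Longrightarrow>
        a \<odot>\<^bsub>M\<^esub> (x \<oplus>\<^bsub>M\<^esub> y) = a \<odot>\<^bsub>M\<^esub> x \<oplus>\<^bsub>M\<^esub> a \<odot>\<^bsub>M\<^esub> y"
    and smult_assoc:
      "\<lbrakk>a \<in> carrier R; b \<in> carrier R; x \<in> carrier M\<rbrakk> \<Longrightarrow>
        (a \<otimes>\<^bsub>R\<^esub> b) \<odot>\<^bsub>M\<^esub> x = a \<odot>\<^bsub>M\<^esub> (b \<odot>\<^bsub>M\<^esub> x)"
    and smult_one:
      "x \<in> carrier M \<Longrightarrow> \<one>\<^bsub>R\<^esub> \<odot>\<^bsub>M\<^esub> x = x"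

definition irreducible_left_module :: "'a ring \<Rightarrow> ('a, 'm) module \<Rightarrow> bool" where
  "irreducible_left_module R M \<longleftrightarrow>
     left_module R M \<and> carrier M \<noteq> {\<zero>\<^bsub>M\<^esub>} \<and>
     (\<forall>H. submodule H R M \<longrightarrow> H = {\<zero>\<^bsub>M\<^esub>} \<or> H = carrier M)"

definition left_module_iso :: "'a ring \<Rightarrow> ('a, 'm) module \<Rightarrow> ('a, 'n) module \<Rightarrow> bool" where
  "left_module_iso R M N \<longleftrightarrow>
     (\<exists>h. bij_betw h (carrier M) (carrier N) \<and>
          (\<forall>x\<in>carrier M. \<forall>y\<in>carrier M. h (x \<oplus>\<^bsub>M\<^esub> y) = h x \<oplus>\<^bsub>N\<^esub> h y) \<and>
          (\<forall>a\<in>carrier R. \<forall>x\<in>carrier M. h (a \<odot>\<^bsub>M\<^esub> x) = a \<odot>\<^bsub>N\<^esub> h x))"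

definition irreducible_classes :: "'a ring \<Rightarrow> ('a, 'm) module set set" where
  "irreducible_classes R =
     {M. irreducible_left_module R M} //
     {(M, N). irreducible_left_module R M \<and> irreducible_left_module R N \<and> left_module_iso R M N}"


section \<open>Compositions, Young subgroups and double cosets\<close>

definition compositions :: "nat \<Rightarrow> nat \<Rightarrow> nat list set" where
  "compositions r n = {lam. length lam = n \<and> sum_list lam = r}"

text \<open>Blocks are indexed from \<open>0\<close>, so \<open>block lam i\<close> is the block usually numbered \<open>i + 1\<close>.\<close>

definition block :: "nat list \<Rightarrow> nat \<Rightarrow> nat set" where
  "block lam i = {k. sum_list (take i lam) < k \<and> k \<le> sum_list (take (Suc i) lam)}"

definition young :: "nat \<Rightarrow> nat list \<Rightarrow> (nat \<Rightarrow> nat) set" where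
  "young r lam =
     {\<sigma>. \<sigma> permutes {1..r} \<and> (\<forall>i<length lam. \<sigma> ` block lam i = block lam i)}"

definition double_coset ::
  "nat \<Rightarrow> nat list \<Rightarrow> (nat \<Rightarrow> nat) \<Rightarrow> nat list \<Rightarrow> (nat \<Rightarrow> nat) set" where
  "double_coset r lam \<alpha> mu = {\<sigma> \<circ> \<alpha> \<circ> \<pi> | \<sigma> \<pi>. \<sigma> \<in> young r lam \<and> \<pi> \<in> young r mu}"

definition double_cosets :: "nat \<Rightarrow> nat list \<Rightarrow> nat list \<Rightarrow> (nat \<Rightarrow> nat) set set" where
  "double_cosets r lam mu = {double_coset r lam \<alpha> mu | \<alpha>. \<alpha> permutes {1..r}}"

definition G_R :: "nat \<Rightarrow> nat list \<Rightarrow> (nat \<Rightarrow> nat) \<Rightarrow> nat list \<Rightarrow> (nat \<Rightarrow> nat) set" where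
  "G_R r lam \<alpha> mu = {\<sigma> \<in> young r lam. \<exists>\<pi>\<in>young r mu. \<sigma> \<circ> \<alpha> = \<alpha> \<circ> \<pi>}"

definition n_R :: "nat \<Rightarrow> nat list \<Rightarrow> (nat \<Rightarrow> nat) \<Rightarrow> nat list \<Rightarrow> nat" where
  "n_R r lam \<alpha> mu = card (G_R r lam \<alpha> mu)"

text \<open>The numbers attached to double cosets below do not depend on the chosen representatives.\<close>

definition rep :: "(nat \<Rightarrow> nat) set \<Rightarrow> nat \<Rightarrow> nat" where
  "rep D = (SOME \<alpha>. \<alpha> \<in> D)"

definition n_R_coset :: "nat \<Rightarrow> nat list \<Rightarrow> (nat \<Rightarrow> nat) set \<Rightarrow> nat list \<Rightarrow> nat" where
  "n_R_coset r lam D mu = n_R r lam (rep D) mu"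

definition N_coset ::
  "nat \<Rightarrow> nat list \<Rightarrow> (nat \<Rightarrow> nat) set \<Rightarrow> (nat \<Rightarrow> nat) set \<Rightarrow> (nat \<Rightarrow> nat) set \<Rightarrow> nat" where
  "N_coset r nu D\<^sub>1 D\<^sub>2 D = card {\<rho> \<in> young r nu. rep D\<^sub>1 \<circ> \<rho> \<circ> rep D\<^sub>2 \<in> D}"


section \<open>The right generalized Schur algebra of the symmetric group\<close>

text \<open>A triple \<open>(lam, D, mu)\<close> is the index of the basis element \<open>f(lam, D, mu)\<close>. An element of the
  algebra is the family of its coefficients, extended by \<open>0\<close> outside the index set.\<close>

type_synonym schur_index = "nat list \<times> (nat \<Rightarrow> nat) set \<times> nat list"

definition schur_indices :: "nat \<Rightarrow> nat \<Rightarrow> schur_index set" where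
  "schur_indices r n =
     {(lam, D, mu). lam \<in> compositions r n \<and> mu \<in> compositions r n \<and> D \<in> double_cosets r lam mu}"

text \<open>The coefficient of the third basis element in the product of the first two. The division
  is exact.\<close>

fun schur_coeff :: "nat \<Rightarrow> schur_index \<Rightarrow> schur_index \<Rightarrow> schur_index \<Rightarrow> nat" where
  "schur_coeff r (lam, D\<^sub>1, nu) (om, D\<^sub>2, mu) (lam', D, mu') =
     (if nu = om \<and> lam' = lam \<and> mu' = mu
      then (n_R_coset r lam D mu * N_coset r nu D\<^sub>1 D\<^sub>2 D) div
           (n_R_coset r lam D\<^sub>1 nu * n_R_coset r nu D\<^sub>2 mu)
      else 0)"

definition right_schur_algebra :: "nat \<Rightarrow> nat \<Rightarrow> (schur_index \<Rightarrow> 'k::field) ring" where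
  "right_schur_algebra r n =
     \<lparr> carrier = {a. \<forall>z. z \<notin> schur_indices r n \<longrightarrow> a z = 0},
       monoid.mult = (\<lambda>a b z.
         if z \<in> schur_indices r n
         then (\<Sum>x\<in>schur_indices r n. \<Sum>y\<in>schur_indices r n. a x * b y * of_nat (schur_coeff r x y z))
         else 0),
       one = (\<lambda>(lam, D, mu).
         if lam \<in> compositions r n \<and> mu = lam \<and> D = double_coset r lam id lam then 1 else 0),
       zero = (\<lambda>z. 0),
       add = (\<lambda>a b z. a z + b z) \<rparr>"


section \<open>The parametrizing data\<close>

definition is_partition_of :: "nat multiset \<Rightarrow> nat \<Rightarrow> bool" where
  "is_partition_of \<pi> m \<longleftrightarrow> 0 \<notin># \<pi> \<and> sum_mset \<pi> = m"

definition p_regular :: "nat \<Rightarrow> nat multiset \<Rightarrow> bool" where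
  "p_regular p \<pi> \<longleftrightarrow> (\<forall>a. a \<noteq> 0 \<longrightarrow> count \<pi> a < p)"

text \<open>A choice is a pair \<open>(s, \<pi>)\<close>. There is nothing to choose at the indices \<open>i\<close> with \<open>s i = 0\<close>, so
  \<open>\<pi> i\<close> is normalized to the empty multiset there.\<close>

definition choices :: "nat \<Rightarrow> nat \<Rightarrow> ((nat \<Rightarrow> nat) \<times> (nat \<Rightarrow> nat multiset)) set" where
  "choices p r =
     {(s, \<pi>). finite {i. s i \<noteq> 0} \<and> r = (\<Sum>i | s i \<noteq> 0. s i * p ^ i) \<and>
        (\<forall>i. if s i > 0 then is_partition_of (\<pi> i) (s i) \<and> p_regular p (\<pi> i) else \<pi> i = {#})}"

end

theory Submission
  imports Defs "HOL-Algebra.Ideal" "HOL-Library.FuncSet" "HOL-Library.List_Lexorder"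
begin

text \<open>Multiplying the structure constants out shows that the coefficient of \<open>f(\<lambda>, D, \<mu>)\<close> in a product counts
  intermediate words: elements of the algebra are the matrices, indexed by the words of length \<open>r\<close> in
  \<open>n\<close> letters, that are invariant under the place permutations, with the usual matrix product.

  Let \<open>e\<^sub>\<lambda>\<close> be the idempotent of the words of weight \<open>\<lambda>\<close> and \<open>I\<^sub>\<lambda>\<close> the ideal generated by the \<open>e\<^sub>\<mu>\<close> with
  \<open>\<mu>\<close> lexicographically larger than \<open>\<lambda>\<close>. For words \<open>u, v\<close> of weight \<open>\<lambda>\<close> with pointwise minimum \<open>m\<close>, the
  orbit matrix of \<open>(u, v)\<close> is the product of those of \<open>(u, m)\<close> and \<open>(m, v)\<close> up to orbits of pairs \<open>(i, j)\<close> with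
  larger \<open>\<Sum>\<^sub>k min (i k) (j k)\<close>, and \<open>m\<close> has larger weight if \<open>u \<noteq> v\<close>. Hence \<open>e\<^sub>\<lambda> B e\<^sub>\<lambda>\<close> is spanned by \<open>e\<^sub>\<lambda>\<close>
  modulo \<open>I\<^sub>\<lambda>\<close>, and highest weights classify the irreducible modules by the \<open>\<lambda>\<close> with \<open>e\<^sub>\<lambda> \<notin> I\<^sub>\<lambda>\<close>.
  These are the partitions of \<open>r\<close>: swapping two letters moves a composition with an ascent up, and for a
  partition the antisymmetrization of a tableau along its columns is killed by \<open>I\<^sub>\<lambda>\<close> but not by \<open>e\<^sub>\<lambda>\<close>.
  Writing the multiplicities of the parts in base \<open>p\<close> turns partitions into the stated data.\<close>

section \<open>Left modules\<close>

text \<open>Young subgroups are stabilizers of words and double cosets are orbits of pairs of words;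
  after this translation associativity is that of matrices and every identity is checked entrywise.
  The field need not be algebraically closed and the algebra need not be semisimple, so only the top
  layer of a module is used: if \<open>l\<close> is the largest weight that acts nontrivially,
  \<open>above l\<close> acts as zero and \<open>e l B e l\<close> acts on the space of weight
  \<open>l\<close> by scalars. This forces the annihilator of a highest weight vector to be
  \<open>maximal_left_ideal l\<close>, and equal annihilators give isomorphic modules. The
  lexicographic order stands in for the dominance order: the two main inequalities between weights
  compare prefix sums, but a linear order makes a highest weight exist as a maximum and be unique.
  Partitions classify the irreducible modules over every field; the characteristic enters when
  multiplicities are expanded into digits, and \<open>n \<ge> r\<close> leaves room for the
  partitions of \<open>r\<close> with up to \<open>r\<close> parts.\<close>

lemma (in abelian_group) minus_eq_zero_iff:
  assumes "a \<in> carrier G" "b \<in> carrier G"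
  shows "a \<ominus> b = \<zero> \<longleftrightarrow> a = b"
  using assms by (metis a_minus_def add.inv_closed minus_equality r_neg)

context left_module
begin

lemma smult_r_null: "a \<in> carrier R \<Longrightarrow> a \<odot>\<^bsub>M\<^esub> \<zero>\<^bsub>M\<^esub> = \<zero>\<^bsub>M\<^esub>"
  by (metis M.add.l_cancel_one' M.zero_closed smult_closed smult_r_distr)

lemma smult_l_null: "x \<in> carrier M \<Longrightarrow> \<zero>\<^bsub>R\<^esub> \<odot>\<^bsub>M\<^esub> x = \<zero>\<^bsub>M\<^esub>"
  by (metis M.add.l_cancel_one' R.l_zero R.zero_closed smult_closed smult_l_distr)

lemma smult_l_minus:
  assumes "a \<in> carrier R" "x \<in> carrier M"
  shows "(\<ominus>\<^bsub>R\<^esub> a) \<odot>\<^bsub>M\<^esub> x = \<ominus>\<^bsub>M\<^esub> (a \<odot>\<^bsub>M\<^esub> x)"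
proof (rule M.minus_equality[symmetric])
  have "(\<ominus>\<^bsub>R\<^esub> a) \<odot>\<^bsub>M\<^esub> x \<oplus>\<^bsub>M\<^esub> a \<odot>\<^bsub>M\<^esub> x = (\<ominus>\<^bsub>R\<^esub> a \<oplus>\<^bsub>R\<^esub> a) \<odot>\<^bsub>M\<^esub> x"
    using assms by (simp add: smult_l_distr)
  then show "(\<ominus>\<^bsub>R\<^esub> a) \<odot>\<^bsub>M\<^esub> x \<oplus>\<^bsub>M\<^esub> a \<odot>\<^bsub>M\<^esub> x = \<zero>\<^bsub>M\<^esub>"
    using assms by (simp add: R.l_neg smult_l_null)
qed (use assms smult_closed in auto)

lemma smult_l_diff:
  assumes "a \<in> carrier R" "b \<in> carrier R" "x \<in> carrier M"
  shows "(a \<ominus>\<^bsub>R\<^esub> b) \<odot>\<^bsub>M\<^esub> x = a \<odot>\<^bsub>M\<^esub> x \<ominus>\<^bsub>M\<^esub> b \<odot>\<^bsub>M\<^esub> x"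
  using assms by (simp add: R.minus_eq M.minus_eq smult_l_distr smult_l_minus)

lemma submodule_cyclic:
  assumes x: "x \<in> carrier M"
  shows "submodule ((\<lambda>a. a \<odot>\<^bsub>M\<^esub> x) ` carrier R) R M"
proof (intro submodule.intro subgroup.intro submodule_axioms.intro)
  let ?H = "(\<lambda>a. a \<odot>\<^bsub>M\<^esub> x) ` carrier R"
  show "?H \<subseteq> carrier (add_monoid M)" using x smult_closed by auto
  show "y \<otimes>\<^bsub>add_monoid M\<^esub> z \<in> ?H" if "y \<in> ?H" "z \<in> ?H" for y z
    using that x by (auto simp: smult_l_distr[symmetric])
  show "\<one>\<^bsub>add_monoid M\<^esub> \<in> ?H"
    using smult_l_null[OF x] by force
  show "inv\<^bsub>add_monoid M\<^esub> y \<in> ?H" if "y \<in> ?H" for y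
    using that x by (auto simp: smult_l_minus[symmetric] simp flip: a_inv_def)
  show "a \<odot>\<^bsub>M\<^esub> y \<in> ?H" if "a \<in> carrier R" "y \<in> ?H" for a y
    using that x by (auto simp: smult_assoc[symmetric])
qed

text \<open>An ideal generated by idempotents kills a module as soon as its generators do. This
  replaces any explicit description of the elements of a generated ideal.\<close>

lemma ideal_annihilator: "ideal {a \<in> carrier R. \<forall>x\<in>carrier M. a \<odot>\<^bsub>M\<^esub> x = \<zero>\<^bsub>M\<^esub>} R"
proof (intro idealI subgroup.intro)
  show "ring R" by (rule R.ring_axioms)
qed (auto simp: smult_closed smult_l_distr smult_l_null smult_l_minus smult_assoc smult_r_null
  simp flip: a_inv_def)

end

lemma irreducible_left_moduleD:
  assumes "irreducible_left_module R M"
  shows "left_module R M" "carrier M \<noteq> {\<zero>\<^bsub>M\<^esub>}"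
    "\<And>H. submodule H R M \<Longrightarrow> H = {\<zero>\<^bsub>M\<^esub>} \<or> H = carrier M"
  using assms by (auto simp: irreducible_left_module_def)

lemma irreducible_cyclic:
  assumes M: "irreducible_left_module R M"
    and x: "x \<in> carrier M" "x \<noteq> \<zero>\<^bsub>M\<^esub>" and y: "y \<in> carrier M"
  obtains a where "a \<in> carrier R" "y = a \<odot>\<^bsub>M\<^esub> x"
proof -
  interpret left_module R M using M by (rule irreducible_left_moduleD)
  have "x \<in> (\<lambda>a. a \<odot>\<^bsub>M\<^esub> x) ` carrier R"
    using smult_one[OF x(1)] by (metis R.one_closed image_eqI)
  with x have "(\<lambda>a. a \<odot>\<^bsub>M\<^esub> x) ` carrier R = carrier M"
    using irreducible_left_moduleD(3)[OF M submodule_cyclic[OF x(1)]] by blast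
  with y that show ?thesis by blast
qed

text \<open>Both modules are cyclic, hence the ring modulo the annihilator of the chosen generator;
  equal annihilators make the map from \<open>a x\<close> to \<open>a y\<close> well defined and
  injective. The element types of the two modules may differ.\<close>

lemma left_module_iso_of_annihilators:
  assumes M: "irreducible_left_module R M" and N: "irreducible_left_module R N"
    and x: "x \<in> carrier M" "x \<noteq> \<zero>\<^bsub>M\<^esub>" and y: "y \<in> carrier N" "y \<noteq> \<zero>\<^bsub>N\<^esub>"
    and ann: "\<And>a. a \<in> carrier R \<Longrightarrow> a \<odot>\<^bsub>M\<^esub> x = \<zero>\<^bsub>M\<^esub> \<longleftrightarrow> a \<odot>\<^bsub>N\<^esub> y = \<zero>\<^bsub>N\<^esub>"
  shows "left_module_iso R M N"
proof -
  interpret M: left_module R M using M by (rule irreducible_left_moduleD)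
  interpret N: left_module R N using N by (rule irreducible_left_moduleD)
  have eq: "a \<odot>\<^bsub>M\<^esub> x = b \<odot>\<^bsub>M\<^esub> x \<longleftrightarrow> a \<odot>\<^bsub>N\<^esub> y = b \<odot>\<^bsub>N\<^esub> y"
    if "a \<in> carrier R" "b \<in> carrier R" for a b
    using ann[of "a \<ominus>\<^bsub>R\<^esub> b"] that x y
    by (simp add: M.smult_l_diff N.smult_l_diff M.smult_closed N.smult_closed
        M.M.minus_eq_zero_iff N.M.minus_eq_zero_iff)
  \<comment> \<open>Any ring element that carries \<open>x\<close> to \<open>z\<close> may be chosen
    here: by \<open>eq\<close> the value at \<open>y\<close> is the same.\<close>
  define h where "h z = (SOME a. a \<in> carrier R \<and> z = a \<odot>\<^bsub>M\<^esub> x) \<odot>\<^bsub>N\<^esub> y" for z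
  have h: "h (a \<odot>\<^bsub>M\<^esub> x) = a \<odot>\<^bsub>N\<^esub> y" if a: "a \<in> carrier R" for a
  proof -
    let ?P = "\<lambda>b. b \<in> carrier R \<and> a \<odot>\<^bsub>M\<^esub> x = b \<odot>\<^bsub>M\<^esub> x"
    have "?P (SOME b. ?P b)" by (rule someI[of ?P a]) (simp add: a)
    then show ?thesis using eq[OF a] by (auto simp: h_def)
  qed
  have carM: "\<exists>a\<in>carrier R. z = a \<odot>\<^bsub>M\<^esub> x" if "z \<in> carrier M" for z
    using irreducible_cyclic[OF M x that] by blast
  have carN: "\<exists>a\<in>carrier R. z = a \<odot>\<^bsub>N\<^esub> y" if "z \<in> carrier N" for z
    using irreducible_cyclic[OF N y that] by blast
  have "inj_on h (carrier M)"
  proof (rule inj_onI)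
    fix z z' assume "z \<in> carrier M" "z' \<in> carrier M" "h z = h z'"
    then show "z = z'" using carM[of z] carM[of z'] by (auto simp: h eq)
  qed
  moreover have "h ` carrier M = carrier N"
  proof (intro equalityI subsetI)
    fix z assume "z \<in> h ` carrier M"
    then show "z \<in> carrier N" using carM y by (auto simp: h N.smult_closed dest!: carM)
  next
    fix z assume "z \<in> carrier N"
    then obtain a where "a \<in> carrier R" "z = h (a \<odot>\<^bsub>M\<^esub> x)" using carN by (auto simp: h)
    then show "z \<in> h ` carrier M" using x by (auto intro!: imageI M.smult_closed)
  qed
  ultimately have "bij_betw h (carrier M) (carrier N)" by (simp add: bij_betw_def)
  moreover have "h (z \<oplus>\<^bsub>M\<^esub> z') = h z \<oplus>\<^bsub>N\<^esub> h z'" if zz: "z \<in> carrier M" "z' \<in> carrier M" for z z'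
  proof -
    obtain a b where ab: "a \<in> carrier R" "b \<in> carrier R" "z = a \<odot>\<^bsub>M\<^esub> x" "z' = b \<odot>\<^bsub>M\<^esub> x"
      using carM[OF zz(1)] carM[OF zz(2)] by auto
    have "h (z \<oplus>\<^bsub>M\<^esub> z') = h ((a \<oplus>\<^bsub>R\<^esub> b) \<odot>\<^bsub>M\<^esub> x)"
      unfolding ab(3,4) by (simp only: M.smult_l_distr[OF ab(1,2) x(1)])
    also have "\<dots> = h z \<oplus>\<^bsub>N\<^esub> h z'"
      unfolding ab(3,4) using ab(1,2) by (simp only: h N.smult_l_distr[OF ab(1,2) y(1)] M.R.a_closed)
    finally show ?thesis .
  qed
  moreover have "h (a \<odot>\<^bsub>M\<^esub> z) = a \<odot>\<^bsub>N\<^esub> h z" if a: "a \<in> carrier R" and z: "z \<in> carrier M" for a z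
  proof -
    obtain b where b: "b \<in> carrier R" "z = b \<odot>\<^bsub>M\<^esub> x"
      using carM[OF z] by auto
    have "h (a \<odot>\<^bsub>M\<^esub> z) = h ((a \<otimes>\<^bsub>R\<^esub> b) \<odot>\<^bsub>M\<^esub> x)"
      unfolding b(2) by (simp only: M.smult_assoc[OF a b(1) x(1)])
    also have "\<dots> = a \<odot>\<^bsub>N\<^esub> h z"
      unfolding b(2) using a b(1) by (simp only: h N.smult_assoc[OF a b(1) y(1)] M.R.m_closed)
    finally show ?thesis .
  qed
  ultimately show ?thesis unfolding left_module_iso_def by blast
qed

section \<open>Quotients of a ring by a left ideal\<close>

definition left_quotient :: "'a ring \<Rightarrow> 'a set \<Rightarrow> ('a, 'a set) module" where
  "left_quotient R J =
     \<lparr>carrier = a_rcosets\<^bsub>R\<^esub> J, monoid.mult = (\<lambda>X Y. J), one = J, zero = J, add = set_add R,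
      smult = (\<lambda>a X. \<Union>x\<in>X. J +>\<^bsub>R\<^esub> (a \<otimes>\<^bsub>R\<^esub> x))\<rparr>"

locale left_ideal = additive_subgroup J R + ring R for J and R :: "'a ring" (structure) +
  assumes l_closed: "\<lbrakk>x \<in> J; a \<in> carrier R\<rbrakk> \<Longrightarrow> a \<otimes> x \<in> J"
begin

sublocale abelian_subgroup J R
  by (intro abelian_subgroupI3 additive_subgroup_axioms abelian_group_axioms)

text \<open>The action on a coset is defined as a union over its elements, which avoids choosing a
  representative; closure of \<open>J\<close> under left multiplication makes all members of the
  union equal.\<close>

lemma smult_rcos:
  assumes a: "a \<in> carrier R" and x: "x \<in> carrier R"
  shows "a \<odot>\<^bsub>left_quotient R J\<^esub> (J +> x) = J +> a \<otimes> x"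
proof -
  have "J +> a \<otimes> y = J +> a \<otimes> x" if y: "y \<in> J +> x" for y
  proof -
    obtain j where j: "j \<in> J" "y = j \<oplus> x" using y by (auto simp: a_r_coset_def')
    then have "a \<otimes> y = a \<otimes> j \<oplus> a \<otimes> x" using a x by (simp add: r_distr)
    then have "a \<otimes> y \<in> J +> a \<otimes> x" using l_closed[OF j(1) a] by (auto simp: a_r_coset_def')
    then show ?thesis using a x by (metis a_repr_independence' m_closed)
  qed
  moreover have "x \<in> J +> x" using x by (rule a_rcos_self)
  ultimately have "(\<Union>y\<in>J +> x. J +> a \<otimes> y) = J +> a \<otimes> x" by blast
  then show ?thesis by (simp only: left_quotient_def module.simps)
qed

lemma rcos_eq_iff:
  assumes "x \<in> carrier R" "y \<in> carrier R"
  shows "J +> x = J +> y \<longleftrightarrow> x \<ominus> y \<in> J"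
proof -
  have "J +> x = J +> y \<longleftrightarrow> x \<in> J +> y"
    using assms by (metis a_rcos_self a_repr_independence')
  also have "\<dots> \<longleftrightarrow> x \<ominus> y \<in> J"
    using a_rcos_module_minus[OF ring_axioms, of y x] assms by simp
  finally show ?thesis .
qed

lemma left_module_quotient: "left_module R (left_quotient R J)"
proof -
  let ?M = "left_quotient R J"
  have carr: "carrier ?M = a_rcosets J" and add: "add ?M = set_add R" and zero: "\<zero>\<^bsub>?M\<^esub> = J"
    by (simp_all add: left_quotient_def)
  have rep: "\<exists>x\<in>carrier R. X = J +> x" if "X \<in> carrier ?M" for X
    using that by (auto simp: carr A_RCOSETS_def')
  have mem: "J +> x \<in> carrier ?M" if "x \<in> carrier R" for x
    using that by (simp add: carr a_rcosetsI a_subset)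
  have zero': "\<zero>\<^bsub>?M\<^esub> = J +> \<zero>" by (simp add: zero a_subset)
  interpret M: abelian_group ?M
  proof (rule abelian_groupI)
    show "\<exists>Y\<in>carrier ?M. Y \<oplus>\<^bsub>?M\<^esub> X = \<zero>\<^bsub>?M\<^esub>" if X: "X \<in> carrier ?M" for X
    proof -
      obtain x where x: "x \<in> carrier R" "X = J +> x" using rep[OF X] by blast
      then have "(J +> \<ominus> x) \<oplus>\<^bsub>?M\<^esub> X = \<zero>\<^bsub>?M\<^esub>" by (simp add: add zero' a_rcos_sum l_neg)
      then show ?thesis using mem x by blast
    qed
  qed (auto dest!: rep simp: add zero' a_rcos_sum mem a_ac)
  show ?thesis
  proof (intro left_module.intro left_module_axioms.intro)
    show "ring R" by (rule ring_axioms)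
    show "abelian_group ?M" by (rule M.abelian_group_axioms)
    note simps = smult_rcos add a_rcos_sum l_distr r_distr m_assoc mem
    show "a \<odot>\<^bsub>?M\<^esub> X \<in> carrier ?M" if "a \<in> carrier R" "X \<in> carrier ?M" for a X
      using rep[OF that(2)] that(1) by (auto simp: simps)
    show "(a \<oplus> b) \<odot>\<^bsub>?M\<^esub> X = a \<odot>\<^bsub>?M\<^esub> X \<oplus>\<^bsub>?M\<^esub> b \<odot>\<^bsub>?M\<^esub> X"
      if "a \<in> carrier R" "b \<in> carrier R" "X \<in> carrier ?M" for a b X
      using rep[OF that(3)] that(1,2) by (auto simp: simps)
    show "a \<odot>\<^bsub>?M\<^esub> (X \<oplus>\<^bsub>?M\<^esub> Y) = a \<odot>\<^bsub>?M\<^esub> X \<oplus>\<^bsub>?M\<^esub> a \<odot>\<^bsub>?M\<^esub> Y"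
      if "a \<in> carrier R" "X \<in> carrier ?M" "Y \<in> carrier ?M" for a X Y
      using rep[OF that(2)] rep[OF that(3)] that(1) by (auto simp: simps)
    show "(a \<otimes> b) \<odot>\<^bsub>?M\<^esub> X = a \<odot>\<^bsub>?M\<^esub> (b \<odot>\<^bsub>?M\<^esub> X)"
      if "a \<in> carrier R" "b \<in> carrier R" "X \<in> carrier ?M" for a b X
      using rep[OF that(3)] that(1,2) by (auto simp: simps)
    show "\<one> \<odot>\<^bsub>?M\<^esub> X = X" if "X \<in> carrier ?M" for X
      using rep[OF that] by (auto simp: simps)
  qed
qed

end

section \<open>Highest weights\<close>

text \<open>The axioms isolate what highest weight theory uses. \<open>K\<close> plays the field of
  scalars inside the ring, \<open>e l\<close> projects onto the vectors of weight \<open>l\<close>,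
  and \<open>diag_decomp\<close> says that \<open>e l R e l\<close> consists of scalar multiples of
  \<open>e l\<close> modulo the ideal of the larger weights.\<close>

locale weighted_ring = ring R for R :: "'a ring" (structure) +
  fixes K :: "'a set" and e :: "'i::linorder \<Rightarrow> 'a" and L :: "'i set"
  assumes finite_weights: "finite L"
    and e_closed: "l \<in> L \<Longrightarrow> e l \<in> carrier R"
    and e_idem: "l \<in> L \<Longrightarrow> e l \<otimes> e l = e l"
    and scalars_closed: "c \<in> K \<Longrightarrow> c \<in> carrier R"
    and scalars_invertible: "\<lbrakk>c \<in> K; c \<noteq> \<zero>\<rbrakk> \<Longrightarrow> \<exists>d\<in>K. d \<otimes> c = \<one>"
    and one_in_genideal: "\<one> \<in> Idl (e ` L)"
    and diag_decomp: "\<lbrakk>l \<in> L; a \<in> carrier R\<rbrakk> \<Longrightarrow>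
      \<exists>c\<in>K. e l \<otimes> a \<otimes> e l \<ominus> c \<otimes> e l \<in> Idl (e ` {m \<in> L. l < m})"
begin

definition above :: "'i \<Rightarrow> 'a set" where
  "above l = Idl (e ` {m \<in> L. l < m})"

definition highest_weight :: "('a, 'm) module \<Rightarrow> 'i \<Rightarrow> bool" where
  "highest_weight M l \<longleftrightarrow> l \<in> L \<and> (\<exists>x\<in>carrier M. e l \<odot>\<^bsub>M\<^esub> x \<noteq> \<zero>\<^bsub>M\<^esub>) \<and>
     (\<forall>m\<in>L. l < m \<longrightarrow> (\<forall>x\<in>carrier M. e m \<odot>\<^bsub>M\<^esub> x = \<zero>\<^bsub>M\<^esub>))"

definition dominant_weights :: "'i set" where
  "dominant_weights = {l \<in> L. e l \<notin> above l}"

text \<open>The largest left ideal \<open>J\<close> with \<open>e l J e l\<close> inside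
  \<open>above l\<close>. It is designed to be the annihilator of any highest weight vector
  \<open>x = e l x\<close>: an element \<open>a\<close> belongs to it if no \<open>b\<close> can
  bring \<open>a x\<close> back to a nonzero multiple of \<open>x\<close>.\<close>

definition maximal_left_ideal :: "'i \<Rightarrow> 'a set" where
  "maximal_left_ideal l = {a \<in> carrier R. \<forall>b\<in>carrier R. e l \<otimes> b \<otimes> a \<otimes> e l \<in> above l}"

lemma ideal_above: "ideal (above l) R"
  unfolding above_def by (rule genideal_ideal) (use e_closed in auto)

lemma e_above: "\<lbrakk>m \<in> L; l < m\<rbrakk> \<Longrightarrow> e m \<in> above l"
  unfolding above_def using genideal_self[of "e ` {m \<in> L. l < m}"] e_closed by auto

lemma above_annihilates:
  assumes M: "left_module R M" and hw: "highest_weight M l"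
    and a: "a \<in> above l" and x: "x \<in> carrier M"
  shows "a \<odot>\<^bsub>M\<^esub> x = \<zero>\<^bsub>M\<^esub>"
proof -
  interpret M: left_module R M by fact
  have "above l \<subseteq> {a \<in> carrier R. \<forall>x\<in>carrier M. a \<odot>\<^bsub>M\<^esub> x = \<zero>\<^bsub>M\<^esub>}"
    unfolding above_def
    by (rule genideal_minimal[OF M.ideal_annihilator])
      (use hw e_closed in \<open>auto simp: highest_weight_def\<close>)
  with a x show ?thesis by blast
qed

text \<open>If every \<open>e l\<close> acted as zero, the annihilator would contain the ideal
  generated by all of them, and with it \<open>\<one>\<close>. So some weight occurs, and the
  largest one is taken.\<close>

lemma highest_weight_exists:
  assumes M: "left_module R M" and nz: "carrier M \<noteq> {\<zero>\<^bsub>M\<^esub>}"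
  shows "\<exists>l. highest_weight M l"
proof -
  interpret M: left_module R M by fact
  let ?S = "{l \<in> L. \<exists>x\<in>carrier M. e l \<odot>\<^bsub>M\<^esub> x \<noteq> \<zero>\<^bsub>M\<^esub>}"
  have "?S \<noteq> {}"
  proof
    assume "?S = {}"
    then have "Idl (e ` L) \<subseteq> {a \<in> carrier R. \<forall>x\<in>carrier M. a \<odot>\<^bsub>M\<^esub> x = \<zero>\<^bsub>M\<^esub>}"
      by (intro genideal_minimal[OF M.ideal_annihilator]) (use e_closed in auto)
    with one_in_genideal have "x = \<zero>\<^bsub>M\<^esub>" if "x \<in> carrier M" for x
      using that M.smult_one by auto
    with nz show False by (auto simp: set_eq_iff)
  qed
  then have "Max ?S \<in> ?S" "\<And>m. m \<in> ?S \<Longrightarrow> m \<le> Max ?S"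
    using finite_weights Max_in[of ?S] Max_ge[of ?S] by auto
  then show ?thesis by (force simp: highest_weight_def intro!: exI[of _ "Max ?S"])
qed

lemma highest_weight_unique:
  assumes "highest_weight M l" "highest_weight M m" shows "l = m"
  using assms by (metis highest_weight_def linorder_neqE)

text \<open>All of \<open>above l\<close> acts as zero, whereas \<open>e l\<close> does not.\<close>

lemma highest_weight_dominant:
  assumes "left_module R M" "highest_weight M l"
  shows "l \<in> dominant_weights"
  using assms above_annihilates[OF assms] by (auto simp: highest_weight_def dominant_weights_def)

text \<open>If \<open>a x = 0\<close>, then the scalar \<open>c\<close> that represents
  \<open>e l b a e l\<close> modulo \<open>above l\<close> kills \<open>x\<close>, so it vanishes.
  If \<open>a x \<noteq> 0\<close>, irreducibility gives \<open>b\<close> with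
  \<open>b a x = x\<close>, so \<open>e l b a e l\<close> fixes \<open>x\<close> and cannot lie in
  \<open>above l\<close>.\<close>

lemma highest_weight_annihilator:
  assumes M: "irreducible_left_module R M" and hw: "highest_weight M l"
    and x: "x \<in> carrier M" "x \<noteq> \<zero>\<^bsub>M\<^esub>" "e l \<odot>\<^bsub>M\<^esub> x = x" and a: "a \<in> carrier R"
  shows "a \<odot>\<^bsub>M\<^esub> x = \<zero>\<^bsub>M\<^esub> \<longleftrightarrow> a \<in> maximal_left_ideal l"
proof
  interpret M: left_module R M using M by (rule irreducible_left_moduleD)
  have l: "l \<in> L" using hw by (simp add: highest_weight_def)
  note [simp] = e_closed[OF l] scalars_closed
  interpret I: ideal "above l" R by (rule ideal_above)
  have act: "e l \<otimes> b \<otimes> a \<otimes> e l \<odot>\<^bsub>M\<^esub> x = e l \<odot>\<^bsub>M\<^esub> (b \<odot>\<^bsub>M\<^esub> (a \<odot>\<^bsub>M\<^esub> x))"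
    if "b \<in> carrier R" for b
    using that a x by (simp add: M.smult_assoc M.smult_closed)
  {
    assume ax: "a \<odot>\<^bsub>M\<^esub> x = \<zero>\<^bsub>M\<^esub>"
    have "e l \<otimes> b \<otimes> a \<otimes> e l \<in> above l" if b: "b \<in> carrier R" for b
    proof -
      obtain c where c: "c \<in> K" and "e l \<otimes> (b \<otimes> a) \<otimes> e l \<ominus> c \<otimes> e l \<in> above l"
        using diag_decomp[OF l, of "b \<otimes> a"] a b unfolding above_def by auto
      then have i: "e l \<otimes> b \<otimes> a \<otimes> e l \<ominus> c \<otimes> e l \<in> above l" using a b by (simp add: m_assoc)
      have "c = \<zero>"
      proof (rule ccontr)
        assume "c \<noteq> \<zero>"
        then obtain d where d: "d \<in> K" "d \<otimes> c = \<one>" using scalars_invertible c by blast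
        have "\<zero>\<^bsub>M\<^esub> = (e l \<otimes> b \<otimes> a \<otimes> e l \<ominus> c \<otimes> e l) \<odot>\<^bsub>M\<^esub> x"
          using above_annihilates[OF M.left_module_axioms hw i x(1)] by simp
        also have "\<dots> = \<ominus>\<^bsub>M\<^esub> (c \<odot>\<^bsub>M\<^esub> x)"
          using act[OF b] ax a b c x
          by (simp add: M.smult_l_diff M.smult_r_null M.smult_assoc M.smult_closed M.minus_eq)
        finally have "c \<odot>\<^bsub>M\<^esub> x = \<zero>\<^bsub>M\<^esub>" using c x
          by (metis M.M.add.inv_eq_1_iff M.smult_closed scalars_closed)
        then have "d \<otimes> c \<odot>\<^bsub>M\<^esub> x = \<zero>\<^bsub>M\<^esub>"
          using M.smult_assoc[of d c x] M.smult_r_null[of d] c d(1) x(1) by simp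
        then show False using d x M.smult_one by simp
      qed
      with i a b show ?thesis by (simp add: minus_eq)
    qed
    with a show "a \<in> maximal_left_ideal l" by (simp add: maximal_left_ideal_def)
  }
  {
    assume J: "a \<in> maximal_left_ideal l"
    show "a \<odot>\<^bsub>M\<^esub> x = \<zero>\<^bsub>M\<^esub>"
    proof (rule ccontr)
      assume "a \<odot>\<^bsub>M\<^esub> x \<noteq> \<zero>\<^bsub>M\<^esub>"
      then obtain b where b: "b \<in> carrier R" "x = b \<odot>\<^bsub>M\<^esub> (a \<odot>\<^bsub>M\<^esub> x)"
        using irreducible_cyclic[OF M M.smult_closed[OF a x(1)] _ x(1)] by blast
      have "e l \<otimes> b \<otimes> a \<otimes> e l \<in> above l" using J b by (simp add: maximal_left_ideal_def)
      from above_annihilates[OF M.left_module_axioms hw this x(1)] act b x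
      show False by simp
    qed
  }
qed

lemma highest_weight_vector:
  assumes M: "left_module R M" and hw: "highest_weight M l"
  obtains x where "x \<in> carrier M" "x \<noteq> \<zero>\<^bsub>M\<^esub>" "e l \<odot>\<^bsub>M\<^esub> x = x"
proof -
  interpret M: left_module R M by fact
  obtain x where x: "x \<in> carrier M" "e l \<odot>\<^bsub>M\<^esub> x \<noteq> \<zero>\<^bsub>M\<^esub>" and l: "l \<in> L"
    using hw by (auto simp: highest_weight_def)
  have "e l \<odot>\<^bsub>M\<^esub> (e l \<odot>\<^bsub>M\<^esub> x) = e l \<odot>\<^bsub>M\<^esub> x"
    using x l e_closed e_idem by (metis M.smult_assoc)
  with x l e_closed that[of "e l \<odot>\<^bsub>M\<^esub> x"] M.smult_closed show ?thesis by blast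
qed

text \<open>Highest weight vectors of both modules have the annihilator
  \<open>maximal_left_ideal l\<close>, which depends on \<open>l\<close> alone.\<close>

lemma iso_of_highest_weight:
  assumes M: "irreducible_left_module R M" and N: "irreducible_left_module R N"
    and hM: "highest_weight M l" and hN: "highest_weight N l"
  shows "left_module_iso R M N"
proof -
  obtain x where x: "x \<in> carrier M" "x \<noteq> \<zero>\<^bsub>M\<^esub>" "e l \<odot>\<^bsub>M\<^esub> x = x"
    using highest_weight_vector[OF irreducible_left_moduleD(1)[OF M] hM] .
  obtain y where y: "y \<in> carrier N" "y \<noteq> \<zero>\<^bsub>N\<^esub>" "e l \<odot>\<^bsub>N\<^esub> y = y"
    using highest_weight_vector[OF irreducible_left_moduleD(1)[OF N] hN] .
  show ?thesis
    by (rule left_module_iso_of_annihilators[OF M N x(1,2) y(1,2)])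
      (simp add: highest_weight_annihilator[OF M hM x] highest_weight_annihilator[OF N hN y])
qed

lemma highest_weight_iso:
  assumes M: "left_module R M" and N: "left_module R N"
    and iso: "left_module_iso R M N" and hw: "highest_weight M l"
  shows "highest_weight N l"
proof -
  interpret M: left_module R M by fact
  interpret N: left_module R N by fact
  obtain h where h: "bij_betw h (carrier M) (carrier N)"
    "\<And>x y. \<lbrakk>x \<in> carrier M; y \<in> carrier M\<rbrakk> \<Longrightarrow> h (x \<oplus>\<^bsub>M\<^esub> y) = h x \<oplus>\<^bsub>N\<^esub> h y"
    "\<And>a x. \<lbrakk>a \<in> carrier R; x \<in> carrier M\<rbrakk> \<Longrightarrow> h (a \<odot>\<^bsub>M\<^esub> x) = a \<odot>\<^bsub>N\<^esub> h x"
    using iso by (auto simp: left_module_iso_def)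
  have hc: "h x \<in> carrier N" if "x \<in> carrier M" for x
    using h(1) that by (auto simp: bij_betw_def)
  have h0: "h \<zero>\<^bsub>M\<^esub> = \<zero>\<^bsub>N\<^esub>"
    using h(2)[of "\<zero>\<^bsub>M\<^esub>" "\<zero>\<^bsub>M\<^esub>"] hc[of "\<zero>\<^bsub>M\<^esub>"] by (simp add: N.M.add.l_cancel_one')
  have h0_iff: "h x = \<zero>\<^bsub>N\<^esub> \<longleftrightarrow> x = \<zero>\<^bsub>M\<^esub>" if "x \<in> carrier M" for x
    using inj_onD[OF bij_betw_imp_inj_on[OF h(1)], of x "\<zero>\<^bsub>M\<^esub>"] h0 that by auto
  have e_iff: "e m \<odot>\<^bsub>N\<^esub> h x = \<zero>\<^bsub>N\<^esub> \<longleftrightarrow> e m \<odot>\<^bsub>M\<^esub> x = \<zero>\<^bsub>M\<^esub>"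
    if "m \<in> L" "x \<in> carrier M" for m x
    using that h(3)[OF e_closed[OF that(1)] that(2)] h0_iff[OF M.smult_closed[OF e_closed[OF that(1)] that(2)]]
    by simp
  have img: "carrier N = h ` carrier M" using h(1) by (simp add: bij_betw_def)
  show ?thesis using hw e_iff unfolding highest_weight_def img by auto
qed

section \<open>The irreducible module of a dominant weight\<close>

lemma left_ideal_maximal:
  assumes l: "l \<in> L"
  shows "left_ideal (maximal_left_ideal l) R"
proof -
  interpret I: ideal "above l" R by (rule ideal_above)
  note [simp] = e_closed[OF l]
  show ?thesis
  proof (intro left_ideal.intro additive_subgroupI subgroup.intro left_ideal_axioms.intro)
    show "x \<otimes>\<^bsub>add_monoid R\<^esub> y \<in> maximal_left_ideal l"
      if "x \<in> maximal_left_ideal l" "y \<in> maximal_left_ideal l" for x y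
      using that by (auto simp: maximal_left_ideal_def r_distr l_distr)
    show "inv\<^bsub>add_monoid R\<^esub> x \<in> maximal_left_ideal l" if "x \<in> maximal_left_ideal l" for x
      unfolding a_inv_def[symmetric] using that by (auto simp: maximal_left_ideal_def r_minus l_minus)
    show "a \<otimes> x \<in> maximal_left_ideal l" if "x \<in> maximal_left_ideal l" "a \<in> carrier R" for a x
    proof -
      have "e l \<otimes> b \<otimes> (a \<otimes> x) \<otimes> e l = e l \<otimes> (b \<otimes> a) \<otimes> x \<otimes> e l" if "b \<in> carrier R" for b
        using that \<open>a \<in> carrier R\<close> \<open>x \<in> _\<close> by (simp add: m_assoc maximal_left_ideal_def)
      with that show ?thesis by (auto simp: maximal_left_ideal_def)
    qed
  qed (auto simp: maximal_left_ideal_def ring_axioms)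
qed

text \<open>Every \<open>x\<close> outside the left ideal has a left inverse modulo it: some
  \<open>e l b x e l\<close> is a nonzero scalar \<open>c\<close> times \<open>e l\<close> modulo
  \<open>above l\<close>, and the inverse of \<open>c\<close> times \<open>e l b\<close> does the
  job. Dominance keeps \<open>e l\<close> out of the left ideal, so that the weight \<open>l\<close>
  occurs in the quotient.\<close>

lemma irreducible_quotient:
  assumes dom: "l \<in> dominant_weights"
  defines "Q \<equiv> left_quotient R (maximal_left_ideal l)"
  shows "irreducible_left_module R Q" "highest_weight Q l"
proof -
  let ?J = "maximal_left_ideal l"
  have l: "l \<in> L" and notin: "e l \<notin> above l" using dom by (auto simp: dominant_weights_def)
  note [simp] = e_closed[OF l] scalars_closed
  interpret I: ideal "above l" R by (rule ideal_above)
  interpret J: left_ideal ?J R using l by (rule left_ideal_maximal)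
  interpret Q: left_module R Q unfolding Q_def by (rule J.left_module_quotient)
  have carr: "carrier Q = a_rcosets ?J" and zero: "\<zero>\<^bsub>Q\<^esub> = ?J"
    by (simp_all add: Q_def left_quotient_def)
  have coset0: "?J +> x = ?J \<longleftrightarrow> x \<in> ?J" if "x \<in> carrier R" for x
    using J.rcos_eq_iff[OF that zero_closed] that by (simp add: minus_eq a_coset_add_zero J.a_subset)
  have smult: "a \<odot>\<^bsub>Q\<^esub> (?J +> x) = ?J +> a \<otimes> x" if "a \<in> carrier R" "x \<in> carrier R" for a x
    unfolding Q_def using that by (rule J.smult_rcos)
  have eJ: "e l \<notin> ?J"
  proof
    assume "e l \<in> ?J"
    then have "e l \<otimes> \<one> \<otimes> e l \<otimes> e l \<in> above l" unfolding maximal_left_ideal_def by blast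
    with notin show False by (simp add: e_idem[OF l])
  qed
  have in_carr: "?J +> x \<in> carrier Q" if "x \<in> carrier R" for x
    using that by (simp add: carr a_rcosetsI J.a_subset)
  have max: "\<exists>a\<in>carrier R. \<one> \<ominus> a \<otimes> x \<in> ?J" if x: "x \<in> carrier R" "x \<notin> ?J" for x
  proof -
    obtain b where b: "b \<in> carrier R" "e l \<otimes> b \<otimes> x \<otimes> e l \<notin> above l"
      using x unfolding maximal_left_ideal_def by blast
    obtain c where c: "c \<in> K" and "e l \<otimes> (b \<otimes> x) \<otimes> e l \<ominus> c \<otimes> e l \<in> above l"
      using diag_decomp[OF l, of "b \<otimes> x"] x b unfolding above_def by auto
    then have i: "e l \<otimes> b \<otimes> x \<otimes> e l \<ominus> c \<otimes> e l \<in> above l" using x b by (simp add: m_assoc)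
    then have "c \<noteq> \<zero>" using b x by (auto simp: minus_eq)
    then obtain d where d: "d \<in> K" "d \<otimes> c = \<one>" using scalars_invertible c by blast
    let ?a = "d \<otimes> (e l \<otimes> b)"
    have "\<one> \<ominus> ?a \<otimes> x \<in> ?J"
    proof -
      have "e l \<otimes> y \<otimes> (\<one> \<ominus> ?a \<otimes> x) \<otimes> e l \<in> above l" if y: "y \<in> carrier R" for y
      proof -
        let ?z = "e l \<otimes> b \<otimes> x \<otimes> e l"
        have [simp]: "b \<in> carrier R" "x \<in> carrier R" "c \<in> carrier R" "d \<in> carrier R" "y \<in> carrier R"
          using b x c d y by auto
        \<comment> \<open>Since \<open>d\<close> cancels \<open>c\<close>, \<open>d ?z\<close>
          differs from \<open>e l\<close> by an element of \<open>above l\<close>.\<close>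
        have dz: "d \<otimes> (?z \<ominus> c \<otimes> e l) = d \<otimes> ?z \<ominus> e l"
        proof -
          have "d \<otimes> (?z \<ominus> c \<otimes> e l) = d \<otimes> ?z \<ominus> d \<otimes> c \<otimes> e l"
            by (simp add: minus_eq r_distr r_minus m_assoc)
          then show ?thesis using d by simp
        qed
        have "e l \<otimes> y \<otimes> (\<one> \<ominus> ?a \<otimes> x) \<otimes> e l = e l \<otimes> y \<otimes> (e l \<ominus> d \<otimes> ?z)"
          by (simp add: minus_eq r_distr l_distr r_minus l_minus m_assoc)
        also have "\<dots> = \<ominus> (e l \<otimes> y \<otimes> (d \<otimes> ?z \<ominus> e l))"
          by (simp add: minus_eq r_distr l_distr r_minus l_minus m_assoc minus_add a_comm)
        also have "\<dots> \<in> above l"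
          using i by (simp flip: dz add: I.I_l_closed)
        finally show ?thesis .
      qed
      moreover have "\<one> \<ominus> ?a \<otimes> x \<in> carrier R" using b(1) x(1) d(1) by simp
      ultimately show ?thesis unfolding maximal_left_ideal_def by blast
    qed
    moreover have "?a \<in> carrier R" using b(1) d(1) by simp
    ultimately show ?thesis by blast
  qed
  show "irreducible_left_module R Q"
    unfolding irreducible_left_module_def
  proof (intro conjI allI impI)
    show "left_module R Q" by (rule Q.left_module_axioms)
    show "carrier Q \<noteq> {\<zero>\<^bsub>Q\<^esub>}"
      using in_carr[of "e l"] coset0[of "e l"] eJ by (auto simp: zero)
    fix H assume H: "submodule H R Q"
    interpret H: submodule H R Q by fact
    have sub: "H \<subseteq> carrier Q" using H.subset by simp
    have z: "\<zero>\<^bsub>Q\<^esub> \<in> H" using H.one_closed by simp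
    show "H = {\<zero>\<^bsub>Q\<^esub>} \<or> H = carrier Q"
    proof (rule disjCI)
      assume "H \<noteq> carrier Q"
      show "H = {\<zero>\<^bsub>Q\<^esub>}"
      proof (rule ccontr)
        assume "H \<noteq> {\<zero>\<^bsub>Q\<^esub>}"
        with z obtain X where "X \<in> H" "X \<noteq> ?J" using zero by auto
        then obtain x where x: "x \<in> carrier R" "?J +> x \<in> H" "x \<notin> ?J"
          using sub coset0 by (auto simp: carr A_RCOSETS_def')
        obtain a where a: "a \<in> carrier R" "\<one> \<ominus> a \<otimes> x \<in> ?J" using max x by blast
        have "?J +> \<one> = ?J +> a \<otimes> x" using a x by (subst J.rcos_eq_iff) auto
        then have one: "?J +> \<one> \<in> H" using H.smult_closed[OF a(1) x(2)] smult a x by simp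
        have "?J +> y \<in> H" if "y \<in> carrier R" for y
          using H.smult_closed[OF that one] smult[OF that one_closed] that by simp
        then have "carrier Q \<subseteq> H" by (auto simp: carr A_RCOSETS_def')
        with sub \<open>H \<noteq> carrier Q\<close> show False by blast
      qed
    qed
  qed
  have "e m \<odot>\<^bsub>Q\<^esub> X = \<zero>\<^bsub>Q\<^esub>" if m: "m \<in> L" "l < m" and X: "X \<in> carrier Q" for m X
  proof -
    obtain x where x: "x \<in> carrier R" "X = ?J +> x" using X by (auto simp: carr A_RCOSETS_def')
    have "e m \<otimes> x \<in> ?J"
      using x(1) e_closed[OF m(1)] I.I_r_closed[OF e_above[OF m]] I.I_l_closed I.I_r_closed
      unfolding maximal_left_ideal_def by simp
    then show ?thesis using x e_closed[OF m(1)] by (simp add: smult zero coset0)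
  qed
  moreover have "e l \<odot>\<^bsub>Q\<^esub> (?J +> \<one>) \<noteq> \<zero>\<^bsub>Q\<^esub>"
    using eJ by (simp add: smult zero coset0)
  ultimately show "highest_weight Q l"
    unfolding highest_weight_def using l in_carr[OF one_closed] by blast
qed

text \<open>Each isomorphism class is the set of all irreducible modules with one highest weight.
  Over the element type of cosets no such set is empty, because the quotient by
  \<open>maximal_left_ideal l\<close> lives there.\<close>

theorem irreducible_classes_bij:
  "\<exists>\<Phi>. bij_betw \<Phi> dominant_weights (irreducible_classes R :: ('a, 'a set) module set set)"
proof -
  let ?irr = "{M :: ('a, 'a set) module. irreducible_left_module R M}"
  let ?r = "{(M, N). irreducible_left_module R M \<and> irreducible_left_module R N \<and>
    left_module_iso R M N} :: (('a, 'a set) module \<times> ('a, 'a set) module) set"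
  let ?Q = "\<lambda>l. left_quotient R (maximal_left_ideal l)"
  let ?\<Phi> = "\<lambda>l. {N :: ('a, 'a set) module. irreducible_left_module R N \<and> highest_weight N l}"
  have cls: "?r `` {M} = ?\<Phi> l" if "irreducible_left_module R M" "highest_weight M l" for M l
    using that iso_of_highest_weight highest_weight_iso irreducible_left_moduleD(1)
    by (fastforce simp: Image_def)
  have "inj_on ?\<Phi> dominant_weights"
  proof (rule inj_onI)
    fix l m assume lm: "l \<in> dominant_weights" "m \<in> dominant_weights" "?\<Phi> l = ?\<Phi> m"
    have "?Q l \<in> ?\<Phi> l" using irreducible_quotient[OF lm(1)] by simp
    then have "?Q l \<in> ?\<Phi> m" using lm(3) by simp
    then show "l = m" using highest_weight_unique irreducible_quotient[OF lm(1)] by blast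
  qed
  moreover have "?\<Phi> ` dominant_weights = ?irr // ?r"
  proof (intro equalityI subsetI)
    fix X assume "X \<in> ?\<Phi> ` dominant_weights"
    then obtain l where l: "l \<in> dominant_weights" "X = ?\<Phi> l" by blast
    then have "X = ?r `` {?Q l}" using cls[OF irreducible_quotient[OF l(1)]] by simp
    then show "X \<in> ?irr // ?r"
      using irreducible_quotient(1)[OF l(1)] by (auto simp: quotient_def)
  next
    fix X assume "X \<in> ?irr // ?r"
    then obtain M :: "('a, 'a set) module" where M: "irreducible_left_module R M" "X = ?r `` {M}"
      by (auto simp: quotient_def)
    obtain l where l: "highest_weight M l"
      using highest_weight_exists irreducible_left_moduleD[OF M(1)] by blast
    then have "l \<in> dominant_weights"
      using highest_weight_dominant irreducible_left_moduleD[OF M(1)] by blast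
    then show "X \<in> ?\<Phi> ` dominant_weights" using cls[OF M(1) l] M(2) by blast
  qed
  ultimately show ?thesis
    unfolding irreducible_classes_def bij_betw_def by blast
qed

theorem irreducible_iso_quotient:
  fixes M :: "('a, 'm) module"
  assumes M: "irreducible_left_module R M"
  shows "\<exists>N :: ('a, 'a set) module. irreducible_left_module R N \<and> left_module_iso R M N"
proof -
  note lm = irreducible_left_moduleD[OF M]
  obtain l where l: "highest_weight M l" using highest_weight_exists lm by blast
  then have "l \<in> dominant_weights" using highest_weight_dominant lm by blast
  from irreducible_quotient[OF this] iso_of_highest_weight[OF M _ l] show ?thesis by blast
qed

end

text \<open>HOL-Algebra uses the syntax \<open>inv\<close> for inverses in a group.\<close>

abbreviation perm_inv :: "('a \<Rightarrow> 'b) \<Rightarrow> 'b \<Rightarrow> 'a" where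
  "perm_inv \<equiv> inv_into UNIV"

lemma comp_perm_inv: "\<lbrakk>a permutes A; g \<circ> a = f\<rbrakk> \<Longrightarrow> f \<circ> perm_inv a = g"
  by (metis comp_id o_assoc permutes_inv_o(1))

section \<open>Words and orbits of pairs of words\<close>

text \<open>Equal fibre sizes mean equal multisets of values. Applied to letters this compares words
  of one weight, applied to pairs of letters it compares orbits of pairs.\<close>

lemma exists_permutation_of_fibres:
  assumes "finite A" and "\<And>s. card {k \<in> A. f k = s} = card {k \<in> A. g k = s}"
  obtains \<sigma> where "\<sigma> permutes A" "\<And>k. k \<in> A \<Longrightarrow> f k = g (\<sigma> k)"
proof -
  have "image_mset f (mset_set A) = image_mset g (mset_set A)"
    using assms by (intro multiset_eqI) (simp add: count_image_mset_eq_card_vimage)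
  from image_mset_eq_implies_permutes[OF assms(1) this]
  obtain \<sigma> where "\<sigma> permutes A" "\<forall>k\<in>A. f k = g (\<sigma> k)" .
  then show thesis by (intro that) auto
qed

lemma card_permuted_fibre:
  assumes "\<sigma> permutes A"
  shows "card {k \<in> A. P (\<sigma> k)} = card {k \<in> A. P k}"
proof (rule bij_betw_same_card[of \<sigma>])
  have "\<sigma> ` {k \<in> A. P (\<sigma> k)} = {k \<in> A. P k}"
  proof (intro equalityI subsetI)
    fix k assume "k \<in> {k \<in> A. P k}"
    then have "perm_inv \<sigma> k \<in> A" "\<sigma> (perm_inv \<sigma> k) = k" "P k"
      using assms by (auto simp: permutes_inverses permutes_in_image permutes_inv)
    then show "k \<in> \<sigma> ` {k \<in> A. P (\<sigma> k)}" by (metis (mono_tags, lifting) image_eqI mem_Collect_eq)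
  qed (use assms permutes_in_image in fastforce)
  then show "bij_betw \<sigma> {k \<in> A. P (\<sigma> k)} {k \<in> A. P k}"
    using permutes_inj[OF assms] by (auto simp: bij_betw_def inj_on_def)
qed

lemma sum_list_take_mono: "i \<le> j \<Longrightarrow> sum_list (take i xs) \<le> sum_list (take j (xs :: nat list))"
  by (metis le_add1 le_iff_add sum_list_append take_add)

lemma sum_list_take_Suc: "i < length xs \<Longrightarrow>
  sum_list (take (Suc i) xs) = sum_list (take i xs) + (xs ! i :: nat)"
  by (simp add: take_Suc_conv_app_nth)

locale words =
  fixes r n :: nat
begin

declare One_nat_def [simp del]

text \<open>Words are extensional functions. Permutations of \<open>{1..r}\<close> fix all other
  numbers, so composing with them stays in \<open>W\<close>, and equality of words is plain equality
  of functions.\<close>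

definition W :: "(nat \<Rightarrow> nat) set" where
  "W = {1..r} \<rightarrow>\<^sub>E {..<n}"

definition weight :: "(nat \<Rightarrow> nat) \<Rightarrow> nat list" where
  "weight u = map (\<lambda>i. card {k \<in> {1..r}. u k = i}) [0..<n]"

text \<open>The weakly increasing word whose fibres are the blocks of \<open>lam\<close>; the
  \<open>LEAST\<close> passes over empty blocks.\<close>

definition canonical :: "nat list \<Rightarrow> nat \<Rightarrow> nat" where
  "canonical lam = (\<lambda>k\<in>{1..r}. LEAST i. k \<le> sum_list (take (Suc i) lam))"

definition same_orbit :: "(nat \<Rightarrow> nat) \<times> (nat \<Rightarrow> nat) \<Rightarrow> (nat \<Rightarrow> nat) \<times> (nat \<Rightarrow> nat) \<Rightarrow> bool" where
  "same_orbit p q \<longleftrightarrow> (\<exists>\<sigma>. \<sigma> permutes {1..r} \<and> fst q = fst p \<circ> \<sigma> \<and> snd q = snd p \<circ> \<sigma>)"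

text \<open>The middle component is the double coset of the pair. Collecting all \<open>g\<close>
  that fit, instead of choosing one, makes the index of an orbit literally equal for all its
  pairs.\<close>

definition pair_index :: "(nat \<Rightarrow> nat) \<Rightarrow> (nat \<Rightarrow> nat) \<Rightarrow> schur_index" where
  "pair_index u v = (weight u,
     {g. g permutes {1..r} \<and> same_orbit (canonical (weight u) \<circ> g, canonical (weight v)) (u, v)},
     weight v)"

lemma finite_W: "finite W"
  by (simp add: W_def finite_PiE)

lemma word_compose: "\<lbrakk>u \<in> W; \<sigma> permutes {1..r}\<rbrakk> \<Longrightarrow> u \<circ> \<sigma> \<in> W"
  unfolding W_def PiE_iff extensional_def
  using permutes_in_image[of \<sigma> "{1..r}"] permutes_not_in[of \<sigma> "{1..r}"] by simp

lemma word_eqI: "\<lbrakk>u \<in> W; v \<in> W; \<And>k. k \<in> {1..r} \<Longrightarrow> u k = v k\<rbrakk> \<Longrightarrow> u = v"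
  unfolding W_def by (rule PiE_ext)

lemma length_weight [simp]: "length (weight u) = n"
  by (simp add: weight_def)

lemma nth_weight: "i < n \<Longrightarrow> weight u ! i = card {k \<in> {1..r}. u k = i}"
  by (simp add: weight_def)

lemma sum_take_weight:
  assumes "u \<in> W" "t \<le> n"
  shows "sum_list (take t (weight u)) = card {k \<in> {1..r}. u k < t}"
proof -
  have "sum_list (take t (weight u)) = (\<Sum>i<t. card {k \<in> {1..r}. u k = i})"
    using assms(2) by (simp add: weight_def take_map interv_sum_list_conv_sum_set_nat atLeast0LessThan)
  also have "\<dots> = card (\<Union>i<t. {k \<in> {1..r}. u k = i})"
    by (rule card_UN_disjoint[symmetric]) auto
  also have "(\<Union>i<t. {k \<in> {1..r}. u k = i}) = {k \<in> {1..r}. u k < t}" by auto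
  finally show ?thesis .
qed

lemma weight_in_compositions:
  assumes "u \<in> W" shows "weight u \<in> compositions r n"
proof -
  have "{k \<in> {1..r}. u k < n} = {1..r}" using assms by (auto simp: W_def)
  then show ?thesis using sum_take_weight[OF assms, of n] by (simp add: compositions_def)
qed

lemma weight_compose:
  assumes "\<sigma> permutes {1..r}" shows "weight (u \<circ> \<sigma>) = weight u"
  unfolding weight_def o_apply
  by (rule map_cong[OF refl]) (rule card_permuted_fibre[OF assms, of "\<lambda>k. u k = i" for i])

lemma weight_eqD:
  assumes "u \<in> W" "v \<in> W" "weight u = weight v"
  obtains \<sigma> where "\<sigma> permutes {1..r}" "u = v \<circ> \<sigma>"
proof -
  have "card {k \<in> {1..r}. u k = s} = card {k \<in> {1..r}. v k = s}" for s
  proof (cases "s < n")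
    case True then show ?thesis using arg_cong[OF assms(3), of "\<lambda>l. l ! s"] by (simp add: nth_weight)
  next
    case False
    then have "{k \<in> {1..r}. u k = s} = {}" "{k \<in> {1..r}. v k = s} = {}"
      using assms(1,2) by (auto simp: W_def)
    then show ?thesis by (simp only:)
  qed
  from exists_permutation_of_fibres[OF finite_atLeastAtMost this] obtain \<sigma>
    where \<sigma>: "\<sigma> permutes {1..r}" "\<And>k. k \<in> {1..r} \<Longrightarrow> u k = v (\<sigma> k)" by blast
  then have "u = v \<circ> \<sigma>" using assms by (intro word_eqI word_compose) auto
  with \<sigma> that show thesis by blast
qed

lemma canonical_block:
  assumes lam: "lam \<in> compositions r n" and i: "i < n"
  shows "block lam i = {k \<in> {1..r}. canonical lam k = i}"
proof -
  let ?S = "\<lambda>i. sum_list (take i lam)"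
  have len: "length lam = n" and Sn: "?S n = r" using lam by (auto simp: compositions_def)
  have mono: "?S a \<le> ?S b" if "a \<le> b" for a b using that by (rule sum_list_take_mono)
  have least: "(LEAST i. k \<le> ?S (Suc i)) = i \<longleftrightarrow> ?S i < k" if k: "k \<le> ?S (Suc i)" "1 \<le> k" for k
  proof
    assume L: "(LEAST i. k \<le> ?S (Suc i)) = i"
    show "?S i < k"
    proof (cases i)
      case 0 then show ?thesis using k by simp
    next
      case (Suc j) then show ?thesis using not_less_Least[of j "\<lambda>i. k \<le> ?S (Suc i)"] L by simp
    qed
  next
    assume "?S i < k"
    moreover have "i \<le> j" if "k \<le> ?S (Suc j)" for j
    proof (rule ccontr)
      assume "\<not> i \<le> j"
      then have "?S (Suc j) \<le> ?S i" by (intro mono) simp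
      with that \<open>?S i < k\<close> show False by simp
    qed
    ultimately show "(LEAST i. k \<le> ?S (Suc i)) = i" using k by (intro Least_equality)
  qed
  show ?thesis
  proof (intro equalityI subsetI)
    fix k assume "k \<in> block lam i"
    then have k: "?S i < k" "k \<le> ?S (Suc i)" by (auto simp: block_def)
    moreover have "?S (Suc i) \<le> r" using mono[of "Suc i" n] i Sn by simp
    ultimately show "k \<in> {k \<in> {1..r}. canonical lam k = i}" using least[of k] by (simp add: canonical_def)
  next
    fix k assume k: "k \<in> {k \<in> {1..r}. canonical lam k = i}"
    then have ki: "(LEAST i. k \<le> ?S (Suc i)) = i" by (auto simp: canonical_def)
    \<comment> \<open>The last block index \<open>n - 1\<close> shows that the \<open>LEAST\<close>
      ranges over a nonempty set.\<close>
    have "k \<le> ?S (Suc (n - 1))" using k i Sn by simp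
    then have "k \<le> ?S (Suc i)" using LeastI[of "\<lambda>i. k \<le> ?S (Suc i)"] ki by metis
    then show "k \<in> block lam i" using least[of k] ki k by (simp add: block_def)
  qed
qed

lemma canonical_in_W:
  assumes lam: "lam \<in> compositions r n"
  shows "canonical lam \<in> W"
proof -
  let ?S = "\<lambda>i. sum_list (take i lam)"
  have "(LEAST i. k \<le> ?S (Suc i)) < n" if k: "k \<in> {1..r}" for k
  proof -
    have "n \<noteq> 0" using lam k by (auto simp: compositions_def)
    moreover have "(LEAST i. k \<le> ?S (Suc i)) \<le> n - 1"
      using lam k \<open>n \<noteq> 0\<close> by (intro Least_le) (simp add: compositions_def)
    ultimately show ?thesis by simp
  qed
  then show ?thesis by (simp add: W_def canonical_def)
qed

lemma weight_canonical:
  assumes lam: "lam \<in> compositions r n"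
  shows "weight (canonical lam) = lam"
proof (rule nth_equalityI)
  fix i assume "i < length (weight (canonical lam))"
  then have i: "i < n" by simp
  then have "weight (canonical lam) ! i = card (block lam i)"
    using canonical_block[OF lam i] by (simp add: nth_weight)
  also have "block lam i = {sum_list (take i lam)<..sum_list (take (Suc i) lam)}"
    by (auto simp: block_def)
  finally show "weight (canonical lam) ! i = lam ! i"
    using lam i by (simp add: compositions_def sum_list_take_Suc)
qed (use lam in \<open>simp add: compositions_def\<close>)

text \<open>A permutation preserves all blocks iff it preserves the word whose fibres they are. This
  turns Young subgroups into stabilizers.\<close>

lemma young_eq:
  assumes lam: "lam \<in> compositions r n"
  shows "young r lam = {\<sigma>. \<sigma> permutes {1..r} \<and> canonical lam \<circ> \<sigma> = canonical lam}"
proof -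
  let ?w = "canonical lam"
  have len: "length lam = n" using lam by (simp add: compositions_def)
  have "(\<forall>i<n. \<sigma> ` block lam i = block lam i) \<longleftrightarrow> ?w \<circ> \<sigma> = ?w" if \<sigma>: "\<sigma> permutes {1..r}" for \<sigma>
  proof
    assume A: "\<forall>i<n. \<sigma> ` block lam i = block lam i"
    show "?w \<circ> \<sigma> = ?w"
    proof (rule word_eqI)
      fix k assume k: "k \<in> {1..r}"
      define i where "i = ?w k"
      have "i < n" using canonical_in_W[OF lam] k by (auto simp: W_def i_def)
      moreover have "k \<in> block lam i" using canonical_block[OF lam \<open>i < n\<close>] k by (simp add: i_def)
      ultimately have "\<sigma> k \<in> block lam i" using A by blast
      then show "(?w \<circ> \<sigma>) k = ?w k" using canonical_block[OF lam \<open>i < n\<close>] by (simp add: i_def)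
    qed (use canonical_in_W[OF lam] \<sigma> word_compose in auto)
  next
    assume A: "?w \<circ> \<sigma> = ?w"
    show "\<forall>i<n. \<sigma> ` block lam i = block lam i"
    proof (intro allI impI card_subset_eq)
      fix i assume i: "i < n"
      show "finite (block lam i)" using canonical_block[OF lam i] by simp
      show "card (\<sigma> ` block lam i) = card (block lam i)"
        using permutes_inj[OF \<sigma>] by (simp add: card_image inj_on_subset)
      show "\<sigma> ` block lam i \<subseteq> block lam i"
        unfolding canonical_block[OF lam i] using fun_cong[OF A] permutes_in_image[OF \<sigma>] by auto
    qed
  qed
  then show ?thesis by (auto simp: young_def len)
qed

lemma same_orbit_refl: "same_orbit p p"
  unfolding same_orbit_def by (intro exI[of _ id]) (simp add: permutes_id)

lemma same_orbit_sym: assumes "same_orbit p q" shows "same_orbit q p"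
proof -
  obtain \<sigma> where \<sigma>: "\<sigma> permutes {1..r}" "fst q = fst p \<circ> \<sigma>" "snd q = snd p \<circ> \<sigma>"
    using assms by (auto simp: same_orbit_def)
  then have "fst p = fst q \<circ> perm_inv \<sigma>" "snd p = snd q \<circ> perm_inv \<sigma>"
    by (simp_all add: o_assoc[symmetric] permutes_inv_o)
  with \<sigma> permutes_inv show ?thesis unfolding same_orbit_def by blast
qed

lemma same_orbit_trans: assumes "same_orbit p q" "same_orbit q s" shows "same_orbit p s"
  using assms unfolding same_orbit_def by (metis o_assoc permutes_compose)

lemma same_orbit_compose: "\<sigma> permutes {1..r} \<Longrightarrow> same_orbit (u, v) (u \<circ> \<sigma>, v \<circ> \<sigma>)"
  by (auto simp: same_orbit_def)

text \<open>Left multiplication by the stabilizer of \<open>canonical lam\<close> does not change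
  the word \<open>canonical lam \<circ> g\<close>, and right multiplication by the stabilizer of
  \<open>canonical mu\<close> moves the pair within its orbit while keeping its second word.\<close>

lemma double_coset_eq:
  assumes lam: "lam \<in> compositions r n" and mu: "mu \<in> compositions r n" and \<alpha>: "\<alpha> permutes {1..r}"
  shows "double_coset r lam \<alpha> mu =
    {g. g permutes {1..r} \<and> same_orbit (canonical lam \<circ> g, canonical mu) (canonical lam \<circ> \<alpha>, canonical mu)}"
proof (intro equalityI subsetI)
  fix g assume "g \<in> double_coset r lam \<alpha> mu"
  then obtain \<sigma> \<pi> where g: "g = \<sigma> \<circ> \<alpha> \<circ> \<pi>" and \<sigma>: "\<sigma> \<in> young r lam" and \<pi>: "\<pi> \<in> young r mu"
    by (auto simp: double_coset_def)
  have "same_orbit (canonical lam \<circ> \<alpha>, canonical mu) (canonical lam \<circ> g, canonical mu)"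
    unfolding same_orbit_def using \<sigma> \<pi>
    by (intro exI[of _ \<pi>]) (simp add: young_eq[OF lam] young_eq[OF mu] g o_assoc)
  moreover have "g permutes {1..r}" unfolding g using \<sigma> \<pi> \<alpha> by (auto simp: young_def intro!: permutes_compose)
  ultimately show "g \<in> {g. g permutes {1..r} \<and>
      same_orbit (canonical lam \<circ> g, canonical mu) (canonical lam \<circ> \<alpha>, canonical mu)}"
    using same_orbit_sym by blast
next
  fix g assume "g \<in> {g. g permutes {1..r} \<and>
      same_orbit (canonical lam \<circ> g, canonical mu) (canonical lam \<circ> \<alpha>, canonical mu)}"
  then have g: "g permutes {1..r}"
    and "same_orbit (canonical lam \<circ> \<alpha>, canonical mu) (canonical lam \<circ> g, canonical mu)"
    using same_orbit_sym by auto
  then obtain \<pi> where \<pi>: "\<pi> permutes {1..r}"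
    and eq: "canonical lam \<circ> g = canonical lam \<circ> \<alpha> \<circ> \<pi>" "canonical mu = canonical mu \<circ> \<pi>"
    by (auto simp: same_orbit_def)
  \<comment> \<open>The orbit relation supplies \<open>\<pi>\<close>; this is the left factor that
    remains in \<open>g = \<sigma> \<circ> \<alpha> \<circ> \<pi>\<close>.\<close>
  let ?\<sigma> = "g \<circ> perm_inv (\<alpha> \<circ> \<pi>)"
  have ap: "\<alpha> \<circ> \<pi> permutes {1..r}" using \<alpha> \<pi> by (intro permutes_compose)
  have "canonical lam \<circ> ?\<sigma> = canonical lam \<circ> (\<alpha> \<circ> \<pi>) \<circ> perm_inv (\<alpha> \<circ> \<pi>)"
    using eq by (simp add: o_assoc)
  also have "\<dots> = canonical lam" using permutes_inv_o(1)[OF ap] by (simp only: o_assoc[symmetric] o_id)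
  finally have "?\<sigma> \<in> young r lam" using g permutes_inv[OF ap] by (simp add: young_eq[OF lam] permutes_compose)
  moreover have "\<pi> \<in> young r mu" using \<pi> eq by (simp add: young_eq[OF mu])
  moreover have "g = ?\<sigma> \<circ> \<alpha> \<circ> \<pi>"
    using permutes_inv_o(2)[OF ap] by (simp only: o_assoc[symmetric] o_id)
  ultimately show "g \<in> double_coset r lam \<alpha> mu" unfolding double_coset_def by blast
qed

lemma pair_index_canonical:
  assumes lam: "lam \<in> compositions r n" and mu: "mu \<in> compositions r n" and \<alpha>: "\<alpha> permutes {1..r}"
  shows "pair_index (canonical lam \<circ> \<alpha>) (canonical mu) = (lam, double_coset r lam \<alpha> mu, mu)"
  by (simp add: pair_index_def weight_compose \<alpha> weight_canonical lam mu double_coset_eq)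

lemma pair_index_cong:
  assumes "same_orbit (u, v) (i, j)"
  shows "pair_index u v = pair_index i j"
proof -
  have w: "weight i = weight u" "weight j = weight v"
    using assms weight_compose by (auto simp: same_orbit_def)
  have "same_orbit q (u, v) \<longleftrightarrow> same_orbit q (i, j)" for q
    using assms same_orbit_trans same_orbit_sym by blast
  then show ?thesis by (simp add: pair_index_def w)
qed

text \<open>Both words are rearrangements of canonical ones, by \<open>\<sigma>\<close> and
  \<open>\<tau>\<close>. Undoing \<open>\<tau>\<close> on both places makes the second word
  canonical and leaves \<open>\<sigma>\<close> followed by the inverse of \<open>\<tau>\<close> on
  the first.\<close>

lemma canonical_pair:
  assumes u: "u \<in> W" and v: "v \<in> W"
  obtains \<alpha> where "\<alpha> permutes {1..r}"
    "same_orbit (canonical (weight u) \<circ> \<alpha>, canonical (weight v)) (u, v)"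
proof -
  note c = weight_in_compositions canonical_in_W weight_canonical
  obtain \<sigma> where \<sigma>: "\<sigma> permutes {1..r}" "u = canonical (weight u) \<circ> \<sigma>"
    using weight_eqD[of u "canonical (weight u)"] u c by metis
  obtain \<tau> where \<tau>: "\<tau> permutes {1..r}" "v = canonical (weight v) \<circ> \<tau>"
    using weight_eqD[of v "canonical (weight v)"] v c by metis
  show thesis
  proof
    show "\<sigma> \<circ> perm_inv \<tau> permutes {1..r}" using \<sigma> \<tau> by (intro permutes_compose permutes_inv)
    have "canonical (weight u) \<circ> (\<sigma> \<circ> perm_inv \<tau>) \<circ> \<tau> = canonical (weight u) \<circ> \<sigma>"
      using permutes_inv_o(2)[OF \<tau>(1)] by (simp only: o_assoc[symmetric] o_id)
    then show "same_orbit (canonical (weight u) \<circ> (\<sigma> \<circ> perm_inv \<tau>), canonical (weight v)) (u, v)"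
      using \<sigma> \<tau> unfolding same_orbit_def by (intro exI[of _ \<tau>]) simp
  qed
qed

text \<open>The permutations recorded in the index of \<open>(u, v)\<close> form a nonempty set by
  \<open>canonical_pair\<close>, and one that is recorded for both pairs links them to the same
  canonical pair.\<close>

lemma pair_index_eq_iff:
  assumes u: "u \<in> W" and v: "v \<in> W"
  shows "pair_index u v = pair_index i j \<longleftrightarrow> same_orbit (u, v) (i, j)"
proof
  assume eq: "pair_index u v = pair_index i j"
  obtain \<alpha> where \<alpha>: "\<alpha> permutes {1..r}"
    "same_orbit (canonical (weight u) \<circ> \<alpha>, canonical (weight v)) (u, v)"
    using canonical_pair[OF u v] .
  then have "\<alpha> \<in> fst (snd (pair_index u v))" by (simp add: pair_index_def)
  then have "\<alpha> \<in> fst (snd (pair_index i j))" by (simp add: eq)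
  then have "same_orbit (canonical (weight u) \<circ> \<alpha>, canonical (weight v)) (i, j)"
    using eq by (simp add: pair_index_def)
  with \<alpha> show "same_orbit (u, v) (i, j)" using same_orbit_sym same_orbit_trans by blast
qed (rule pair_index_cong)

lemma pair_index_in:
  assumes u: "u \<in> W" and v: "v \<in> W"
  shows "pair_index u v \<in> schur_indices r n"
proof -
  obtain \<alpha> where \<alpha>: "\<alpha> permutes {1..r}"
    "same_orbit (canonical (weight u) \<circ> \<alpha>, canonical (weight v)) (u, v)"
    using canonical_pair[OF u v] .
  then have "pair_index u v = (weight u, double_coset r (weight u) \<alpha> (weight v), weight v)"
    using pair_index_cong[OF \<alpha>(2)] pair_index_canonical[OF _ _ \<alpha>(1)] weight_in_compositions u v by simp
  with \<alpha> show ?thesis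
    using weight_in_compositions u v by (auto simp: schur_indices_def double_cosets_def)
qed

lemma schur_indexE:
  assumes "(lam, D, mu) \<in> schur_indices r n"
  obtains "lam \<in> compositions r n" "mu \<in> compositions r n" "rep D permutes {1..r}"
    "(lam, D, mu) = pair_index (canonical lam \<circ> rep D) (canonical mu)"
proof -
  obtain \<alpha> where lam: "lam \<in> compositions r n" and mu: "mu \<in> compositions r n"
    and \<alpha>: "\<alpha> permutes {1..r}" "D = double_coset r lam \<alpha> mu"
    using assms by (auto simp: schur_indices_def double_cosets_def)
  have "\<alpha> \<in> D" using double_coset_eq[OF lam mu \<alpha>(1)] \<alpha> same_orbit_refl by auto
  then have "rep D \<in> D" unfolding rep_def by (rule someI[of "\<lambda>a. a \<in> D"])
  then have rep: "rep D permutes {1..r}"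
    "same_orbit (canonical lam \<circ> rep D, canonical mu) (canonical lam \<circ> \<alpha>, canonical mu)"
    using double_coset_eq[OF lam mu \<alpha>(1)] \<alpha>(2) by auto
  have "pair_index (canonical lam \<circ> rep D) (canonical mu) = (lam, D, mu)"
    using pair_index_cong[OF rep(2)] pair_index_canonical[OF lam mu \<alpha>(1)] \<alpha>(2) by simp
  with lam mu rep(1) that show thesis by simp
qed

lemma schur_index_pair:
  assumes "z \<in> schur_indices r n"
  obtains u v where "u \<in> W" "v \<in> W" "z = pair_index u v"
proof -
  obtain lam D mu where z: "z = (lam, D, mu)" by (cases z)
  show thesis
    using schur_indexE[OF assms[unfolded z]] that canonical_in_W word_compose z by metis
qed

section \<open>The structure constants count intermediate words\<close>

text \<open>\<open>G_R\<close> is the intersection of one Young subgroup with a conjugate of the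
  other. Conjugation by \<open>\<alpha>\<close> turns it into the common stabilizer of two
  words.\<close>

lemma n_R_eq_card_stabilizer:
  assumes lam: "lam \<in> compositions r n" and mu: "mu \<in> compositions r n" and \<alpha>: "\<alpha> permutes {1..r}"
  shows "n_R r lam \<alpha> mu = card {a. a permutes {1..r} \<and>
    canonical lam \<circ> \<alpha> \<circ> a = canonical lam \<circ> \<alpha> \<and> canonical mu \<circ> a = canonical mu}"
  unfolding n_R_def
proof (rule bij_betw_same_card[of "\<lambda>\<sigma>. perm_inv \<alpha> \<circ> \<sigma> \<circ> \<alpha>"], rule bij_betwI[where g = "\<lambda>a. \<alpha> \<circ> a \<circ> perm_inv \<alpha>"])
  note a1 = permutes_inv_o(1)[OF \<alpha>] and a2 = permutes_inv_o(2)[OF \<alpha>]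
  have c1: "\<alpha> \<circ> (perm_inv \<alpha> \<circ> f) = f" and c2: "perm_inv \<alpha> \<circ> (\<alpha> \<circ> f) = f" for f :: "nat \<Rightarrow> nat"
    using a1 a2 by (simp_all add: o_assoc)
  show "(\<lambda>\<sigma>. perm_inv \<alpha> \<circ> \<sigma> \<circ> \<alpha>) \<in> G_R r lam \<alpha> mu \<rightarrow> {a. a permutes {1..r} \<and>
    canonical lam \<circ> \<alpha> \<circ> a = canonical lam \<circ> \<alpha> \<and> canonical mu \<circ> a = canonical mu}"
  proof
    fix \<sigma> assume "\<sigma> \<in> G_R r lam \<alpha> mu"
    then obtain \<pi> where \<sigma>: "\<sigma> \<in> young r lam" and \<pi>: "\<pi> \<in> young r mu" "\<sigma> \<circ> \<alpha> = \<alpha> \<circ> \<pi>"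
      by (auto simp: G_R_def)
    have eq: "perm_inv \<alpha> \<circ> \<sigma> \<circ> \<alpha> = \<pi>" using \<pi>(2) c2 by (simp add: o_assoc[symmetric])
    have "canonical lam \<circ> \<alpha> \<circ> \<pi> = canonical lam \<circ> \<alpha>"
      using \<sigma> \<pi>(2) unfolding young_eq[OF lam] by (metis (mono_tags, lifting) mem_Collect_eq o_assoc)
    then show "perm_inv \<alpha> \<circ> \<sigma> \<circ> \<alpha> \<in> {a. a permutes {1..r} \<and>
      canonical lam \<circ> \<alpha> \<circ> a = canonical lam \<circ> \<alpha> \<and> canonical mu \<circ> a = canonical mu}"
      unfolding eq using \<pi>(1) by (simp add: young_eq[OF mu])
  qed
  show "(\<lambda>a. \<alpha> \<circ> a \<circ> perm_inv \<alpha>) \<in> {a. a permutes {1..r} \<and>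
    canonical lam \<circ> \<alpha> \<circ> a = canonical lam \<circ> \<alpha> \<and> canonical mu \<circ> a = canonical mu} \<rightarrow> G_R r lam \<alpha> mu"
  proof
    fix a assume "a \<in> {a. a permutes {1..r} \<and>
      canonical lam \<circ> \<alpha> \<circ> a = canonical lam \<circ> \<alpha> \<and> canonical mu \<circ> a = canonical mu}"
    then have a: "a permutes {1..r}" "canonical lam \<circ> \<alpha> \<circ> a = canonical lam \<circ> \<alpha>" "canonical mu \<circ> a = canonical mu"
      by auto
    have "canonical lam \<circ> (\<alpha> \<circ> a \<circ> perm_inv \<alpha>) = canonical lam \<circ> \<alpha> \<circ> perm_inv \<alpha>"
      using a(2) by (simp add: o_assoc)
    also have "\<dots> = canonical lam" using a1 by (simp add: o_assoc[symmetric])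
    finally have "\<alpha> \<circ> a \<circ> perm_inv \<alpha> \<in> young r lam"
      using a \<alpha> by (simp add: young_eq[OF lam] permutes_compose permutes_inv)
    moreover have "a \<in> young r mu" using a by (simp add: young_eq[OF mu])
    moreover have "\<alpha> \<circ> a \<circ> perm_inv \<alpha> \<circ> \<alpha> = \<alpha> \<circ> a" using a2 by (simp add: o_assoc[symmetric])
    ultimately show "\<alpha> \<circ> a \<circ> perm_inv \<alpha> \<in> G_R r lam \<alpha> mu" unfolding G_R_def by blast
  qed
  show "\<alpha> \<circ> (perm_inv \<alpha> \<circ> \<sigma> \<circ> \<alpha>) \<circ> perm_inv \<alpha> = \<sigma>" for \<sigma>
    by (simp add: o_assoc[symmetric] c1 a1)
  show "perm_inv \<alpha> \<circ> (\<alpha> \<circ> a \<circ> perm_inv \<alpha>) \<circ> \<alpha> = a" for a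
    by (simp add: o_assoc[symmetric] c2 a2)
qed

text \<open>The permutations that carry one pair to another form a coset of the stabilizer.\<close>

lemma card_transporter:
  assumes "same_orbit (u, v) (i, j)"
  shows "card {a. a permutes {1..r} \<and> u \<circ> a = i \<and> v \<circ> a = j} =
    card {a. a permutes {1..r} \<and> u \<circ> a = u \<and> v \<circ> a = v}"
proof -
  obtain \<sigma> where \<sigma>: "\<sigma> permutes {1..r}" "i = u \<circ> \<sigma>" "j = v \<circ> \<sigma>"
    using assms by (auto simp: same_orbit_def)
  note s1 = permutes_inv_o(1)[OF \<sigma>(1)] and s2 = permutes_inv_o(2)[OF \<sigma>(1)]
  have shift: "f \<circ> a = f \<circ> \<sigma> \<Longrightarrow> f \<circ> (a \<circ> perm_inv \<sigma>) = f" for f a :: "nat \<Rightarrow> nat"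
    by (simp add: o_assoc comp_perm_inv[OF \<sigma>(1)])
  show ?thesis
  proof (rule bij_betw_same_card[of "\<lambda>a. a \<circ> perm_inv \<sigma>"], rule bij_betwI[where g = "\<lambda>a. a \<circ> \<sigma>"])
    show "a \<circ> perm_inv \<sigma> \<circ> \<sigma> = a" "a \<circ> \<sigma> \<circ> perm_inv \<sigma> = a" for a
      using s1 s2 by (simp_all add: o_assoc[symmetric])
  qed (use \<sigma> shift in \<open>auto simp: permutes_compose permutes_inv o_assoc\<close>)
qed

text \<open>The multiplication rule with its denominators cleared. Because the factors
  \<open>n_R\<close> on the left are positive, it also shows that the division in
  \<open>schur_coeff\<close> is exact.\<close>

lemma card_intermediate_words:
  assumes lam: "lam \<in> compositions r n" and nu: "nu \<in> compositions r n" and mu: "mu \<in> compositions r n"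
    and \<alpha>: "\<alpha> permutes {1..r}" and \<beta>: "\<beta> permutes {1..r}" and \<gamma>: "\<gamma> permutes {1..r}"
    and ij: "same_orbit (canonical lam \<circ> \<gamma>, canonical mu) (i, j)"
  shows "n_R r lam \<alpha> nu * n_R r nu \<beta> mu *
      card {m. same_orbit (canonical lam \<circ> \<alpha>, canonical nu) (i, m) \<and>
        same_orbit (canonical nu \<circ> \<beta>, canonical mu) (m, j)} =
    n_R r lam \<gamma> mu * card {\<rho> \<in> young r nu. \<alpha> \<circ> \<rho> \<circ> \<beta> \<in> double_coset r lam \<gamma> mu}"
    (is "?n1 * ?n2 * card ?C = ?n * card ?N")
proof -
  let ?G = "{a. a permutes {1..r}}"
  let ?u1 = "canonical lam \<circ> \<alpha>" and ?v1 = "canonical nu" and ?u2 = "canonical nu \<circ> \<beta>" and ?v2 = "canonical mu"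
  \<comment> \<open>Count \<open>T\<close> twice: by the intermediate word \<open>m = ?v1 \<circ> a\<close>, and by \<open>\<rho> = a \<circ> (\<beta> \<circ> b)\<^sup>-\<^sup>1\<close>.\<close>
  define T where "T = {(a, b). a \<in> ?G \<and> b \<in> ?G \<and> ?u1 \<circ> a = i \<and> ?v2 \<circ> b = j \<and> ?v1 \<circ> a = ?u2 \<circ> b}"
  define A where "A m = {a. a permutes {1..r} \<and> ?u1 \<circ> a = i \<and> ?v1 \<circ> a = m}" for m
  define B where "B m = {b. b permutes {1..r} \<and> ?u2 \<circ> b = m \<and> ?v2 \<circ> b = j}" for m
  have finG: "finite ?G" by (simp add: finite_permutations)
  have finC: "finite ?C"
  proof (rule finite_subset)
    show "?C \<subseteq> (\<lambda>a. ?v1 \<circ> a) ` ?G" by (auto simp: same_orbit_def)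
  qed (simp add: finG)
  have T1: "T = (\<Union>m\<in>?C. A m \<times> B m)"
    by (auto simp: T_def A_def B_def same_orbit_def)
  have "card T = (\<Sum>m\<in>?C. card (A m \<times> B m))"
    unfolding T1
  proof (rule card_UN_disjoint)
    show "\<forall>m\<in>?C. finite (A m \<times> B m)"
      using finite_subset[OF _ finG] by (auto simp: A_def B_def)
  qed (use finC in \<open>auto simp: A_def\<close>)
  also have "\<dots> = (\<Sum>m\<in>?C. ?n1 * ?n2)"
    by (rule sum.cong)
      (simp_all add: A_def B_def card_cartesian_product card_transporter
        n_R_eq_card_stabilizer[OF lam nu \<alpha>] n_R_eq_card_stabilizer[OF nu mu \<beta>])
  also have "\<dots> = ?n1 * ?n2 * card ?C" by simp
  finally have c1: "card T = ?n1 * ?n2 * card ?C" .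
  define S where "S \<rho> = {b. b permutes {1..r} \<and> canonical lam \<circ> (\<alpha> \<circ> \<rho> \<circ> \<beta>) \<circ> b = i \<and> ?v2 \<circ> b = j}" for \<rho>
  have finN: "finite ?N" by (rule finite_subset[OF _ finG]) (auto simp: young_def)
  have "bij_betw (\<lambda>(\<rho>, b). (\<rho> \<circ> \<beta> \<circ> b, b)) (Sigma ?N S) T"
  proof (rule bij_betwI[where g = "\<lambda>(a, b). (a \<circ> perm_inv (\<beta> \<circ> b), b)"])
    show "(\<lambda>(\<rho>, b). (\<rho> \<circ> \<beta> \<circ> b, b)) \<in> Sigma ?N S \<rightarrow> T"
    proof (clarify)
      fix \<rho> b assume \<rho>: "\<rho> \<in> young r nu" and b: "b \<in> S \<rho>"
      have "?v1 \<circ> (\<rho> \<circ> \<beta> \<circ> b) = ?u2 \<circ> b" using \<rho> by (simp add: young_eq[OF nu] o_assoc)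
      moreover have "?u1 \<circ> (\<rho> \<circ> \<beta> \<circ> b) = i" using b by (simp add: S_def o_assoc)
      ultimately show "(\<rho> \<circ> \<beta> \<circ> b, b) \<in> T"
        using \<rho> b \<beta> by (simp add: T_def S_def young_eq[OF nu] permutes_compose)
    qed
    show "(\<lambda>(a, b). (a \<circ> perm_inv (\<beta> \<circ> b), b)) \<in> T \<rightarrow> Sigma ?N S"
    proof
      fix p assume "p \<in> T"
      then obtain a b where p: "p = (a, b)" "(a, b) \<in> T" by (cases p) simp
      then have a: "a permutes {1..r}" "?u1 \<circ> a = i" "?v1 \<circ> a = ?u2 \<circ> b"
        and b: "b permutes {1..r}" "?v2 \<circ> b = j" by (auto simp: T_def)
      let ?\<rho> = "a \<circ> perm_inv (\<beta> \<circ> b)"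
      have bb: "\<beta> \<circ> b permutes {1..r}" using b \<beta> by (intro permutes_compose)
      have \<rho>: "?\<rho> permutes {1..r}" by (rule permutes_compose[OF permutes_inv[OF bb] a(1)])
      have "?v1 \<circ> ?\<rho> = ?v1 \<circ> (\<beta> \<circ> b) \<circ> perm_inv (\<beta> \<circ> b)" using a(3) by (simp add: o_assoc)
      also have "\<dots> = ?v1" using permutes_inv_o(1)[OF bb] by (simp only: o_assoc[symmetric] o_id)
      finally have y: "?\<rho> \<in> young r nu" using \<rho> by (simp add: young_eq[OF nu])
      have rb: "?\<rho> \<circ> (\<beta> \<circ> b) = a" using permutes_inv_o(2)[OF bb] by (simp only: o_assoc[symmetric] o_id)
      have S: "b \<in> S ?\<rho>" using a(2) b rb by (simp add: S_def o_assoc[symmetric])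
      then have "same_orbit (canonical lam \<circ> (\<alpha> \<circ> ?\<rho> \<circ> \<beta>), canonical mu) (i, j)"
        by (auto simp: S_def same_orbit_def)
      then have "same_orbit (canonical lam \<circ> (\<alpha> \<circ> ?\<rho> \<circ> \<beta>), canonical mu) (canonical lam \<circ> \<gamma>, canonical mu)"
        using ij same_orbit_sym same_orbit_trans by blast
      then have "\<alpha> \<circ> ?\<rho> \<circ> \<beta> \<in> double_coset r lam \<gamma> mu"
        using \<rho> \<alpha> \<beta> by (simp add: double_coset_eq[OF lam mu \<gamma>] permutes_compose)
      with y S show "(case p of (a, b) \<Rightarrow> (a \<circ> perm_inv (\<beta> \<circ> b), b)) \<in> Sigma ?N S" by (simp add: p)
    qed
    fix p assume p: "p \<in> Sigma ?N S"
    then obtain \<rho> b where pb: "p = (\<rho>, b)" and b: "b permutes {1..r}" by (auto simp: S_def)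
    have "\<beta> \<circ> b permutes {1..r}" using b \<beta> by (intro permutes_compose)
    from permutes_inv_o(1)[OF this]
    show "(case case p of (\<rho>, b) \<Rightarrow> (\<rho> \<circ> \<beta> \<circ> b, b) of (a, b) \<Rightarrow> (a \<circ> perm_inv (\<beta> \<circ> b), b)) = p"
      by (simp only: pb prod.case o_assoc[symmetric] o_id)
  next
    fix p assume p: "p \<in> T"
    then obtain a b where pb: "p = (a, b)" and b: "b permutes {1..r}" by (auto simp: T_def)
    have "\<beta> \<circ> b permutes {1..r}" using b \<beta> by (intro permutes_compose)
    from permutes_inv_o(2)[OF this]
    show "(case case p of (a, b) \<Rightarrow> (a \<circ> perm_inv (\<beta> \<circ> b), b) of (\<rho>, b) \<Rightarrow> (\<rho> \<circ> \<beta> \<circ> b, b)) = p"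
      by (simp only: pb prod.case o_assoc[symmetric] o_id)
  qed
  then have "card T = card (Sigma ?N S)" by (simp add: bij_betw_same_card)
  also have "\<dots> = (\<Sum>\<rho>\<in>?N. card (S \<rho>))"
  proof (rule card_SigmaI[OF finN])
    show "\<forall>\<rho>\<in>?N. finite (S \<rho>)" using finite_subset[OF _ finG] by (auto simp: S_def)
  qed
  also have "\<dots> = (\<Sum>\<rho>\<in>?N. ?n)"
  proof (rule sum.cong)
    fix \<rho> assume "\<rho> \<in> ?N"
    then have so: "same_orbit (canonical lam \<circ> (\<alpha> \<circ> \<rho> \<circ> \<beta>), canonical mu) (canonical lam \<circ> \<gamma>, canonical mu)"
      by (auto simp: double_coset_eq[OF lam mu \<gamma>])
    have "card (S \<rho>) = card {a. a permutes {1..r} \<and>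
        canonical lam \<circ> (\<alpha> \<circ> \<rho> \<circ> \<beta>) \<circ> a = canonical lam \<circ> (\<alpha> \<circ> \<rho> \<circ> \<beta>) \<and> canonical mu \<circ> a = canonical mu}"
      unfolding S_def by (rule card_transporter) (rule same_orbit_trans[OF so ij])
    also have "\<dots> = card {a. a permutes {1..r} \<and>
        canonical lam \<circ> (\<alpha> \<circ> \<rho> \<circ> \<beta>) \<circ> a = canonical lam \<circ> \<gamma> \<and> canonical mu \<circ> a = canonical mu}"
      by (rule card_transporter[symmetric]) (rule so)
    \<comment> \<open>Stabilizers of two pairs in one orbit are compared through the transporters
      between the pairs, which inversion interchanges.\<close>
    also have "\<dots> = card {a. a permutes {1..r} \<and>
        canonical lam \<circ> \<gamma> \<circ> a = canonical lam \<circ> (\<alpha> \<circ> \<rho> \<circ> \<beta>) \<and> canonical mu \<circ> a = canonical mu}"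
    proof (rule bij_betw_same_card[of perm_inv], rule bij_betwI[where g = perm_inv])
      show "perm_inv (perm_inv a) = a" if "a \<in> {a. a permutes {1..r} \<and> P a}" for a :: "nat \<Rightarrow> nat" and P
        using that by (auto intro: inv_inv_eq permutes_bij)
      then show "perm_inv (perm_inv a) = a" if "a \<in> {a. a permutes {1..r} \<and> P a}" for a :: "nat \<Rightarrow> nat" and P
        using that by blast
    qed (auto simp: permutes_inv o_assoc intro!: comp_perm_inv)
    also have "\<dots> = ?n"
      unfolding n_R_eq_card_stabilizer[OF lam mu \<gamma>]
      by (rule card_transporter) (rule same_orbit_sym[OF so])
    finally show "card (S \<rho>) = ?n" .
  qed simp
  also have "\<dots> = ?n * card ?N" by simp
  finally show ?thesis using c1 by simp
qed

lemma schur_coeff_eq_card: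
  assumes x: "x \<in> schur_indices r n" and y: "y \<in> schur_indices r n"
    and i: "i \<in> W" and j: "j \<in> W"
  shows "schur_coeff r x y (pair_index i j) = card {m \<in> W. pair_index i m = x \<and> pair_index m j = y}"
proof -
  obtain lam D1 nu where xe: "x = (lam, D1, nu)" by (cases x)
  obtain om D2 mu where ye: "y = (om, D2, mu)" by (cases y)
  obtain D where ze: "pair_index i j = (weight i, D, weight j)" by (simp add: pair_index_def)
  show ?thesis
  proof (cases "nu = om \<and> weight i = lam \<and> weight j = mu")
    case False
    then have "{m \<in> W. pair_index i m = x \<and> pair_index m j = y} = {}"
      by (auto simp: xe ye pair_index_def)
    moreover have "schur_coeff r x y (pair_index i j) = 0" using False by (auto simp: xe ye ze)
    ultimately show ?thesis by (simp only: card.empty)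
  next
    case True
    then have eqs: "om = nu" "weight i = lam" "weight j = mu" by auto
    have z: "(lam, D, mu) \<in> schur_indices r n" using pair_index_in[OF i j] ze eqs by simp
    from schur_indexE[OF x[unfolded xe]] have lam: "lam \<in> compositions r n"
      and nu: "nu \<in> compositions r n" and \<alpha>: "rep D1 permutes {1..r}"
      and x': "x = pair_index (canonical lam \<circ> rep D1) (canonical nu)" by (metis xe)+
    from schur_indexE[OF y[unfolded ye]] eqs have mu: "mu \<in> compositions r n"
      and \<beta>: "rep D2 permutes {1..r}"
      and y': "y = pair_index (canonical nu \<circ> rep D2) (canonical mu)" by (metis ye)+
    from schur_indexE[OF z] have \<gamma>: "rep D permutes {1..r}"
      and z': "pair_index i j = pair_index (canonical lam \<circ> rep D) (canonical mu)" by (metis eqs(2,3) ze)+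
    note cW = canonical_in_W word_compose
    have D: "D = double_coset r lam (rep D) mu"
      using z' pair_index_canonical[OF lam mu \<gamma>] ze by simp
    have ij: "same_orbit (canonical lam \<circ> rep D, canonical mu) (i, j)"
      by (rule pair_index_eq_iff[THEN iffD1, OF _ _ z'[symmetric]]) (use lam mu \<gamma> cW in auto)
    have C: "{m \<in> W. pair_index i m = x \<and> pair_index m j = y} =
      {m. same_orbit (canonical lam \<circ> rep D1, canonical nu) (i, m) \<and>
        same_orbit (canonical nu \<circ> rep D2, canonical mu) (m, j)}" (is "_ = ?C")
    proof -
      have "m \<in> W" if "same_orbit (canonical lam \<circ> rep D1, canonical nu) (i, m)" for m
        using that cW nu by (auto simp: same_orbit_def)
      moreover have "pair_index i m = x \<longleftrightarrow> same_orbit (canonical lam \<circ> rep D1, canonical nu) (i, m)" for m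
        unfolding x' using pair_index_eq_iff[of "canonical lam \<circ> rep D1" "canonical nu" i m] lam nu \<alpha> cW by auto
      moreover have "pair_index m j = y \<longleftrightarrow> same_orbit (canonical nu \<circ> rep D2, canonical mu) (m, j)" for m
        unfolding y' using pair_index_eq_iff[of "canonical nu \<circ> rep D2" "canonical mu" m j] mu nu \<beta> cW by auto
      ultimately show ?thesis by blast
    qed
    \<comment> \<open>The identity lies in every stabilizer, so the divisor is positive and
      cancels.\<close>
    have pos: "n_R r lam (rep D1) nu * n_R r nu (rep D2) mu > 0"
    proof -
      have "0 < n_R r la a m" if "la \<in> compositions r n" "m \<in> compositions r n" "a permutes {1..r}" for la a m
        unfolding n_R_eq_card_stabilizer[OF that] card_gt_0_iff
        by (auto intro!: exI[of _ id] permutes_id finite_subset[OF _ finite_permutations[of "{1..r}"]])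
      then show ?thesis using lam nu mu \<alpha> \<beta> by simp
    qed
    have "schur_coeff r x y (pair_index i j) =
      (n_R r lam (rep D) mu * card {\<rho> \<in> young r nu. rep D1 \<circ> \<rho> \<circ> rep D2 \<in> D}) div
      (n_R r lam (rep D1) nu * n_R r nu (rep D2) mu)"
      by (simp add: xe ye ze eqs n_R_coset_def N_coset_def)
    also have "\<dots> = card ?C"
      unfolding card_intermediate_words[OF lam nu mu \<alpha> \<beta> \<gamma> ij, folded D, symmetric]
      using pos by simp
    finally show ?thesis by (simp only: C)
  qed
qed

end

section \<open>The algebra as a ring of invariant matrices\<close>

context words
begin

abbreviation schur_algebra :: "(schur_index \<Rightarrow> 'k::field) ring" where
  "schur_algebra \<equiv> right_schur_algebra r n"

definition mat :: "(schur_index \<Rightarrow> 'k::field) \<Rightarrow> (nat \<Rightarrow> nat) \<Rightarrow> (nat \<Rightarrow> nat) \<Rightarrow> 'k" where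
  "mat a i j = a (pair_index i j)"

text \<open>The inverse of \<open>mat\<close> on invariant matrices: the entry is read off at one
  chosen pair of each orbit.\<close>

definition of_mat :: "((nat \<Rightarrow> nat) \<Rightarrow> (nat \<Rightarrow> nat) \<Rightarrow> 'k::field) \<Rightarrow> schur_index \<Rightarrow> 'k" where
  "of_mat F z = (if z \<in> schur_indices r n
     then case_prod F (SOME p. p \<in> W \<times> W \<and> case_prod pair_index p = z) else 0)"

definition invariant :: "((nat \<Rightarrow> nat) \<Rightarrow> (nat \<Rightarrow> nat) \<Rightarrow> 'k::field) \<Rightarrow> bool" where
  "invariant F \<longleftrightarrow> (\<forall>i\<in>W. \<forall>j\<in>W. \<forall>\<sigma>. \<sigma> permutes {1..r} \<longrightarrow> F (i \<circ> \<sigma>) (j \<circ> \<sigma>) = F i j)"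

lemma pair_index_eqD:
  "\<lbrakk>u \<in> W; v \<in> W; pair_index i j = pair_index u v\<rbrakk> \<Longrightarrow> same_orbit (u, v) (i, j)"
  using pair_index_eq_iff[of u v i j] by simp

lemma invariant_same_orbit:
  assumes "invariant F" "i \<in> W" "j \<in> W" "same_orbit (i, j) (u, v)"
  shows "F u v = F i j"
  using assms by (auto simp: invariant_def same_orbit_def)

lemma mat_invariant: "\<sigma> permutes {1..r} \<Longrightarrow> mat a (i \<circ> \<sigma>) (j \<circ> \<sigma>) = mat a i j"
  unfolding mat_def using pair_index_cong[OF same_orbit_compose] by metis

lemma mat_same_orbit: "same_orbit (i, j) (u, v) \<Longrightarrow> mat a u v = mat a i j"
  unfolding mat_def using pair_index_cong by metis

lemma of_mat_closed: "of_mat F \<in> carrier schur_algebra"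
  by (simp add: of_mat_def right_schur_algebra_def)

lemma mat_of_mat:
  assumes F: "invariant F" and i: "i \<in> W" and j: "j \<in> W"
  shows "mat (of_mat F) i j = F i j"
proof -
  let ?P = "\<lambda>p. p \<in> W \<times> W \<and> case_prod pair_index p = pair_index i j"
  have "?P (SOME p. ?P p)" by (rule someI[of ?P "(i, j)"]) (simp add: i j)
  moreover obtain u v where uv: "(SOME p. ?P p) = (u, v)" by (cases "SOME p. ?P p")
  ultimately have "same_orbit (i, j) (u, v)"
    using pair_index_eqD[OF i j] by auto
  then have "F u v = F i j" using invariant_same_orbit[OF F i j] by blast
  then show ?thesis using pair_index_in[OF i j] by (simp add: mat_def of_mat_def uv)
qed

lemma finite_schur_indices: "finite (schur_indices r n)"
proof (rule finite_subset)
  show "schur_indices r n \<subseteq> case_prod pair_index ` (W \<times> W)"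
  proof
    fix z assume "z \<in> schur_indices r n"
    then obtain u v where "u \<in> W" "v \<in> W" "z = pair_index u v" by (rule schur_index_pair)
    then show "z \<in> case_prod pair_index ` (W \<times> W)" by (intro image_eqI[of _ _ "(u, v)"]) auto
  qed
qed (simp add: finite_W)

lemma schur_algebra_eqI:
  assumes "a \<in> carrier schur_algebra" "b \<in> carrier schur_algebra"
    and "\<And>i j. \<lbrakk>i \<in> W; j \<in> W\<rbrakk> \<Longrightarrow> mat a i j = mat b i j"
  shows "a = b"
proof
  fix z show "a z = b z"
  proof (cases "z \<in> schur_indices r n")
    case True
    then obtain i j where "i \<in> W" "j \<in> W" "z = pair_index i j" by (rule schur_index_pair)
    with assms(3)[of i j] show ?thesis by (simp add: mat_def)
  next
    case False with assms(1,2) show ?thesis by (cases z) (simp add: right_schur_algebra_def)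
  qed
qed

lemma mat_add [simp]: "mat (a \<oplus>\<^bsub>schur_algebra\<^esub> b) i j = mat a i j + mat b i j"
  by (simp add: mat_def right_schur_algebra_def)

lemma mat_zero [simp]: "mat \<zero>\<^bsub>schur_algebra\<^esub> i j = 0"
  by (simp add: mat_def right_schur_algebra_def)

text \<open>An intermediate word \<open>m\<close> is counted by exactly one pair of basis indices,
  those of \<open>(i, m)\<close> and \<open>(m, j)\<close>, so summing the counts over all indices
  leaves a sum over words.\<close>

lemma mat_mult:
  assumes i: "i \<in> W" and j: "j \<in> W"
  shows "mat (a \<otimes>\<^bsub>schur_algebra\<^esub> b) i j = (\<Sum>m\<in>W. mat a i m * mat b m j)"
proof -
  let ?I = "schur_indices r n"
  have "mat (a \<otimes>\<^bsub>schur_algebra\<^esub> b) i j =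
    (\<Sum>x\<in>?I. \<Sum>y\<in>?I. a x * b y * of_nat (schur_coeff r x y (pair_index i j)))"
    using pair_index_in[OF i j] by (simp add: mat_def right_schur_algebra_def)
  also have "\<dots> = (\<Sum>x\<in>?I. \<Sum>y\<in>?I. \<Sum>m\<in>W.
      if pair_index i m = x then if pair_index m j = y then a x * b y else 0 else 0)"
  proof (intro sum.cong refl)
    fix x y assume x: "x \<in> ?I" and y: "y \<in> ?I"
    have "a x * b y * of_nat (card {m \<in> W. pair_index i m = x \<and> pair_index m j = y}) =
      (\<Sum>m\<in>W. if pair_index i m = x \<and> pair_index m j = y then a x * b y else 0)"
      by (simp add: sum.If_cases[OF finite_W] Int_def)
    also have "\<dots> = (\<Sum>m\<in>W. if pair_index i m = x then if pair_index m j = y then a x * b y else 0 else 0)"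
      by (intro sum.cong) auto
    finally show "a x * b y * of_nat (schur_coeff r x y (pair_index i j)) =
      (\<Sum>m\<in>W. if pair_index i m = x then if pair_index m j = y then a x * b y else 0 else 0)"
      by (simp only: schur_coeff_eq_card[OF x y i j])
  qed
  also have "\<dots> = (\<Sum>x\<in>?I. \<Sum>m\<in>W. \<Sum>y\<in>?I.
      if pair_index i m = x then if pair_index m j = y then a x * b y else 0 else 0)"
    by (intro sum.cong refl sum.swap)
  also have "\<dots> = (\<Sum>m\<in>W. \<Sum>x\<in>?I. \<Sum>y\<in>?I.
      if pair_index i m = x then if pair_index m j = y then a x * b y else 0 else 0)"
    by (rule sum.swap)
  also have "\<dots> = (\<Sum>m\<in>W. mat a i m * mat b m j)"
  proof (intro sum.cong refl)
    fix m assume m: "m \<in> W"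
    have "(\<Sum>x\<in>?I. \<Sum>y\<in>?I. if pair_index i m = x then if pair_index m j = y then a x * b y else 0 else 0) =
      (\<Sum>x\<in>?I. if pair_index i m = x then (\<Sum>y\<in>?I. if pair_index m j = y then a x * b y else 0) else 0)"
      by (intro sum.cong) auto
    then show "(\<Sum>x\<in>?I. \<Sum>y\<in>?I. if pair_index i m = x then if pair_index m j = y then a x * b y else 0 else 0) =
      mat a i m * mat b m j"
      using pair_index_in[OF i m] pair_index_in[OF m j] by (simp add: finite_schur_indices mat_def)
  qed
  finally show ?thesis .
qed

text \<open>The double coset of \<open>id\<close> is an orbit of diagonal pairs, and a place
  permutation acts on both words at once, so no other pair has that index.\<close>

lemma mat_one:
  assumes i: "i \<in> W" and j: "j \<in> W"
  shows "mat \<one>\<^bsub>schur_algebra\<^esub> i j = (if i = j then 1 else 0)"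
proof -
  define lam where "lam = weight i"
  have lam: "lam \<in> compositions r n" unfolding lam_def using i by (rule weight_in_compositions)
  have unit: "pair_index (canonical lam) (canonical lam) = (lam, double_coset r lam id lam, lam)"
    using pair_index_canonical[OF lam lam permutes_id] by simp
  have "mat \<one>\<^bsub>schur_algebra\<^esub> i j =
    (if pair_index i j = (lam, double_coset r lam id lam, lam) then 1 else 0)"
  proof -
    obtain D where "pair_index i j = (lam, D, weight j)" by (simp add: pair_index_def lam_def)
    then show ?thesis using lam by (simp add: mat_def right_schur_algebra_def conj_commute)
  qed
  moreover have "pair_index i j = (lam, double_coset r lam id lam, lam) \<longleftrightarrow> i = j"
  proof
    assume "pair_index i j = (lam, double_coset r lam id lam, lam)"
    then have "same_orbit (canonical lam, canonical lam) (i, j)"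
      using pair_index_eqD[OF canonical_in_W[OF lam] canonical_in_W[OF lam]] unit by simp
    then show "i = j" by (auto simp: same_orbit_def)
  next
    assume ij: "i = j"
    obtain \<sigma> where "\<sigma> permutes {1..r}" "i = canonical lam \<circ> \<sigma>"
      using weight_eqD[OF i canonical_in_W[OF lam]] weight_canonical[OF lam] lam_def by metis
    then show "pair_index i j = (lam, double_coset r lam id lam, lam)"
      unfolding unit[symmetric] ij[symmetric] using pair_index_cong[OF same_orbit_compose] by metis
  qed
  ultimately show ?thesis by simp
qed

lemma schur_algebra_closed:
  "a \<in> carrier schur_algebra \<Longrightarrow> b \<in> carrier schur_algebra \<Longrightarrow> a \<oplus>\<^bsub>schur_algebra\<^esub> b \<in> carrier schur_algebra"
  "a \<otimes>\<^bsub>schur_algebra\<^esub> b \<in> carrier schur_algebra"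
  "\<zero>\<^bsub>schur_algebra\<^esub> \<in> carrier schur_algebra"
  by (auto simp: right_schur_algebra_def)

lemma schur_algebra_one_closed: "\<one>\<^bsub>schur_algebra\<^esub> \<in> carrier schur_algebra"
proof -
  have "(lam, double_coset r lam id lam, lam) \<in> schur_indices r n" if "lam \<in> compositions r n" for lam
    using that permutes_id by (auto simp: schur_indices_def double_cosets_def)
  then show ?thesis by (auto simp: right_schur_algebra_def)
qed

lemma ring_schur_algebra: "ring (schur_algebra :: (schur_index \<Rightarrow> 'k::field) ring)"
proof (rule ringI)
  let ?R = "schur_algebra :: (schur_index \<Rightarrow> 'k) ring"
  show "abelian_group ?R"
  proof (rule abelian_groupI)
    show "\<exists>y\<in>carrier ?R. y \<oplus>\<^bsub>?R\<^esub> x = \<zero>\<^bsub>?R\<^esub>" if "x \<in> carrier ?R" for x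
      using that by (intro bexI[of _ "\<lambda>z. - x z"]) (auto simp: right_schur_algebra_def)
  qed (auto simp: right_schur_algebra_def)
  show "Group.monoid ?R"
  proof (rule monoidI)
    fix x y z assume "x \<in> carrier ?R" "y \<in> carrier ?R" "z \<in> carrier ?R"
    show "x \<otimes>\<^bsub>?R\<^esub> y \<otimes>\<^bsub>?R\<^esub> z = x \<otimes>\<^bsub>?R\<^esub> (y \<otimes>\<^bsub>?R\<^esub> z)"
    proof (rule schur_algebra_eqI)
      fix i j assume ij: "i \<in> W" "j \<in> W"
      have "mat (x \<otimes>\<^bsub>?R\<^esub> y \<otimes>\<^bsub>?R\<^esub> z) i j = (\<Sum>m\<in>W. \<Sum>l\<in>W. mat x i l * mat y l m * mat z m j)"
        using ij by (simp add: mat_mult sum_distrib_right)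
      also have "\<dots> = (\<Sum>l\<in>W. \<Sum>m\<in>W. mat x i l * mat y l m * mat z m j)" by (rule sum.swap)
      also have "\<dots> = mat (x \<otimes>\<^bsub>?R\<^esub> (y \<otimes>\<^bsub>?R\<^esub> z)) i j"
        using ij by (simp add: mat_mult sum_distrib_left mult.assoc)
      finally show "mat (x \<otimes>\<^bsub>?R\<^esub> y \<otimes>\<^bsub>?R\<^esub> z) i j = mat (x \<otimes>\<^bsub>?R\<^esub> (y \<otimes>\<^bsub>?R\<^esub> z)) i j" .
    qed (rule schur_algebra_closed)+
  next
    fix x assume "x \<in> carrier ?R"
    then show "\<one>\<^bsub>?R\<^esub> \<otimes>\<^bsub>?R\<^esub> x = x" "x \<otimes>\<^bsub>?R\<^esub> \<one>\<^bsub>?R\<^esub> = x"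
      by (auto intro!: schur_algebra_eqI schur_algebra_closed
        simp: mat_mult mat_one if_distrib[of "\<lambda>a. a * _"] if_distrib[of "\<lambda>a. _ * a"] finite_W cong: if_cong)
  qed (rule schur_algebra_closed schur_algebra_one_closed)+
  fix x y z assume xyz: "x \<in> carrier ?R" "y \<in> carrier ?R" "z \<in> carrier ?R"
  then show "(x \<oplus>\<^bsub>?R\<^esub> y) \<otimes>\<^bsub>?R\<^esub> z = x \<otimes>\<^bsub>?R\<^esub> z \<oplus>\<^bsub>?R\<^esub> y \<otimes>\<^bsub>?R\<^esub> z"
    "z \<otimes>\<^bsub>?R\<^esub> (x \<oplus>\<^bsub>?R\<^esub> y) = z \<otimes>\<^bsub>?R\<^esub> x \<oplus>\<^bsub>?R\<^esub> z \<otimes>\<^bsub>?R\<^esub> y"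
    by (auto intro!: schur_algebra_eqI schur_algebra_closed
      simp: mat_mult distrib_left distrib_right sum.distrib)
qed

end

sublocale words \<subseteq> schur: ring "right_schur_algebra r n :: (schur_index \<Rightarrow> 'k::field) ring"
  by (rule ring_schur_algebra)

context words
begin

lemma mat_minus [simp]:
  assumes "a \<in> carrier schur_algebra"
  shows "mat (\<ominus>\<^bsub>schur_algebra\<^esub> a) i j = - mat a i j"
proof -
  have "mat (\<ominus>\<^bsub>schur_algebra\<^esub> a) i j + mat a i j = mat (\<ominus>\<^bsub>schur_algebra\<^esub> a \<oplus>\<^bsub>schur_algebra\<^esub> a) i j" by simp
  also have "\<dots> = 0" unfolding schur.l_neg[OF assms] by simp
  finally show ?thesis by (simp add: eq_neg_iff_add_eq_0)
qed

lemma mat_diff [simp]: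
  "b \<in> carrier schur_algebra \<Longrightarrow> mat (a \<ominus>\<^bsub>schur_algebra\<^esub> b) i j = mat a i j - mat b i j"
  by (simp add: schur.minus_eq)

section \<open>Weight idempotents, scalars and orbit matrices\<close>

definition weight_idem :: "nat list \<Rightarrow> schur_index \<Rightarrow> 'k::field" where
  "weight_idem l = of_mat (\<lambda>i j. if i = j \<and> weight i = l then 1 else 0)"

definition scalar :: "'k::field \<Rightarrow> schur_index \<Rightarrow> 'k" where
  "scalar c = of_mat (\<lambda>i j. if i = j then c else 0)"

definition orbit_elt :: "(nat \<Rightarrow> nat) \<Rightarrow> (nat \<Rightarrow> nat) \<Rightarrow> schur_index \<Rightarrow> 'k::field" where
  "orbit_elt u v = of_mat (\<lambda>i j. if same_orbit (u, v) (i, j) then 1 else 0)"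

lemma word_compose_inj: "\<sigma> permutes {1..r} \<Longrightarrow> i \<circ> \<sigma> = j \<circ> \<sigma> \<longleftrightarrow> i = j"
  using comp_perm_inv by metis

lemma weight_idem_closed [simp]: "weight_idem l \<in> carrier schur_algebra"
  by (simp add: weight_idem_def of_mat_closed)

lemma scalar_closed [simp]: "scalar c \<in> carrier schur_algebra"
  by (simp add: scalar_def of_mat_closed)

lemma orbit_elt_closed [simp]: "orbit_elt u v \<in> carrier schur_algebra"
  by (simp add: orbit_elt_def of_mat_closed)

lemma mat_weight_idem: "\<lbrakk>i \<in> W; j \<in> W\<rbrakk> \<Longrightarrow> mat (weight_idem l) i j = (if i = j \<and> weight i = l then 1 else 0)"
  unfolding weight_idem_def
  by (rule mat_of_mat) (auto simp: invariant_def word_compose_inj weight_compose)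

lemma mat_scalar: "\<lbrakk>i \<in> W; j \<in> W\<rbrakk> \<Longrightarrow> mat (scalar c) i j = (if i = j then c else 0)"
  unfolding scalar_def by (rule mat_of_mat) (auto simp: invariant_def word_compose_inj)

lemma mat_orbit_elt:
  "\<lbrakk>i \<in> W; j \<in> W\<rbrakk> \<Longrightarrow> mat (orbit_elt u v) i j = (if same_orbit (u, v) (i, j) then 1 else 0)"
  unfolding orbit_elt_def
proof (rule mat_of_mat)
  have "same_orbit p (i \<circ> \<sigma>, j \<circ> \<sigma>) \<longleftrightarrow> same_orbit p (i, j)" if "\<sigma> permutes {1..r}" for p i j \<sigma>
    using same_orbit_compose[OF that] same_orbit_trans same_orbit_sym by blast
  then show "invariant (\<lambda>i j. if same_orbit (u, v) (i, j) then 1 else 0)" by (simp add: invariant_def)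
qed

lemma mat_weight_idem_mult:
  assumes "i \<in> W" "j \<in> W"
  shows "mat (weight_idem l \<otimes>\<^bsub>schur_algebra\<^esub> a) i j = (if weight i = l then mat a i j else 0)"
proof -
  have "mat (weight_idem l \<otimes>\<^bsub>schur_algebra\<^esub> a) i j =
    (\<Sum>m\<in>W. if i = m then if weight i = l then mat a m j else 0 else 0)"
    unfolding mat_mult[OF assms] by (intro sum.cong refl) (auto simp: mat_weight_idem assms)
  then show ?thesis using assms by (simp add: finite_W)
qed

lemma mat_mult_weight_idem:
  assumes "i \<in> W" "j \<in> W"
  shows "mat (a \<otimes>\<^bsub>schur_algebra\<^esub> weight_idem l) i j = (if weight j = l then mat a i j else 0)"
proof -
  have "mat (a \<otimes>\<^bsub>schur_algebra\<^esub> weight_idem l) i j =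
    (\<Sum>m\<in>W. if j = m then if weight j = l then mat a i m else 0 else 0)"
    unfolding mat_mult[OF assms] by (intro sum.cong refl) (auto simp: mat_weight_idem assms)
  then show ?thesis using assms by (simp add: finite_W)
qed

lemma mat_scalar_mult:
  assumes "i \<in> W" "j \<in> W"
  shows "mat (scalar c \<otimes>\<^bsub>schur_algebra\<^esub> a) i j = c * mat a i j"
proof -
  have "mat (scalar c \<otimes>\<^bsub>schur_algebra\<^esub> a) i j = (\<Sum>m\<in>W. if i = m then c * mat a m j else 0)"
    unfolding mat_mult[OF assms] by (intro sum.cong refl) (auto simp: mat_scalar assms)
  then show ?thesis using assms by (simp add: finite_W)
qed

lemma compositions_eq: "compositions r n = weight ` W"
  using weight_in_compositions weight_canonical canonical_in_W by (force simp: image_iff)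

lemma finite_compositions: "finite (compositions r n)"
  by (simp add: compositions_eq finite_W)

text \<open>The identity is the sum of all weight idempotents; \<open>d S\<close> is the partial sum
  over the weights in \<open>S\<close>.\<close>

lemma one_in_weight_ideal:
  assumes I: "ideal I schur_algebra" and e: "\<And>l. l \<in> compositions r n \<Longrightarrow> weight_idem l \<in> I"
  shows "\<one>\<^bsub>schur_algebra\<^esub> \<in> I"
proof -
  interpret I: ideal I schur_algebra by (rule I)
  define d where "d S = of_mat (\<lambda>i j. if i = j \<and> weight i \<in> S then 1 else (0::'a))" for S
  have md: "mat (d S) i j = (if i = j \<and> weight i \<in> S then 1 else 0)" if "i \<in> W" "j \<in> W" for S i j
    unfolding d_def using that
    by (intro mat_of_mat) (auto simp: invariant_def word_compose_inj weight_compose)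
  have dc: "d S \<in> carrier schur_algebra" for S by (simp add: d_def of_mat_closed)
  have "d S \<in> I" if "finite S" "S \<subseteq> compositions r n" for S
    using that
  proof (induction S)
    case empty
    have "d {} = \<zero>\<^bsub>schur_algebra\<^esub>" by (rule schur_algebra_eqI) (auto simp: md dc)
    then show ?case by simp
  next
    case (insert l S)
    have "d (insert l S) = weight_idem l \<oplus>\<^bsub>schur_algebra\<^esub> d S"
      using insert by (intro schur_algebra_eqI) (auto simp: md dc mat_weight_idem)
    then show ?case using insert e by simp
  qed
  moreover have "d (compositions r n) = \<one>\<^bsub>schur_algebra\<^esub>"
    by (rule schur_algebra_eqI) (auto simp: md dc mat_one weight_in_compositions)
  ultimately show ?thesis using finite_compositions by force
qed

end

section \<open>Triangularity\<close>

text \<open>At the first place where the lists differ, their prefix sums differ in the same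
  direction: the lexicographic order extends dominance.\<close>

lemma prefix_dominance_le:
  fixes xs ys :: "nat list"
  assumes "length xs = length ys"
    and "\<And>t. t \<le> length xs \<Longrightarrow> sum_list (take t xs) \<le> sum_list (take t ys)"
  shows "xs \<le> ys"
  using assms
proof (induction xs ys rule: list_induct2)
  case (Cons x xs y ys)
  have "x \<le> y" using Cons.prems[of 1] by simp
  moreover have "xs \<le> ys" if "x = y"
  proof (rule Cons.IH)
    fix t assume "t \<le> length xs"
    then show "sum_list (take t xs) \<le> sum_list (take t ys)"
      using Cons.prems[of "Suc t"] that by simp
  qed
  ultimately show ?case by auto
qed simp

context words
begin

definition overlap :: "(nat \<Rightarrow> nat) \<Rightarrow> (nat \<Rightarrow> nat) \<Rightarrow> nat" where
  "overlap u v = (\<Sum>k\<in>{1..r}. min (u k) (v k))"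

definition word_min :: "(nat \<Rightarrow> nat) \<Rightarrow> (nat \<Rightarrow> nat) \<Rightarrow> nat \<Rightarrow> nat" where
  "word_min u v = (\<lambda>k\<in>{1..r}. min (u k) (v k))"

lemma word_min_in_W: "\<lbrakk>u \<in> W; v \<in> W\<rbrakk> \<Longrightarrow> word_min u v \<in> W"
  by (auto simp: W_def word_min_def PiE_iff min_less_iff_disj)

lemma sum_compose: "\<sigma> permutes {1..r} \<Longrightarrow> (\<Sum>k\<in>{1..r}. f (\<sigma> k)) = (\<Sum>k\<in>{1..r}. f k)"
  for f :: "nat \<Rightarrow> nat"
  using sum.permute[of \<sigma> "{1..r}" f] by (simp add: comp_def)

lemma word_le_eqI:
  assumes u: "u \<in> W" and v: "v \<in> W"
    and le: "\<And>k. k \<in> {1..r} \<Longrightarrow> u k \<le> v k" and sum: "(\<Sum>k\<in>{1..r}. v k) \<le> (\<Sum>k\<in>{1..r}. u k)"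
  shows "u = v"
proof (rule word_eqI[OF u v], rule ccontr)
  fix k assume "k \<in> {1..r}" "u k \<noteq> v k"
  then have "(\<Sum>k\<in>{1..r}. u k) < (\<Sum>k\<in>{1..r}. v k)"
    using le by (intro sum_strict_mono_ex1) force+
  with sum show False by simp
qed

lemma sum_word_eq:
  assumes "u \<in> W" "v \<in> W" "weight u = weight v"
  shows "(\<Sum>k\<in>{1..r}. u k) = (\<Sum>k\<in>{1..r}. v k)"
proof -
  obtain \<sigma> where \<sigma>: "\<sigma> permutes {1..r}" "u = v \<circ> \<sigma>" using weight_eqD[OF assms] .
  then show ?thesis using sum_compose[OF \<sigma>(1), of v] by simp
qed

text \<open>Lowering letters can only enlarge the prefix sums of the weight. If the weight stayed
  the same, the letter sums would agree, so the minimum would be \<open>u\<close>; then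
  \<open>u\<close> lies below \<open>v\<close>, and equal letter sums once more give
  \<open>u = v\<close>.\<close>

lemma weight_word_min_greater:
  assumes u: "u \<in> W" and v: "v \<in> W" and wt: "weight u = weight v" and ne: "u \<noteq> v"
  shows "weight u < weight (word_min u v)"
proof -
  let ?m = "word_min u v"
  have m: "?m \<in> W" using u v by (rule word_min_in_W)
  have "weight u \<le> weight ?m"
  proof (rule prefix_dominance_le)
    fix t assume "t \<le> length (weight u)"
    then have t: "t \<le> n" by simp
    have "card {k \<in> {1..r}. u k < t} \<le> card {k \<in> {1..r}. ?m k < t}"
      by (rule card_mono) (auto simp: word_min_def)
    then show "sum_list (take t (weight u)) \<le> sum_list (take t (weight ?m))"
      by (simp only: sum_take_weight[OF u t] sum_take_weight[OF m t])
  qed simp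
  moreover have "weight u \<noteq> weight ?m"
  proof
    assume "weight u = weight ?m"
    then have mu: "?m = u"
      by (intro word_le_eqI[OF m u _ eq_refl[OF sum_word_eq[OF u m]]]) (simp_all add: word_min_def)
    have "u k \<le> v k" if k: "k \<in> {1..r}" for k
    proof -
      have "min (u k) (v k) = u k" using fun_cong[OF mu, of k] k by (simp only: word_min_def restrict_apply')
      then show ?thesis by (simp add: min_def split: if_splits)
    qed
    then have "u = v" by (rule word_le_eqI[OF u v _ eq_refl[OF sum_word_eq[OF v u wt[symmetric]]]])
    with ne show False by simp
  qed
  ultimately show ?thesis by simp
qed

text \<open>The numbers of places with letters \<open>(s, t)\<close> form the nonnegative integer
  matrix that classifies double cosets of Young subgroups.\<close>

lemma same_orbitI_pair_fibres:
  assumes uv: "u \<in> W" "v \<in> W" and ij: "i \<in> W" "j \<in> W"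
    and fib: "\<And>s t. card {k \<in> {1..r}. i k = s \<and> j k = t} = card {k \<in> {1..r}. u k = s \<and> v k = t}"
  shows "same_orbit (u, v) (i, j)"
proof -
  have "card {k \<in> {1..r}. (i k, j k) = p} = card {k \<in> {1..r}. (u k, v k) = p}" for p
    using fib by (cases p) simp
  from exists_permutation_of_fibres[OF finite_atLeastAtMost this]
  obtain \<sigma> where \<sigma>: "\<sigma> permutes {1..r}" and eq: "\<And>k. k \<in> {1..r} \<Longrightarrow> (i k, j k) = (u (\<sigma> k), v (\<sigma> k))"
    by blast
  have "i = u \<circ> \<sigma>" "j = v \<circ> \<sigma>"
    using eq uv ij \<sigma> by (auto intro!: word_eqI word_compose)
  with \<sigma> show ?thesis by (auto simp: same_orbit_def)
qed

lemma same_orbit_weight: "same_orbit (u, v) (i, j) \<Longrightarrow> weight i = weight u \<and> weight j = weight v"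
  using weight_compose by (auto simp: same_orbit_def)

lemma card_pair_fibre:
  assumes "same_orbit (u, v) (i, j)"
  shows "card {k \<in> {1..r}. P (i k) (j k)} = card {k \<in> {1..r}. P (u k) (v k)}"
proof -
  obtain \<sigma> where "\<sigma> permutes {1..r}" "i = u \<circ> \<sigma>" "j = v \<circ> \<sigma>"
    using assms by (auto simp: same_orbit_def)
  then show ?thesis using card_permuted_fibre[of \<sigma> "{1..r}" "\<lambda>k. P (u k) (v k)"] by simp
qed

text \<open>The orbits of \<open>(u, min u v)\<close> and \<open>(min u v, v)\<close> determine the right-hand side, hence the orbit
  of \<open>(u, v)\<close>.\<close>

lemma card_pair_fibre_min:
  fixes u v :: "nat \<Rightarrow> nat"
  shows "card {k \<in> {1..r}. u k = s \<and> v k = t} =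
    (if t < s then card {k \<in> {1..r}. u k = s \<and> min (u k) (v k) = t}
     else if s < t then card {k \<in> {1..r}. min (u k) (v k) = s \<and> v k = t}
     else card {k \<in> {1..r}. min (u k) (v k) = s} - card {k \<in> {1..r}. s < u k \<and> min (u k) (v k) = s}
       - card {k \<in> {1..r}. min (u k) (v k) = s \<and> s < v k})"
proof -
  consider "t < s" | "s < t" | "s = t" by linarith
  then show ?thesis
  proof cases
    case 1
    then have "u k = s \<and> v k = t \<longleftrightarrow> u k = s \<and> min (u k) (v k) = t" for k by auto
    with 1 show ?thesis by simp
  next
    case 2
    then have "u k = s \<and> v k = t \<longleftrightarrow> min (u k) (v k) = s \<and> v k = t" for k by auto
    with 2 show ?thesis by simp
  next
    case 3
    let ?A = "{k \<in> {1..r}. u k = s \<and> v k = t}"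
    let ?B = "{k \<in> {1..r}. s < u k \<and> min (u k) (v k) = s}"
    let ?C = "{k \<in> {1..r}. min (u k) (v k) = s \<and> s < v k}"
    have "{k \<in> {1..r}. min (u k) (v k) = s} = ?A \<union> ?B \<union> ?C" using 3 by auto
    moreover have "card (?A \<union> ?B \<union> ?C) = card ?A + card ?B + card ?C"
      using 3 by (subst card_Un_disjoint; (subst card_Un_disjoint)?) auto
    ultimately show ?thesis using 3 by simp
  qed
qed

text \<open>\<open>z\<close> rearranges the minimum of \<open>u\<close> and \<open>v\<close>, so its
  letter sum is \<open>overlap u v\<close>. It lies below \<open>i\<close> by the first orbit
  relation and below \<open>j\<close> by the second, hence below their minimum. Equal sums force
  equality, and then the orbits of \<open>(i, z)\<close> and \<open>(z, j)\<close> determine that of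
  \<open>(i, j)\<close>.\<close>

lemma overlap_le_intermediate:
  assumes u: "u \<in> W" and v: "v \<in> W" and i: "i \<in> W" and j: "j \<in> W"
    and iz: "same_orbit (u, word_min u v) (i, z)" and zj: "same_orbit (word_min u v, v) (z, j)"
  shows "overlap u v \<le> overlap i j"
    and "overlap i j \<le> overlap u v \<Longrightarrow> z = word_min i j \<and> same_orbit (u, v) (i, j)"
proof -
  let ?m = "word_min u v"
  obtain \<sigma> where \<sigma>: "\<sigma> permutes {1..r}" "i = u \<circ> \<sigma>" "z = ?m \<circ> \<sigma>"
    using iz by (auto simp: same_orbit_def)
  obtain \<tau> where \<tau>: "\<tau> permutes {1..r}" "z = ?m \<circ> \<tau>" "j = v \<circ> \<tau>"
    using zj by (auto simp: same_orbit_def)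
  have z: "z \<in> W" using \<sigma> word_min_in_W[OF u v] word_compose by blast
  have "z k \<le> i k" if "k \<in> {1..r}" for k
    using that \<sigma> permutes_in_image[OF \<sigma>(1)] by (simp add: word_min_def)
  moreover have "z k \<le> j k" if "k \<in> {1..r}" for k
    using that \<tau> permutes_in_image[OF \<tau>(1)] by (simp add: word_min_def)
  ultimately have le: "z k \<le> word_min i j k" if "k \<in> {1..r}" for k
    using that by (simp add: word_min_def)
  have "(\<Sum>k\<in>{1..r}. z k) = (\<Sum>k\<in>{1..r}. ?m k)"
    using sum_compose[OF \<sigma>(1), of ?m] by (simp add: \<sigma>(3))
  then have sz: "(\<Sum>k\<in>{1..r}. z k) = overlap u v" by (simp add: overlap_def word_min_def)
  have sm: "(\<Sum>k\<in>{1..r}. word_min i j k) = overlap i j" by (simp add: overlap_def word_min_def)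
  show "overlap u v \<le> overlap i j"
    unfolding sz[symmetric] sm[symmetric] using le by (rule sum_mono)
  assume "overlap i j \<le> overlap u v"
  then have zm: "z = word_min i j"
    using le sz sm by (intro word_le_eqI z word_min_in_W i j) auto
  have min: "z k = min (i k) (j k)" "?m k = min (u k) (v k)" if "k \<in> {1..r}" for k
    using that by (simp_all add: zm word_min_def)
  have card_cong: "card {k \<in> {1..r}. P k} = card {k \<in> {1..r}. Q k}"
    if "\<And>k. k \<in> {1..r} \<Longrightarrow> P k = Q k" for P Q
    using that by (intro arg_cong[where f = card] Collect_cong conj_cong refl)
  \<comment> \<open>Every count on the right of \<open>card_pair_fibre_min\<close> involves the
    minimum and at most one of the words. Counts with the first word transfer along
    \<open>iz\<close>, those with the second along \<open>zj\<close>.\<close>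
  have f1: "card {k \<in> {1..r}. P (i k) (min (i k) (j k))} = card {k \<in> {1..r}. P (u k) (min (u k) (v k))}" for P
  proof -
    have f1: "card {k \<in> {1..r}. P (i k) (min (i k) (j k))} = card {k \<in> {1..r}. P (i k) (z k)}"
      by (rule card_cong) (simp only: min)
    also have "\<dots> = card {k \<in> {1..r}. P (u k) (?m k)}" by (rule card_pair_fibre[OF iz])
    also have "\<dots> = card {k \<in> {1..r}. P (u k) (min (u k) (v k))}" by (rule card_cong) (simp only: min)
    finally show ?thesis .
  qed
  have f2: "card {k \<in> {1..r}. P (min (i k) (j k)) (j k)} = card {k \<in> {1..r}. P (min (u k) (v k)) (v k)}" for P
  proof -
    have "card {k \<in> {1..r}. P (min (i k) (j k)) (j k)} = card {k \<in> {1..r}. P (z k) (j k)}"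
      by (rule card_cong) (simp only: min)
    also have "\<dots> = card {k \<in> {1..r}. P (?m k) (v k)}" by (rule card_pair_fibre[OF zj])
    also have "\<dots> = card {k \<in> {1..r}. P (min (u k) (v k)) (v k)}" by (rule card_cong) (simp only: min)
    finally show ?thesis .
  qed
  have "same_orbit (u, v) (i, j)"
  proof (rule same_orbitI_pair_fibres[OF u v i j])
    fix s t
    show "card {k \<in> {1..r}. i k = s \<and> j k = t} = card {k \<in> {1..r}. u k = s \<and> v k = t}"
      unfolding card_pair_fibre_min[of i s j t] card_pair_fibre_min[of u s v t]
        f1[of "\<lambda>a b. a = s \<and> b = t"] f1[of "\<lambda>a b. b = s"] f1[of "\<lambda>a b. s < a \<and> b = s"]
        f2[of "\<lambda>a b. a = s \<and> b = t"] f2[of "\<lambda>a b. a = s \<and> s < b"] ..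
  qed
  with zm show "z = word_min i j \<and> same_orbit (u, v) (i, j)" by simp
qed

text \<open>Entries of \<open>b\<close> count intermediate words. On the orbit of
  \<open>(u, v)\<close> the minimum is the only one, so the leading coefficient is exactly 1 and
  survives in every characteristic.\<close>

lemma mat_orbit_elt_mult:
  assumes u: "u \<in> W" and v: "v \<in> W" and i: "i \<in> W" and j: "j \<in> W"
  defines "b \<equiv> orbit_elt u (word_min u v) \<otimes>\<^bsub>schur_algebra\<^esub> orbit_elt (word_min u v) v :: schur_index \<Rightarrow> 'k::field"
  shows "same_orbit (u, v) (i, j) \<Longrightarrow> mat b i j = 1"
    and "mat b i j \<noteq> 0 \<Longrightarrow> same_orbit (u, v) (i, j) \<or> overlap u v < overlap i j"
    and "mat b i j \<noteq> 0 \<Longrightarrow> weight i = weight u \<and> weight j = weight v"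
proof -
  let ?m = "word_min u v"
  have b: "mat b i j = (\<Sum>z\<in>W. if same_orbit (u, ?m) (i, z) \<and> same_orbit (?m, v) (z, j) then 1 else 0)"
    unfolding b_def mat_mult[OF i j] by (intro sum.cong refl) (simp add: mat_orbit_elt i j)
  {
    assume "mat b i j \<noteq> 0"
    have "\<exists>z. same_orbit (u, ?m) (i, z) \<and> same_orbit (?m, v) (z, j)"
    proof (rule ccontr)
      assume "\<not> ?thesis"
      then have none: "\<not> (same_orbit (u, ?m) (i, z) \<and> same_orbit (?m, v) (z, j))" for z by blast
      have "mat b i j = 0" unfolding b by (simp only: none if_False sum.neutral_const)
      with \<open>mat b i j \<noteq> 0\<close> show False by contradiction
    qed
    then obtain z where z: "same_orbit (u, ?m) (i, z)" "same_orbit (?m, v) (z, j)" by blast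
    from overlap_le_intermediate(2)[OF u v i j z]
    show "same_orbit (u, v) (i, j) \<or> overlap u v < overlap i j" by linarith
    show "weight i = weight u \<and> weight j = weight v"
      using same_orbit_weight[OF z(1)] same_orbit_weight[OF z(2)] by simp
  }
  assume so: "same_orbit (u, v) (i, j)"
  then obtain \<sigma> where \<sigma>: "\<sigma> permutes {1..r}" "i = u \<circ> \<sigma>" "j = v \<circ> \<sigma>"
    by (auto simp: same_orbit_def)
  have zW: "word_min i j \<in> W" using i j by (rule word_min_in_W)
  have "word_min i j = ?m \<circ> \<sigma>"
    using permutes_in_image[OF \<sigma>(1)]
    by (intro word_eqI word_compose[OF _ \<sigma>(1)] word_min_in_W u v i j) (simp add: word_min_def \<sigma>)
  then have so2: "same_orbit (u, ?m) (i, word_min i j)" "same_orbit (?m, v) (word_min i j, j)"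
    using same_orbit_compose[OF \<sigma>(1)] \<sigma> by auto
  have ov: "overlap i j = overlap u v"
    unfolding overlap_def using sum_compose[OF \<sigma>(1), of "\<lambda>k. min (u k) (v k)"] by (simp add: \<sigma>)
  have "mat b i j = (\<Sum>z\<in>W. if z = word_min i j then 1 else 0)"
    unfolding b
  proof (intro sum.cong refl)
    fix z assume "z \<in> W"
    have "same_orbit (u, ?m) (i, z) \<and> same_orbit (?m, v) (z, j) \<longleftrightarrow> z = word_min i j"
    proof
      assume "same_orbit (u, ?m) (i, z) \<and> same_orbit (?m, v) (z, j)"
      then show "z = word_min i j"
        using overlap_le_intermediate(2)[OF u v i j _ _ eq_refl[OF ov]] by auto
    next
      assume "z = word_min i j"
      with so2 show "same_orbit (u, ?m) (i, z) \<and> same_orbit (?m, v) (z, j)" by (simp only:)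
    qed
    then show "(if same_orbit (u, ?m) (i, z) \<and> same_orbit (?m, v) (z, j) then 1 else 0) =
      (if z = word_min i j then 1 else 0 :: 'k)" by simp
  qed
  then show "mat b i j = 1" using zW by (simp add: finite_W)
qed

text \<open>The product factors through the weight of \<open>m\<close>: the idempotent of that
  weight can be inserted between the factors.\<close>

lemma orbit_elt_mult_in_ideal:
  fixes I :: "(schur_index \<Rightarrow> 'k::field) set"
  assumes I: "ideal I schur_algebra" and m: "m \<in> W" "weight_idem (weight m) \<in> I"
    and u: "u \<in> W" and v: "v \<in> W"
  shows "orbit_elt u m \<otimes>\<^bsub>schur_algebra\<^esub> orbit_elt m v \<in> I"
proof -
  interpret I: ideal I schur_algebra by (rule I)
  have "orbit_elt u m \<otimes>\<^bsub>schur_algebra\<^esub> weight_idem (weight m) = (orbit_elt u m :: schur_index \<Rightarrow> 'k)"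
    by (rule schur_algebra_eqI)
      (auto simp: mat_mult_weight_idem mat_orbit_elt same_orbit_def weight_compose)
  then have "orbit_elt u m \<in> I" using I.I_l_closed[OF m(2) orbit_elt_closed[of u m]] by simp
  then show ?thesis by (simp add: I.I_r_closed)
qed

lemma diagonal_modulo_ideal:
  fixes a :: "schur_index \<Rightarrow> 'k::field"
  assumes I: "ideal I (schur_algebra :: (schur_index \<Rightarrow> 'k) ring)"
    and l: "l \<in> compositions r n"
    and above: "\<And>m. \<lbrakk>m \<in> compositions r n; l < m\<rbrakk> \<Longrightarrow> weight_idem m \<in> I"
    and a: "a \<in> carrier schur_algebra"
    and supp: "\<And>i j. \<lbrakk>i \<in> W; j \<in> W; mat a i j \<noteq> 0\<rbrakk> \<Longrightarrow> weight i = l \<and> weight j = l"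
  shows "\<exists>c. a \<ominus>\<^bsub>schur_algebra\<^esub> scalar c \<otimes>\<^bsub>schur_algebra\<^esub> weight_idem l \<in> I"
proof -
  interpret I: ideal I "schur_algebra :: (schur_index \<Rightarrow> 'k) ring" by (rule I)
  let ?R = "schur_algebra :: (schur_index \<Rightarrow> 'k) ring"
  define S where "S a = {p \<in> W \<times> W. fst p \<noteq> snd p \<and> mat a (fst p) (snd p) \<noteq> 0}" for a :: "schur_index \<Rightarrow> 'k"
  let ?o = "\<lambda>p. overlap (fst p) (snd p)"
  \<comment> \<open>The off-diagonal support closed upwards: subtracting a multiple of \<open>b\<close> below clears the orbit of a
    minimal element \<open>q\<close> and otherwise changes \<open>a\<close> only above it.\<close>
  define U where "U a = {p \<in> W \<times> W. \<exists>q\<in>S a. q = p \<or> ?o q < ?o p}" for a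
  have fin: "finite (U a)" for a by (rule finite_subset[of _ "W \<times> W"]) (auto simp: U_def finite_W)
  show ?thesis
    using a supp
  proof (induction "card (U a)" arbitrary: a rule: less_induct)
    case less
    show ?case
    proof (cases "S a = {}")
      case True
      \<comment> \<open>The words of weight \<open>l\<close> are the rearrangements of
        \<open>w\<close>, so invariance makes the diagonal constant on them.\<close>
      define w where "w = canonical l"
      have w: "w \<in> W" "weight w = l"
        using l by (simp_all add: w_def canonical_in_W weight_canonical)
      have "mat a i j = mat (scalar (mat a w w) \<otimes>\<^bsub>?R\<^esub> weight_idem l) i j" if ij: "i \<in> W" "j \<in> W" for i j
      proof (cases "i = j \<and> weight i = l")
        case True
        then obtain \<sigma> where "\<sigma> permutes {1..r}" "i = w \<circ> \<sigma>" using weight_eqD[OF ij(1) w(1)] w by metis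
        then have "mat a i i = mat a w w" by (simp add: mat_invariant)
        with True ij show ?thesis by (auto simp: mat_scalar_mult mat_weight_idem)
      next
        case False
        then have "mat a i j = 0" using \<open>S a = {}\<close> less.prems(2)[OF ij] ij by (auto simp: S_def)
        with False ij show ?thesis by (auto simp: mat_scalar_mult mat_weight_idem)
      qed
      then have "a = scalar (mat a w w) \<otimes>\<^bsub>?R\<^esub> weight_idem l"
        using less.prems(1) by (intro schur_algebra_eqI) auto
      then have "a \<ominus>\<^bsub>?R\<^esub> scalar (mat a w w) \<otimes>\<^bsub>?R\<^esub> weight_idem l = \<zero>\<^bsub>?R\<^esub>"
        using schur.r_neg[OF less.prems(1)] by (metis schur.minus_eq)
      then show ?thesis by (intro exI[of _ "mat a w w"]) (simp only: I.zero_closed)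
    next
      case False
      moreover have "finite (S a)" by (rule finite_subset[of _ "W \<times> W"]) (auto simp: S_def finite_W)
      ultimately obtain q where qS: "q \<in> S a" and qmin: "\<And>p. p \<in> S a \<Longrightarrow> ?o q \<le> ?o p"
        using arg_min_if_finite[of "S a" ?o] by (meson not_less)
      obtain u v where q: "q = (u, v)" by (cases q)
      have uv: "u \<in> W" "v \<in> W" "u \<noteq> v" "mat a u v \<noteq> 0" using qS by (auto simp: S_def q)
      have wt: "weight u = l" "weight v = l" using less.prems(2)[OF uv(1,2,4)] by auto
      define m where "m = word_min u v"
      have m: "m \<in> W" unfolding m_def using uv(1,2) by (rule word_min_in_W)
      have "l < weight m" using weight_word_min_greater[OF uv(1,2) _ uv(3)] wt by (simp add: m_def)
      then have mI: "weight_idem (weight m) \<in> I" using above weight_in_compositions[OF m] by blast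
      define b where "b = (orbit_elt u m \<otimes>\<^bsub>?R\<^esub> orbit_elt m v)"
      have bI: "b \<in> I" unfolding b_def by (rule orbit_elt_mult_in_ideal[OF I m mI uv(1,2)])
      note bm = mat_orbit_elt_mult[where 'k = 'k, OF uv(1,2), folded m_def, folded b_def]
      \<comment> \<open>The entry of \<open>b\<close> at \<open>(u, v)\<close> is 1, so this
        multiple clears the orbit of \<open>(u, v)\<close> from \<open>a\<close>.\<close>
      define t where "t = scalar (mat a u v) \<otimes>\<^bsub>?R\<^esub> b"
      have tI: "t \<in> I" unfolding t_def using bI by (simp add: I.I_l_closed)
      then have tc: "t \<in> carrier ?R" by (rule I.a_Hcarr)
      define a' where "a' = a \<ominus>\<^bsub>?R\<^esub> t"
      have a'c: "a' \<in> carrier ?R" using less.prems(1) tc by (simp add: a'_def)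
      have ma': "mat a' i j = mat a i j - mat a u v * mat b i j" if "i \<in> W" "j \<in> W" for i j
        using that tc by (simp add: a'_def t_def mat_scalar_mult)
      have orb0: "mat a' i j = 0" if "i \<in> W" "j \<in> W" "same_orbit (u, v) (i, j)" for i j
        using bm(1)[OF that] mat_same_orbit[OF that(3), of a] ma'[OF that(1,2)] by simp
      have step: "mat a i j \<noteq> 0 \<or> overlap u v < overlap i j"
        if "i \<in> W" "j \<in> W" "mat a' i j \<noteq> 0" for i j
        using orb0[OF that(1,2)] ma'[OF that(1,2)] bm(2)[OF that(1,2)] that(3) by auto
      have "U a' \<subseteq> U a"
      proof
        fix p assume "p \<in> U a'"
        then obtain x where x: "x \<in> S a'" "x = p \<or> ?o x < ?o p" and p: "p \<in> W \<times> W"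
          by (auto simp: U_def)
        have "x \<in> S a \<or> ?o q < ?o x"
          using x(1) step[of "fst x" "snd x"] by (auto simp: S_def q)
        then have "\<exists>y\<in>S a. y = p \<or> ?o y < ?o p"
        proof
          assume "x \<in> S a" with x(2) show ?thesis by blast
        next
          assume "?o q < ?o x"
          then have "?o q < ?o p" using x(2) by auto
          with qS show ?thesis by blast
        qed
        with p show "p \<in> U a" by (simp add: U_def)
      qed
      moreover have "q \<in> U a" using qS uv(1,2) unfolding U_def q by blast
      \<comment> \<open>An off-diagonal entry of \<open>a'\<close> that is \<open>q\<close> or has
        smaller overlap already occurs in \<open>a\<close>; minimality makes it \<open>q\<close>
        itself, which has been cleared.\<close>
      moreover have "q \<notin> U a'"
      proof
        assume "q \<in> U a'"
        then obtain x where x: "x \<in> S a'" "x = q \<or> ?o x < ?o q" by (auto simp: U_def)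
        then have "\<not> ?o q < ?o x" by auto
        then have "x \<in> S a" using x(1) step[of "fst x" "snd x"] by (auto simp: S_def q)
        then have "x = q" using qmin[of x] x(2) by simp
        then show False using x(1) orb0[OF uv(1,2) same_orbit_refl] by (simp add: S_def q)
      qed
      ultimately have "card (U a') < card (U a)" by (intro psubset_card_mono fin) auto
      moreover have "weight i = l \<and> weight j = l" if "i \<in> W" "j \<in> W" "mat a' i j \<noteq> 0" for i j
        using that(3) ma'[OF that(1,2)] less.prems(2)[OF that(1,2)] bm(3)[OF that(1,2)] wt
        by (cases "mat a i j = 0") auto
      ultimately obtain c where c: "a' \<ominus>\<^bsub>?R\<^esub> scalar c \<otimes>\<^bsub>?R\<^esub> weight_idem l \<in> I" (is "?d \<in> I")
        using less.hyps[OF _ a'c] by blast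
      have "a \<ominus>\<^bsub>?R\<^esub> scalar c \<otimes>\<^bsub>?R\<^esub> weight_idem l = ?d \<oplus>\<^bsub>?R\<^esub> t"
        using less.prems(1) a'c tc by (intro schur_algebra_eqI) (auto simp: a'_def)
      then show ?thesis using c tI by (metis I.a_closed)
    qed
  qed
qed

lemma weighted_ring_schur:
  "weighted_ring (schur_algebra :: (schur_index \<Rightarrow> 'k::field) ring) (range scalar) weight_idem (compositions r n)"
proof (intro weighted_ring.intro weighted_ring_axioms.intro)
  let ?R = "schur_algebra :: (schur_index \<Rightarrow> 'k) ring"
  show "ring ?R" by (rule ring_schur_algebra)
  show "finite (compositions r n)" by (rule finite_compositions)
  show "weight_idem l \<otimes>\<^bsub>?R\<^esub> weight_idem l = weight_idem l" for l
    by (rule schur_algebra_eqI) (auto simp: mat_weight_idem_mult mat_weight_idem)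
  show "\<exists>d\<in>range scalar. d \<otimes>\<^bsub>?R\<^esub> c = \<one>\<^bsub>?R\<^esub>" if c: "c \<in> range scalar" "c \<noteq> \<zero>\<^bsub>?R\<^esub>" for c
  proof -
    obtain x where x: "c = scalar x" using c(1) by auto
    have "x \<noteq> 0"
    proof
      assume "x = 0"
      then have "c = \<zero>\<^bsub>?R\<^esub>" by (intro schur_algebra_eqI) (auto simp: x mat_scalar)
      with c show False by simp
    qed
    then have "scalar (inverse x) \<otimes>\<^bsub>?R\<^esub> c = \<one>\<^bsub>?R\<^esub>"
      by (intro schur_algebra_eqI) (auto simp: x mat_scalar_mult mat_scalar mat_one)
    then show ?thesis by blast
  qed
  show "\<one>\<^bsub>?R\<^esub> \<in> Idl\<^bsub>?R\<^esub> (weight_idem ` compositions r n)"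
    by (rule one_in_weight_ideal[OF schur.genideal_ideal]) (auto intro!: subsetD[OF schur.genideal_self])
  show "\<exists>c\<in>range scalar. weight_idem l \<otimes>\<^bsub>?R\<^esub> a \<otimes>\<^bsub>?R\<^esub> weight_idem l \<ominus>\<^bsub>?R\<^esub> c \<otimes>\<^bsub>?R\<^esub> weight_idem l
      \<in> Idl\<^bsub>?R\<^esub> (weight_idem ` {m \<in> compositions r n. l < m})"
    if l: "l \<in> compositions r n" and a: "a \<in> carrier ?R" for l a
  proof -
    have "\<exists>c. weight_idem l \<otimes>\<^bsub>?R\<^esub> a \<otimes>\<^bsub>?R\<^esub> weight_idem l \<ominus>\<^bsub>?R\<^esub> scalar c \<otimes>\<^bsub>?R\<^esub> weight_idem l
      \<in> Idl\<^bsub>?R\<^esub> (weight_idem ` {m \<in> compositions r n. l < m})"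
    proof (rule diagonal_modulo_ideal[OF schur.genideal_ideal l])
      show "weight_idem m \<in> Idl\<^bsub>?R\<^esub> (weight_idem ` {m \<in> compositions r n. l < m})"
        if "m \<in> compositions r n" "l < m" for m
        using that by (intro subsetD[OF schur.genideal_self]) auto
      show "weight i = l \<and> weight j = l"
        if "i \<in> W" "j \<in> W" "mat (weight_idem l \<otimes>\<^bsub>?R\<^esub> a \<otimes>\<^bsub>?R\<^esub> weight_idem l) i j \<noteq> 0" for i j
        using that by (simp add: mat_weight_idem_mult mat_mult_weight_idem split: if_splits)
    qed (use a in auto)
    then show ?thesis by blast
  qed
qed auto

end

section \<open>Dominant weights\<close>

lemma list_less_at:
  fixes xs ys :: "nat list"
  assumes "length xs = length ys" "i < length xs" "take i xs = take i ys" "xs ! i < ys ! i"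
  shows "xs < ys"
proof -
  have "xs = take i xs @ (xs ! i) # drop (Suc i) xs" "ys = take i ys @ (ys ! i) # drop (Suc i) ys"
    using assms(1,2) by (simp_all add: id_take_nth_drop)
  moreover have "zs @ x # as < zs @ y # bs" if "x < y" for zs as bs :: "nat list" and x y
    using that by (induction zs) auto
  ultimately show ?thesis using assms(3,4) by metis
qed

context words
begin

section \<open>Compositions with an ascent\<close>

lemma letter_swap_weight:
  assumes x: "x \<in> W" and ab: "a < n" "b < n"
  defines "y \<equiv> \<lambda>k\<in>{1..r}. transpose a b (x k)"
  shows "y \<in> W" and "i < n \<Longrightarrow> weight y ! i = weight x ! transpose a b i"
    and "(\<lambda>k\<in>{1..r}. transpose a b (y k)) = x"
proof -
  have lt: "transpose a b i < n" if "i < n" for i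
    using that ab by (simp add: transpose_def)
  show "y \<in> W" using x lt by (auto simp: W_def y_def PiE_iff)
  show "(\<lambda>k\<in>{1..r}. transpose a b (y k)) = x"
    by (rule word_eqI) (use x lt in \<open>auto simp: W_def y_def PiE_iff\<close>)
  assume i: "i < n"
  have "y k = i \<longleftrightarrow> x k = transpose a b i" if "k \<in> {1..r}" for k
    using that by (auto simp: y_def transpose_def)
  then have "{k \<in> {1..r}. y k = i} = {k \<in> {1..r}. x k = transpose a b i}" by blast
  then show "weight y ! i = weight x ! transpose a b i" using i lt by (simp add: nth_weight)
qed

lemma weight_idem_in_ideal_if_ascent:
  fixes I :: "(schur_index \<Rightarrow> 'k::field) set"
  assumes I: "ideal I schur_algebra"
    and above: "\<And>m. \<lbrakk>m \<in> compositions r n; l < m\<rbrakk> \<Longrightarrow> weight_idem m \<in> I"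
    and l: "l \<in> compositions r n" and i: "Suc i < n" "l ! i < l ! Suc i"
  shows "weight_idem l \<in> I"
proof -
  interpret I: ideal I schur_algebra by (rule I)
  define sw where "sw x = (\<lambda>k\<in>{1..r}. transpose i (Suc i) (x k))" for x :: "nat \<Rightarrow> nat"
  have sw: "sw x \<in> W" "sw (sw x) = x" "\<And>t. t < n \<Longrightarrow> weight (sw x) ! t = weight x ! transpose i (Suc i) t"
    if "x \<in> W" for x
    using letter_swap_weight[OF that, of i "Suc i"] i by (simp_all add: sw_def)
  have sw_comp: "sw (x \<circ> \<sigma>) = sw x \<circ> \<sigma>" if "x \<in> W" "\<sigma> permutes {1..r}" for x \<sigma>
    by (rule word_eqI[OF sw(1)[OF word_compose[OF that]] word_compose[OF sw(1)[OF that(1)] that(2)]])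
      (use permutes_in_image[OF that(2)] in \<open>simp add: sw_def\<close>)
  define l' where "l' = weight (sw (canonical l))"
  have cW: "canonical l \<in> W" and cwt: "weight (canonical l) = l"
    using l by (simp_all add: canonical_in_W weight_canonical)
  have len: "length l = n" using l by (simp add: compositions_def)
  have l'c: "l' \<in> compositions r n" unfolding l'_def by (intro weight_in_compositions sw cW)
  have nth: "l' ! t = l ! transpose i (Suc i) t" if "t < n" for t
    using sw(3)[OF cW that] by (simp add: l'_def cwt)
  have "l < l'"
  proof (rule list_less_at[of _ _ i])
    show "take i l = take i l'"
      using i len nth by (intro nth_equalityI) (auto simp: l'_def transpose_def)
  qed (use i len nth in \<open>auto simp: l'_def\<close>)
  then have eI: "weight_idem l' \<in> I" using above l'c by blast
  have wt_sw: "weight (sw x) = l'" if "x \<in> W" "weight x = l" for x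
    by (rule nth_equalityI) (use sw(3)[OF that(1)] nth that(2) in \<open>auto simp: l'_def\<close>)
  \<comment> \<open>The letter swap on the words of weight \<open>l\<close>, as a matrix in both
    directions. Permuting letters commutes with permuting places, so both matrices are invariant;
    their product is \<open>weight_idem l\<close> and passes through the larger weight
    \<open>l'\<close>.\<close>
  define a where "a = (of_mat (\<lambda>x y. if weight x = l \<and> y = sw x then 1 else 0) :: schur_index \<Rightarrow> 'k)"
  define b where "b = (of_mat (\<lambda>y x. if weight x = l \<and> y = sw x then 1 else 0) :: schur_index \<Rightarrow> 'k)"
  have ma: "mat a x y = (if weight x = l \<and> y = sw x then 1 else 0)" if "x \<in> W" "y \<in> W" for x y
    unfolding a_def using that
    by (intro mat_of_mat) (auto simp: invariant_def word_compose_inj weight_compose sw_comp)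
  have mb: "mat b y x = (if weight x = l \<and> y = sw x then 1 else 0)" if "x \<in> W" "y \<in> W" for x y
    unfolding b_def using that
    by (intro mat_of_mat) (auto simp: invariant_def word_compose_inj weight_compose sw_comp)
  have ac: "a \<in> carrier schur_algebra" and bc: "b \<in> carrier schur_algebra"
    by (simp_all add: a_def b_def of_mat_closed)
  have "a \<otimes>\<^bsub>schur_algebra\<^esub> weight_idem l' = a"
    by (rule schur_algebra_eqI) (auto simp: ac mat_mult_weight_idem ma wt_sw)
  then have aI: "a \<in> I" using I.I_l_closed[OF eI ac] by simp
  have "a \<otimes>\<^bsub>schur_algebra\<^esub> b = weight_idem l"
  proof (rule schur_algebra_eqI)
    fix x y assume xy: "x \<in> W" "y \<in> W"
    have inj: "sw x = sw y \<longleftrightarrow> x = y" using sw(2)[OF xy(1)] sw(2)[OF xy(2)] by metis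
    have "mat (a \<otimes>\<^bsub>schur_algebra\<^esub> b) x y =
      (\<Sum>m\<in>W. if m = sw x then if x = y \<and> weight x = l then 1 else 0 else 0)"
      unfolding mat_mult[OF xy] by (intro sum.cong refl) (auto simp: ma mb xy inj)
    then show "mat (a \<otimes>\<^bsub>schur_algebra\<^esub> b) x y = mat (weight_idem l) x y"
      using xy sw(1)[OF xy(1)] by (simp add: finite_W mat_weight_idem)
  qed (auto simp: ac bc)
  then show ?thesis using I.I_r_closed[OF aI bc] by simp
qed

subsection \<open>Column antisymmetrizers\<close>

text \<open>The places fill the Young diagram of \<open>l\<close> bijectively: place
  \<open>k\<close> stands in row \<open>w k\<close> and column \<open>col k\<close>, both counted
  from 0.\<close>

definition is_tableau :: "nat list \<Rightarrow> (nat \<Rightarrow> nat) \<Rightarrow> (nat \<Rightarrow> nat) \<Rightarrow> bool" where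
  "is_tableau l w col \<longleftrightarrow>
     w \<in> W \<and> bij_betw (\<lambda>k. (w k, col k)) {1..r} (SIGMA i:{..<n}. {..<l ! i})"

lemma tableau_exists:
  assumes l: "l \<in> compositions r n"
  obtains w col where "is_tableau l w col"
proof -
  let ?C = "SIGMA i:{..<n}. {..<l ! i}"
  have "card ?C = (\<Sum>i<n. l ! i)" by simp
  also have "\<dots> = r" using l by (auto simp: compositions_def sum_list_sum_nth atLeast0LessThan)
  finally have "card {1..r} = card ?C" by simp
  then obtain \<beta> where \<beta>: "bij_betw \<beta> {1..r} ?C"
    using finite_same_card_bij[of "{1..r}" ?C] by auto
  let ?w = "\<lambda>k\<in>{1..r}. fst (\<beta> k)" and ?col = "\<lambda>k. snd (\<beta> k)"
  have "bij_betw (\<lambda>k. (?w k, ?col k)) {1..r} ?C"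
    using \<beta> by (rule bij_betw_cong[THEN iffD1, rotated]) auto
  moreover have "?w \<in> W" using bij_betwE[OF \<beta>] by (auto simp: W_def)
  ultimately show thesis using that[of ?w ?col] by (simp add: is_tableau_def)
qed

lemma tableau_weight:
  assumes l: "l \<in> compositions r n" and t: "is_tableau l w col"
  shows "weight w = l"
proof (rule nth_equalityI)
  fix i assume "i < length (weight w)"
  then have i: "i < n" by simp
  have bij: "bij_betw (\<lambda>k. (w k, col k)) {1..r} (SIGMA i:{..<n}. {..<l ! i})"
    using t by (simp add: is_tableau_def)
  have "bij_betw (\<lambda>k. (w k, col k)) {k \<in> {1..r}. w k = i} ({i} \<times> {..<l ! i})"
  proof (rule bij_betw_subset[OF bij])
    show "(\<lambda>k. (w k, col k)) ` {k \<in> {1..r}. w k = i} = {i} \<times> {..<l ! i}"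
    proof (intro equalityI subsetI)
      fix p assume p: "p \<in> {i} \<times> {..<l ! i}"
      then have "p \<in> (\<lambda>k. (w k, col k)) ` {1..r}" using bij i by (auto simp: bij_betw_def)
      with p show "p \<in> (\<lambda>k. (w k, col k)) ` {k \<in> {1..r}. w k = i}" by auto
    next
      fix p assume "p \<in> (\<lambda>k. (w k, col k)) ` {k \<in> {1..r}. w k = i}"
      then show "p \<in> {i} \<times> {..<l ! i}" using bij_betwE[OF bij] by auto
    qed
  qed auto
  then have "card {k \<in> {1..r}. w k = i} = l ! i" by (auto dest: bij_betw_same_card)
  then show "weight w ! i = l ! i" using i by (simp add: nth_weight)
qed (use l in \<open>simp add: compositions_def\<close>)

text \<open>A word without repetition in a column has there at most as many letters below
  \<open>s\<close> as there are such letters, and at most as many as the column is long. The row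
  word \<open>w\<close> attains the smaller bound in every column, so its prefix sums are
  largest.\<close>

lemma weight_le_of_column_injective:
  assumes l: "l \<in> compositions r n" and desc: "sorted_wrt (\<ge>) l" and t: "is_tableau l w col"
    and x: "x \<in> W"
    and inj: "\<And>k k'. \<lbrakk>k \<in> {1..r}; k' \<in> {1..r}; col k = col k'; x k = x k'\<rbrakk> \<Longrightarrow> k = k'"
  shows "weight x \<le> l"
proof -
  have w: "w \<in> W" and bij: "bij_betw (\<lambda>k. (w k, col k)) {1..r} (SIGMA i:{..<n}. {..<l ! i})"
    using t by (simp_all add: is_tableau_def)
  have len: "length l = n" using l by (simp add: compositions_def)
  have col: "card {k \<in> {1..r}. col k = c \<and> x k < s} \<le> card {k \<in> {1..r}. col k = c \<and> w k < s}"
    (is "card ?X \<le> card ?Y") for c s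
  proof (cases "\<exists>k\<in>{1..r}. col k = c \<and> s \<le> w k")
    case False
    then have "?X \<subseteq> ?Y" by auto
    then show ?thesis by (intro card_mono) auto
  next
    case True
    then obtain k where k: "k \<in> {1..r}" "col k = c" "s \<le> w k" by blast
    have wk: "w k < n" "c < l ! w k" using bij_betwE[OF bij] k by auto
    \<comment> \<open>The decreasing order of \<open>l\<close> enters here: rows above row
      \<open>w k\<close> are at least as long, so they meet column \<open>c\<close> too.\<close>
    have "{..<s} \<subseteq> w ` ?Y"
    proof
      fix i assume "i \<in> {..<s}"
      then have i: "i < s" "i < w k" using k by auto
      have "l ! w k \<le> l ! i" using sorted_wrt_nth_less[OF desc i(2)] wk len by simp
      then have "(i, c) \<in> (\<lambda>k. (w k, col k)) ` {1..r}" using bij i wk by (auto simp: bij_betw_def)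
      then show "i \<in> w ` ?Y" using i by auto
    qed
    then have "card {..<s} \<le> card (w ` ?Y)" by (intro card_mono) auto
    also have "\<dots> \<le> card ?Y" by (intro card_image_le) auto
    finally have "s \<le> card ?Y" by simp
    moreover have "card ?X \<le> s"
    proof -
      have "inj_on x ?X"
      proof (rule inj_onI)
        fix k k' assume "k \<in> ?X" "k' \<in> ?X" "x k = x k'"
        then show "k = k'" using inj[of k k'] by simp
      qed
      then have "card ?X = card (x ` ?X)" by (simp only: card_image)
      also have "\<dots> \<le> card {..<s}" by (intro card_mono) auto
      finally show ?thesis by simp
    qed
    ultimately show ?thesis by simp
  qed
  have split: "card {k \<in> {1..r}. y k < s} = (\<Sum>c\<in>col ` {1..r}. card {k \<in> {1..r}. col k = c \<and> y k < s})"
    for y :: "nat \<Rightarrow> nat" and s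
  proof -
    have "{k \<in> {1..r}. y k < s} = (\<Union>c\<in>col ` {1..r}. {k \<in> {1..r}. col k = c \<and> y k < s})" by auto
    then have "card {k \<in> {1..r}. y k < s} = card (\<Union>c\<in>col ` {1..r}. {k \<in> {1..r}. col k = c \<and> y k < s})"
      by (rule arg_cong)
    also have "\<dots> = (\<Sum>c\<in>col ` {1..r}. card {k \<in> {1..r}. col k = c \<and> y k < s})"
      by (rule card_UN_disjoint) auto
    finally show ?thesis .
  qed
  show ?thesis
  proof (rule prefix_dominance_le)
    fix s assume "s \<le> length (weight x)"
    then have s: "s \<le> n" by simp
    have "card {k \<in> {1..r}. x k < s} \<le> card {k \<in> {1..r}. w k < s}"
      unfolding split by (rule sum_mono) (rule col)
    then show "sum_list (take s (weight x)) \<le> sum_list (take s l)"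
      using sum_take_weight[OF x s] sum_take_weight[OF w s] tableau_weight[OF l t] by simp
  qed (simp add: len)
qed

definition column_group :: "(nat \<Rightarrow> nat) \<Rightarrow> (nat \<Rightarrow> nat) set" where
  "column_group col = {\<sigma>. \<sigma> permutes {1..r} \<and> (\<forall>k\<in>{1..r}. col (\<sigma> k) = col k)}"

text \<open>With words as a basis of tensor space, this is the coordinate at \<open>x\<close> of the
  image under \<open>a\<close> of the signed sum of the words
  \<open>w \<circ> \<sigma>\<close>.\<close>

definition antisym :: "(nat \<Rightarrow> nat) \<Rightarrow> (nat \<Rightarrow> nat) \<Rightarrow> (schur_index \<Rightarrow> 'k::field) \<Rightarrow> (nat \<Rightarrow> nat) \<Rightarrow> 'k" where
  "antisym w col a x = (\<Sum>\<sigma>\<in>column_group col. of_int (sign \<sigma>) * mat a x (w \<circ> \<sigma>))"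

lemma finite_column_group: "finite (column_group col)"
  by (rule finite_subset[OF _ finite_permutations[of "{1..r}"]]) (auto simp: column_group_def)

text \<open>The transposition of the two places fixes \<open>x\<close> and preserves columns, so by
  invariance the terms of \<open>\<sigma>\<close> and \<open>\<sigma> \<circ> \<tau>\<close> have
  equal entries and opposite signs.\<close>

lemma antisym_collision:
  assumes k: "k \<in> {1..r}" "k' \<in> {1..r}" "k \<noteq> k'" "col k = col k'" "x k = x k'"
  shows "antisym w col a x = (0 :: 'k::field)"
proof -
  define \<tau> where "\<tau> = transpose k k'"
  have \<tau>: "\<tau> permutes {1..r}" using k unfolding \<tau>_def by (intro permutes_swap_id)
  have x: "x \<circ> \<tau> = x" using k(5) by (auto simp: \<tau>_def transpose_def)
  have g: "mat a x (w \<circ> (\<sigma> \<circ> \<tau>)) = mat a x (w \<circ> \<sigma>)" for \<sigma>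
    using mat_invariant[OF \<tau>, of a x "w \<circ> \<sigma>"] by (simp add: x o_assoc)
  have \<tau>\<tau>: "\<sigma> \<circ> \<tau> \<circ> \<tau> = \<sigma>" for \<sigma> :: "nat \<Rightarrow> nat" by (simp add: \<tau>_def o_assoc[symmetric])
  have cl: "\<sigma> \<circ> \<tau> \<in> column_group col" if "\<sigma> \<in> column_group col" for \<sigma>
  proof -
    have "col (\<sigma> (\<tau> i)) = col i" if "i \<in> {1..r}" for i
    proof -
      have "\<tau> i \<in> {1..r}" using permutes_in_image[OF \<tau>] that by (simp only:)
      then have "col (\<sigma> (\<tau> i)) = col (\<tau> i)" using \<open>\<sigma> \<in> _\<close> by (simp add: column_group_def)
      then show ?thesis using k(4) by (simp add: \<tau>_def transpose_def split: if_splits)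
    qed
    with that \<tau> show ?thesis by (simp add: column_group_def permutes_compose)
  qed
  have sg: "sign (\<sigma> \<circ> \<tau>) = - sign \<sigma>" if "\<sigma> \<in> column_group col" for \<sigma>
  proof -
    have "permutation \<sigma>" using that permutation_permutes by (auto simp: column_group_def)
    then show ?thesis using k(3) by (simp add: \<tau>_def sign_compose permutation_swap_id sign_swap_id)
  qed
  \<comment> \<open>Cancel \<open>\<sigma>\<close> against \<open>\<sigma> \<circ> \<tau>\<close>: antisymmetry under \<open>\<tau>\<close> alone proves nothing in characteristic \<open>2\<close>.\<close>
  let ?E = "{\<sigma> \<in> column_group col. sign \<sigma> = 1}" and ?O = "{\<sigma> \<in> column_group col. sign \<sigma> = - 1}"
  have bij: "bij_betw (\<lambda>\<sigma>. \<sigma> \<circ> \<tau>) ?E ?O"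
    by (rule bij_betwI[where g = "\<lambda>\<sigma>. \<sigma> \<circ> \<tau>"]) (simp_all add: Pi_def cl sg \<tau>\<tau>)
  have "column_group col = ?E \<union> ?O" using sign_cases by blast
  then have "antisym w col a x = (\<Sum>\<sigma>\<in>?E \<union> ?O. of_int (sign \<sigma>) * mat a x (w \<circ> \<sigma>))"
    by (simp add: antisym_def)
  also have "\<dots> = (\<Sum>\<sigma>\<in>?E. mat a x (w \<circ> \<sigma>)) + (\<Sum>\<sigma>\<in>?O. - mat a x (w \<circ> \<sigma>))"
    by (subst sum.union_disjoint) (auto simp: finite_column_group intro!: sum.cong)
  also have "(\<Sum>\<sigma>\<in>?O. - mat a x (w \<circ> \<sigma>)) = (\<Sum>\<sigma>\<in>?E. - mat a x (w \<circ> (\<sigma> \<circ> \<tau>)))"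
    by (rule sum.reindex_bij_betw[OF bij, symmetric])
  finally show ?thesis by (simp only: g sum_negf add.right_inverse)
qed

lemma antisym_mult:
  assumes w: "w \<in> W" and x: "x \<in> W"
  shows "antisym w col (a \<otimes>\<^bsub>schur_algebra\<^esub> b) x = (\<Sum>m\<in>W. mat a x m * antisym w col b m)"
proof -
  have "antisym w col (a \<otimes>\<^bsub>schur_algebra\<^esub> b) x =
    (\<Sum>\<sigma>\<in>column_group col. \<Sum>m\<in>W. mat a x m * (of_int (sign \<sigma>) * mat b m (w \<circ> \<sigma>)))"
    unfolding antisym_def
    by (intro sum.cong refl)
      (simp add: column_group_def mat_mult x word_compose w sum_distrib_left mult_ac)
  also have "\<dots> = (\<Sum>m\<in>W. \<Sum>\<sigma>\<in>column_group col. mat a x m * (of_int (sign \<sigma>) * mat b m (w \<circ> \<sigma>)))"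
    by (rule sum.swap)
  finally show ?thesis by (simp add: antisym_def sum_distrib_left)
qed

lemma weight_idem_notin_above:
  assumes l: "l \<in> compositions r n" and desc: "sorted_wrt (\<ge>) l"
  shows "weight_idem l \<notin> Idl\<^bsub>schur_algebra :: (schur_index \<Rightarrow> 'k::field) ring\<^esub>
    (weight_idem ` {m \<in> compositions r n. l < m})"
proof -
  let ?R = "schur_algebra :: (schur_index \<Rightarrow> 'k) ring"
  obtain w col where t: "is_tableau l w col" using tableau_exists[OF l] .
  have w: "w \<in> W" and bij: "bij_betw (\<lambda>k. (w k, col k)) {1..r} (SIGMA i:{..<n}. {..<l ! i})"
    using t by (simp_all add: is_tableau_def)
  have wt: "weight w = l" using tableau_weight[OF l t] .
  \<comment> \<open>The annihilator of the submodule of tensor space generated by the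
    antisymmetrized word, hence a two-sided ideal.\<close>
  define Z where "Z = {a \<in> carrier ?R. \<forall>b\<in>carrier ?R. \<forall>x\<in>W. antisym w col (a \<otimes>\<^bsub>?R\<^esub> b) x = 0}"
  have anti_add: "antisym w col (a \<oplus>\<^bsub>?R\<^esub> b) x = antisym w col a x + antisym w col b x" for a b :: "schur_index \<Rightarrow> 'k" and x
    by (simp add: antisym_def distrib_left sum.distrib)
  have anti_neg: "antisym w col (\<ominus>\<^bsub>?R\<^esub> a) x = - antisym w col a x" if "a \<in> carrier ?R" for a and x
    using that by (simp add: antisym_def sum_negf)
  have anti_zero: "antisym w col \<zero>\<^bsub>?R\<^esub> x = (0 :: 'k)" for x by (simp add: antisym_def)
  have Z: "ideal Z ?R"
  proof (rule idealI[OF ring_schur_algebra], rule subgroup.intro)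
    show "Z \<subseteq> carrier (add_monoid ?R)" by (auto simp: Z_def)
    show "a \<otimes>\<^bsub>add_monoid ?R\<^esub> b \<in> Z" if "a \<in> Z" "b \<in> Z" for a b
      using that by (auto simp: Z_def schur.l_distr anti_add)
    show "\<one>\<^bsub>add_monoid ?R\<^esub> \<in> Z" by (auto simp: Z_def anti_zero)
    show "inv\<^bsub>add_monoid ?R\<^esub> a \<in> Z" if "a \<in> Z" for a
      unfolding a_inv_def[symmetric] using that by (auto simp: Z_def schur.l_minus anti_neg)
    show "c \<otimes>\<^bsub>?R\<^esub> a \<in> Z" if "a \<in> Z" "c \<in> carrier ?R" for a c
      using that by (auto simp: Z_def schur.m_assoc antisym_mult[OF w, of _ _ c])
    show "a \<otimes>\<^bsub>?R\<^esub> c \<in> Z" if "a \<in> Z" "c \<in> carrier ?R" for a c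
      using that by (auto simp: Z_def schur.m_assoc)
  qed
  have "weight_idem ` {m \<in> compositions r n. l < m} \<subseteq> Z"
  proof
    fix e assume "e \<in> (weight_idem ` {m \<in> compositions r n. l < m} :: (schur_index \<Rightarrow> 'k) set)"
    then obtain m where m: "l < m" and e: "e = weight_idem m" by auto
    have "antisym w col (e \<otimes>\<^bsub>?R\<^esub> b) x = 0" if x: "x \<in> W" for b x
    proof (cases "weight x = m")
      case False
      then show ?thesis unfolding e antisym_def
        using x w by (intro sum.neutral) (auto simp: mat_weight_idem_mult word_compose column_group_def)
    next
      case True
      then have "\<not> weight x \<le> l" using m by simp
      then obtain k k' where "k \<in> {1..r}" "k' \<in> {1..r}" "k \<noteq> k'" "col k = col k'" "x k = x k'"
        using weight_le_of_column_injective[OF l desc t x] by blast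
      then show ?thesis by (rule antisym_collision)
    qed
    then show "e \<in> Z" by (simp add: Z_def e)
  qed
  then have "Idl\<^bsub>?R\<^esub> (weight_idem ` {m \<in> compositions r n. l < m}) \<subseteq> Z"
    by (rule schur.genideal_minimal[OF Z])
  moreover have "weight_idem l \<notin> Z"
  proof
    assume "weight_idem l \<in> Z"
    then have "antisym w col (weight_idem l \<otimes>\<^bsub>?R\<^esub> \<one>\<^bsub>?R\<^esub>) w = 0"
      using w schur.one_closed unfolding Z_def by blast
    then have "antisym w col (weight_idem l :: schur_index \<Rightarrow> 'k) w = 0" by simp
    moreover have "antisym w col (weight_idem l :: schur_index \<Rightarrow> 'k) w =
      (\<Sum>\<sigma>\<in>column_group col. if \<sigma> = id then 1 else 0)"
      unfolding antisym_def
    proof (intro sum.cong refl)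
      fix \<sigma> assume \<sigma>: "\<sigma> \<in> column_group col"
      then have p: "\<sigma> permutes {1..r}" by (simp add: column_group_def)
      \<comment> \<open>A column permutation that also preserves rows fixes every cell of the
        diagram. Hence the coefficient at \<open>w\<close> is 1, which is nonzero in every
        characteristic.\<close>
      have "w = w \<circ> \<sigma> \<longleftrightarrow> \<sigma> = id"
      proof
        assume eq: "w = w \<circ> \<sigma>"
        show "\<sigma> = id"
        proof
          fix k show "\<sigma> k = id k"
          proof (cases "k \<in> {1..r}")
            case True
            have "w (\<sigma> k) = w k" using fun_cong[OF eq, of k] by simp
            moreover have "col (\<sigma> k) = col k" using \<sigma> True by (simp add: column_group_def)
            moreover have "\<sigma> k \<in> {1..r}" using permutes_in_image[OF p] True by (simp only:)
            ultimately show ?thesis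
              using inj_onD[OF bij_betw_imp_inj_on[OF bij], of "\<sigma> k" k] True by simp
          next
            case False then show ?thesis using p by (simp add: permutes_not_in)
          qed
        qed
      qed simp
      then show "of_int (sign \<sigma>) * mat (weight_idem l) w (w \<circ> \<sigma>) = (if \<sigma> = id then 1 else 0 :: 'k)"
        by (simp add: mat_weight_idem w word_compose[OF w p] wt)
    qed
    moreover have "id \<in> column_group col" by (simp add: column_group_def permutes_id)
    ultimately show False by (simp add: finite_column_group)
  qed
  ultimately show ?thesis by blast
qed

lemma dominant_weights_schur:
  "weighted_ring.dominant_weights (schur_algebra :: (schur_index \<Rightarrow> 'k::field) ring) weight_idem (compositions r n) =
    {l \<in> compositions r n. sorted_wrt (\<ge>) l}"
proof -
  let ?R = "schur_algebra :: (schur_index \<Rightarrow> 'k) ring"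
  interpret weighted_ring ?R "range scalar" weight_idem "compositions r n"
    by (rule weighted_ring_schur)
  have "sorted_wrt (\<ge>) l" if l: "l \<in> compositions r n" and notin: "weight_idem l \<notin> above l" for l
  proof (rule ccontr)
    have len: "length l = n" using l by (simp add: compositions_def)
    assume "\<not> sorted_wrt (\<ge>) l"
    then have "\<not> sorted_wrt (\<lambda>x y. y \<le> x) l" by simp
    then obtain i where "Suc i < n" "l ! i < l ! Suc i"
      using sorted_wrt_iff_nth_Suc_transp[of "\<lambda>x y. y \<le> (x :: nat)" l] len
      by (auto simp: transp_def not_le)
    then have "weight_idem l \<in> above l"
      using weight_idem_in_ideal_if_ascent[OF ideal_above _ l] e_above by blast
    with notin show False by contradiction
  qed
  then show ?thesis
    using weight_idem_notin_above by (auto simp: dominant_weights_def above_def)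
qed

end

section \<open>Partitions and their base-p digits\<close>

definition partitions_of :: "nat \<Rightarrow> nat multiset set" where
  "partitions_of r = {\<mu>. is_partition_of \<mu> r}"

text \<open>A part of the partition at index \<open>i\<close> is repeated \<open>p ^ i\<close>
  times. For \<open>p \<ge> 2\<close> the indices up to \<open>r\<close> suffice by
  \<open>choice_bound\<close>.\<close>

definition of_choice :: "nat \<Rightarrow> nat \<Rightarrow> (nat \<Rightarrow> nat) \<times> (nat \<Rightarrow> nat multiset) \<Rightarrow> nat multiset" where
  "of_choice p r c = (\<Sum>i<Suc r. repeat_mset (p ^ i) (snd c i))"

text \<open>The digits at place \<open>i\<close> of all multiplicities; since digits are smaller
  than \<open>p\<close>, the result is \<open>p\<close>-regular.\<close>

definition digit_parts :: "nat \<Rightarrow> nat multiset \<Rightarrow> nat \<Rightarrow> nat multiset" where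
  "digit_parts p \<mu> i = (\<Sum>a\<in>set_mset \<mu>. replicate_mset (count \<mu> a div p ^ i mod p) a)"

definition to_choice :: "nat \<Rightarrow> nat multiset \<Rightarrow> (nat \<Rightarrow> nat) \<times> (nat \<Rightarrow> nat multiset)" where
  "to_choice p \<mu> = (\<lambda>i. sum_mset (digit_parts p \<mu> i), digit_parts p \<mu>)"

lemma sum_digits: "(\<Sum>i<N. p ^ i * (c div p ^ i mod p)) = c mod (p ^ N :: nat)"
proof (induction N)
  case (Suc N)
  have "c mod p ^ Suc N = p ^ N * (c div p ^ N mod p) + c mod p ^ N"
    by (metis mod_mult2_eq power_Suc2)
  then show ?case using Suc by simp
qed simp

text \<open>Uniqueness of base \<open>p\<close> expansions: dividing by \<open>p\<close> strips the
  lowest digit and shifts the others.\<close>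

lemma digit_of_sum:
  fixes d :: "nat \<Rightarrow> nat"
  assumes "\<And>j. d j < p"
  shows "(\<Sum>j<N. p ^ j * d j) div p ^ i mod p = (if i < N then d i else 0)"
  using assms
proof (induction N arbitrary: d i)
  case (Suc N)
  have "(\<Sum>j<Suc N. p ^ j * d j) = d 0 + (\<Sum>j<N. p ^ Suc j * d (Suc j))"
    by (subst sum.lessThan_Suc_shift) simp
  also have "\<dots> = d 0 + p * (\<Sum>j<N. p ^ j * d (Suc j))"
    by (simp add: sum_distrib_left mult.assoc)
  finally have S: "(\<Sum>j<Suc N. p ^ j * d j) = d 0 + p * (\<Sum>j<N. p ^ j * d (Suc j))" (is "_ = d 0 + p * ?T") .
  show ?case
  proof (cases i)
    case 0 then show ?thesis using Suc.prems[of 0] by (simp only: S) simp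
  next
    case (Suc i')
    have "(d 0 + p * ?T) div p = ?T" using Suc.prems[of 0] by simp
    then have "(d 0 + p * ?T) div p ^ i = ?T div p ^ i'"
      using Suc by (metis div_mult2_eq power_Suc)
    then show ?thesis using Suc.IH[of "\<lambda>j. d (Suc j)" i'] Suc.prems Suc by (simp only: S) simp
  qed
qed simp

lemma sum_mset_repeat: "sum_mset (repeat_mset k A) = k * (sum_mset A :: nat)"
  by (induction k) auto

lemma sum_mset_sum: "finite A \<Longrightarrow> sum_mset (\<Sum>i\<in>A. f i) = (\<Sum>i\<in>A. sum_mset (f i) :: nat)"
  by (induction A rule: finite_induct) auto

lemma count_digit_parts: "count (digit_parts p \<mu> i) a = count \<mu> a div p ^ i mod p"
proof (cases "a \<in># \<mu>")
  case True
  have "count (digit_parts p \<mu> i) a = (\<Sum>b\<in>set_mset \<mu>. if b = a then count \<mu> a div p ^ i mod p else 0)"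
    unfolding digit_parts_def count_sum by (intro sum.cong) auto
  with True show ?thesis by simp
next
  case False
  then have "count (digit_parts p \<mu> i) a = 0"
    unfolding digit_parts_def count_sum by (intro sum.neutral) auto
  with False show ?thesis by (simp add: not_in_iff)
qed

lemma count_le_sum_mset: "a \<noteq> 0 \<Longrightarrow> count \<mu> a \<le> sum_mset (\<mu> :: nat multiset)"
  by (induction \<mu>) auto

lemma size_le_sum_mset: "0 \<notin># \<mu> \<Longrightarrow> size \<mu> \<le> sum_mset (\<mu> :: nat multiset)"
  by (induction \<mu>) auto

lemma of_choice_to_choice:
  assumes p: "2 \<le> p" and \<mu>: "\<mu> \<in> partitions_of r"
  shows "of_choice p r (to_choice p \<mu>) = \<mu>"
proof (rule multiset_eqI)
  fix a
  \<comment> \<open>Multiplicities are at most \<open>r\<close>, so \<open>Suc r\<close> digits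
    reproduce them.\<close>
  have "count \<mu> a \<le> r"
    using \<mu> count_le_sum_mset[of a \<mu>] by (cases "a = 0") (auto simp: partitions_of_def is_partition_of_def not_in_iff)
  also have "r < p ^ Suc r"
    using p by (meson Suc_lessD less_exp order_less_le_trans power_mono zero_le lessI less_trans)
  finally have "count \<mu> a < p ^ Suc r" .
  have "count (of_choice p r (to_choice p \<mu>)) a = (\<Sum>i<Suc r. p ^ i * (count \<mu> a div p ^ i mod p))"
    unfolding of_choice_def count_sum by (simp add: to_choice_def count_digit_parts del: sum.lessThan_Suc)
  also have "\<dots> = count \<mu> a"
    unfolding sum_digits using \<open>count \<mu> a < p ^ Suc r\<close> by (rule mod_less)
  finally show "count (of_choice p r (to_choice p \<mu>)) a = count \<mu> a" .
qed

text \<open>A nonzero \<open>s i\<close> contributes at least \<open>p ^ i\<close>, which exceeds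
  \<open>i\<close>, to the total \<open>r\<close>.\<close>

lemma choice_bound:
  assumes p: "2 \<le> p" and c: "(s, \<pi>) \<in> choices p r" and s: "s i \<noteq> 0"
  shows "i < Suc r"
proof -
  have "i < p ^ i" using p by (meson less_exp order_less_le_trans power_mono zero_le)
  also have "p ^ i \<le> s i * p ^ i" using s by simp
  also have "\<dots> \<le> (\<Sum>i | s i \<noteq> 0. s i * p ^ i)"
    using c s by (intro member_le_sum) (auto simp: choices_def)
  also have "\<dots> = r" using c by (simp add: choices_def)
  finally show ?thesis by simp
qed

lemma choice_parts:
  assumes c: "(s, \<pi>) \<in> choices p r"
  shows "sum_mset (\<pi> i) = s i" "0 \<notin># \<pi> i" "p > 0 \<Longrightarrow> count (\<pi> i) a < p"
proof -
  have "if s i > 0 then is_partition_of (\<pi> i) (s i) \<and> p_regular p (\<pi> i) else \<pi> i = {#}"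
    using c by (auto simp: choices_def)
  then show "sum_mset (\<pi> i) = s i" "0 \<notin># \<pi> i" "p > 0 \<Longrightarrow> count (\<pi> i) a < p"
    by (cases "a = 0"; auto simp: is_partition_of_def p_regular_def not_in_iff split: if_splits)+
qed

lemma of_choice_in_partitions:
  assumes p: "2 \<le> p" and c: "(s, \<pi>) \<in> choices p r"
  shows "of_choice p r (s, \<pi>) \<in> partitions_of r"
proof -
  have "sum_mset (of_choice p r (s, \<pi>)) = (\<Sum>i<Suc r. s i * p ^ i)"
    unfolding of_choice_def
    by (simp add: sum_mset_sum sum_mset_repeat choice_parts(1)[OF c] mult.commute del: sum.lessThan_Suc)
  also have "\<dots> = (\<Sum>i | s i \<noteq> 0. s i * p ^ i)"
    using choice_bound[OF p c] by (intro sum.mono_neutral_right) auto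
  also have "\<dots> = r" using c by (simp add: choices_def)
  finally have "sum_mset (of_choice p r (s, \<pi>)) = r" .
  moreover have "count (of_choice p r (s, \<pi>)) 0 = 0"
    using choice_parts(2)[OF c] unfolding of_choice_def count_sum by (intro sum.neutral) (simp add: not_in_iff)
  ultimately show ?thesis by (simp add: partitions_of_def is_partition_of_def not_in_iff)
qed

lemma to_choice_in_choices:
  assumes p: "2 \<le> p" and \<mu>: "\<mu> \<in> partitions_of r"
  shows "to_choice p \<mu> \<in> choices p r"
proof -
  let ?\<pi> = "digit_parts p \<mu>"
  define s where "s i = sum_mset (?\<pi> i)" for i
  have tc: "to_choice p \<mu> = (s, ?\<pi>)" by (simp add: to_choice_def s_def fun_eq_iff)
  have no0: "0 \<notin># ?\<pi> i" for i
    using \<mu> by (simp add: count_digit_parts not_in_iff partitions_of_def is_partition_of_def)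
  have cnt: "count \<mu> a \<le> r" for a
    using \<mu> count_le_sum_mset[of a \<mu>] by (cases "a = 0") (auto simp: partitions_of_def is_partition_of_def not_in_iff)
  have big: "?\<pi> i = {#}" if "\<not> i < Suc r" for i
  proof (rule multiset_eqI)
    fix a
    have "i < p ^ i" using p by (meson less_exp order_less_le_trans power_mono zero_le)
    then have "count \<mu> a < p ^ i" using cnt[of a] that by simp
    then show "count (?\<pi> i) a = count {#} a" by (simp add: count_digit_parts)
  qed
  have sub: "{i. s i \<noteq> 0} \<subseteq> {..<Suc r}" using big by (force simp: s_def)
  have "(\<Sum>i | s i \<noteq> 0. s i * p ^ i) = (\<Sum>i<Suc r. s i * p ^ i)"
    using sub by (intro sum.mono_neutral_left) auto
  also have "\<dots> = sum_mset (of_choice p r (to_choice p \<mu>))"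
    unfolding of_choice_def
    by (simp add: sum_mset_sum sum_mset_repeat tc s_def mult.commute del: sum.lessThan_Suc)
  also have "\<dots> = r"
    unfolding of_choice_to_choice[OF p \<mu>] using \<mu> by (simp add: partitions_of_def is_partition_of_def)
  finally have sum: "(\<Sum>i | s i \<noteq> 0. s i * p ^ i) = r" .
  have empty: "?\<pi> i = {#}" if "s i = 0" for i
    using size_le_sum_mset[OF no0[of i]] that unfolding s_def by (simp del: sum_mset_0_iff)
  have reg: "p_regular p (?\<pi> i)" for i
    using p by (simp add: p_regular_def count_digit_parts)
  have "finite {i. s i \<noteq> 0}" using sub by (rule finite_subset) simp
  then show ?thesis
    using sum empty reg no0 unfolding tc by (auto simp: choices_def is_partition_of_def s_def[symmetric])
qed

lemma to_choice_of_choice: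
  assumes p: "2 \<le> p" and c: "(s, \<pi>) \<in> choices p r"
  shows "to_choice p (of_choice p r (s, \<pi>)) = (s, \<pi>)"
proof -
  have "digit_parts p (of_choice p r (s, \<pi>)) i = \<pi> i" for i
  proof (rule multiset_eqI)
    fix a
    have "count (digit_parts p (of_choice p r (s, \<pi>)) i) a =
      (\<Sum>j<Suc r. p ^ j * count (\<pi> j) a) div p ^ i mod p"
      by (simp add: count_digit_parts of_choice_def count_sum del: sum.lessThan_Suc)
    also have "\<dots> = (if i < Suc r then count (\<pi> i) a else 0)"
      by (rule digit_of_sum) (use p choice_parts(3)[OF c] in auto)
    also have "\<dots> = count (\<pi> i) a"
    proof (cases "i < Suc r")
      case False
      then have "s i = 0" using choice_bound[OF p c] by blast
      then have "size (\<pi> i) \<le> 0" using size_le_sum_mset[OF choice_parts(2)[OF c]] choice_parts(1)[OF c] by metis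
      with False show ?thesis by simp
    qed simp
    finally show "count (digit_parts p (of_choice p r (s, \<pi>)) i) a = count (\<pi> i) a" .
  qed
  then show ?thesis using choice_parts(1)[OF c] by (auto simp: to_choice_def fun_eq_iff)
qed

lemma choices_bij_partitions:
  assumes p: "2 \<le> p"
  shows "bij_betw (of_choice p r) (choices p r) (partitions_of r)"
  by (rule bij_betwI[where g = "to_choice p"])
    (use of_choice_in_partitions[OF p] to_choice_in_choices[OF p] of_choice_to_choice[OF p]
      to_choice_of_choice[OF p] in auto)

text \<open>A partition of \<open>r\<close> has at most \<open>r\<close> parts, so it can be padded
  with zeros to length \<open>n\<close> and listed in decreasing order; deleting the zeros undoes
  this.\<close>

lemma partitions_bij_compositions:
  assumes n: "r \<le> n"
  shows "bij_betw (\<lambda>\<mu>. rev (sorted_list_of_multiset (\<mu> + replicate_mset (n - size \<mu>) 0)))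
    (partitions_of r) {l \<in> compositions r n. sorted_wrt (\<ge>) l}"
proof (rule bij_betwI[where g = "\<lambda>l. filter_mset (\<lambda>a. a \<noteq> 0) (mset l)"])
  let ?f = "\<lambda>\<mu>. rev (sorted_list_of_multiset (\<mu> + replicate_mset (n - size \<mu>) 0))"
  have filt: "filter_mset (\<lambda>a. a \<noteq> 0) \<mu> = \<mu>" if "\<mu> \<in> partitions_of r" for \<mu>
    using that by (auto simp: partitions_of_def is_partition_of_def filter_mset_eq_conv intro!: gr0I)
  have size: "size \<mu> \<le> n" if "\<mu> \<in> partitions_of r" for \<mu>
    using that n size_le_sum_mset[of \<mu>] by (auto simp: partitions_of_def is_partition_of_def)
  have msum: "sum_list l = sum_mset (mset l)" for l :: "nat list" by (simp add: sum_mset_sum_list)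
  show "?f \<in> partitions_of r \<rightarrow> {l \<in> compositions r n. sorted_wrt (\<ge>) l}"
  proof
    fix \<mu> assume \<mu>: "\<mu> \<in> partitions_of r"
    have "length (?f \<mu>) = n" using size[OF \<mu>] by (simp add: size_mset[symmetric] del: size_mset)
    moreover have "sum_list (?f \<mu>) = r"
      using \<mu> by (simp add: msum partitions_of_def is_partition_of_def del: sum_mset_sum_list)
    moreover have "sorted_wrt (\<ge>) (?f \<mu>)"
      by (simp add: sorted_wrt_rev sorted_sorted_list_of_multiset)
    ultimately show "?f \<mu> \<in> {l \<in> compositions r n. sorted_wrt (\<ge>) l}" by (simp add: compositions_def)
  qed
  show "(\<lambda>l. filter_mset (\<lambda>a. a \<noteq> 0) (mset l)) \<in> {l \<in> compositions r n. sorted_wrt (\<ge>) l} \<rightarrow> partitions_of r"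
  proof
    fix l assume "l \<in> {l \<in> compositions r n. sorted_wrt (\<ge>) l}"
    then have "sum_list l = r" by (simp add: compositions_def)
    moreover have "sum_mset (filter_mset (\<lambda>a. a \<noteq> 0) (mset l)) = sum_list l" by (induction l) auto
    ultimately show "filter_mset (\<lambda>a. a \<noteq> 0) (mset l) \<in> partitions_of r"
      by (simp add: partitions_of_def is_partition_of_def)
  qed
  show "filter_mset (\<lambda>a. a \<noteq> 0) (mset (?f \<mu>)) = \<mu>" if "\<mu> \<in> partitions_of r" for \<mu>
    using filt[OF that] by simp
  show "?f (filter_mset (\<lambda>a. a \<noteq> 0) (mset l)) = l" if "l \<in> {l \<in> compositions r n. sorted_wrt (\<ge>) l}" for l
  proof -
    have len: "length l = n" and desc: "sorted_wrt (\<ge>) l" using that by (simp_all add: compositions_def)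
    have "filter_mset (\<lambda>a. a \<noteq> 0) (mset l) +
        replicate_mset (length l - size (filter_mset (\<lambda>a. a \<noteq> 0) (mset l))) 0 = mset l" for l :: "nat list"
    proof -
      let ?F = "filter_mset (\<lambda>a. a \<noteq> 0) (mset l)"
      have part: "mset l = ?F + replicate_mset (count (mset l) 0) 0"
        using multiset_partition[of "mset l" "\<lambda>a. a \<noteq> 0"] by (simp add: filter_eq_replicate_mset)
      then have "length l = size ?F + count (mset l) 0"
        by (metis size_mset size_replicate_mset size_union)
      with part show ?thesis by (metis add_diff_cancel_left')
    qed
    then have "?f (filter_mset (\<lambda>a. a \<noteq> 0) (mset l)) = rev (sort l)"
      unfolding len[symmetric] by (simp add: sorted_list_of_multiset_mset)
    also have "sort l = rev l"
      by (rule properties_for_sort) (use desc in \<open>simp_all add: sorted_wrt_rev\<close>)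
    finally show ?thesis by simp
  qed
qed

text \<open>The first conjunct counts the isomorphism classes of the irreducible modules whose elements
  are sets of elements of the algebra. Every irreducible module is isomorphic to the quotient of
  the algebra by a maximal left ideal, hence to one of these. The second conjunct states this for
  irreducible modules over an arbitrary type.\<close>

theorem mainTheorem3:
  fixes r n p :: nat
    and B :: "(schur_index \<Rightarrow> 'k::field) ring"
  assumes "r \<ge> 1" and "n \<ge> r"
    and "CHAR('k) = p" and "p > 0"
    and "B = right_schur_algebra r n"
  shows "(\<exists>\<Phi>. bij_betw \<Phi> (choices p r)
             (irreducible_classes B ::
                (schur_index \<Rightarrow> 'k, (schur_index \<Rightarrow> 'k) set) module set set)) \<and>
         (\<forall>M :: (schur_index \<Rightarrow> 'k, 'm) module. irreducible_left_module B M \<longrightarrow>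
            (\<exists>N :: (schur_index \<Rightarrow> 'k, (schur_index \<Rightarrow> 'k) set) module.
               irreducible_left_module B N \<and> left_module_iso B M N))"
proof -
  interpret words r n .
  let ?R = "right_schur_algebra r n :: (schur_index \<Rightarrow> 'k) ring"
  interpret weighted_ring ?R "range scalar" weight_idem "compositions r n"
    by (rule weighted_ring_schur)
  \<comment> \<open>Since \<open>1 \<noteq> 0\<close> in a field, \<open>p\<close> is at least 2 and
    can serve as a base.\<close>
  have "p \<noteq> 1"
  proof
    assume "p = 1"
    then have "(1 :: 'k) = 0" using of_nat_CHAR[where 'a = 'k] assms(3) by simp
    then show False by simp
  qed
  then have p: "2 \<le> p" using assms(4) by simp
  obtain \<Phi> where "bij_betw \<Phi> {l \<in> compositions r n. sorted_wrt (\<ge>) l}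
      (irreducible_classes ?R :: (schur_index \<Rightarrow> 'k, (schur_index \<Rightarrow> 'k) set) module set set)"
    using irreducible_classes_bij unfolding dominant_weights_schur by blast
  from bij_betw_trans[OF bij_betw_trans[OF choices_bij_partitions[OF p] partitions_bij_compositions[OF assms(2)]] this]
  show ?thesis unfolding assms(5) using irreducible_iso_quotient by blast
qed

end
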